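(* Let $N\ge 2$, $\beta\in\,]0,\pi[$, $l\in\Sigma_\beta$, $\nu_l=\frac{N+2l-2}{2}$, and let $\lambda_*\neq 0$ be a solution of the equation $J_{\nu_l}(\sqrt{\lambda})=0$ in the unknown $\lambda\in[0,\infty[$. Then for any $\epsilon>0$ sufficiently small there exists a unique solution $\lambda(\epsilon)$ to the equation $$J_{\nu_l}(\sqrt{\lambda})\,Y_{\nu_l}(\epsilon\sqrt{\lambda})-Y_{\nu_l}(\sqrt{\lambda})\,J_{\nu_l}(\epsilon\sqrt{\lambda})=0$$ such that $\lambda(\epsilon)\to\lambda_*$ as $\epsilon\to 0$, and it satisfies $$\lambda(\epsilon)=\lambda_*+a\,|\Omega_\beta\setminus\Omega_\beta(\epsilon)|^{\frac{N+2l-2}{N}}+o\Bigl(|\Omega_\beta\setminus\Omega_\beta(\epsilon)|^{\frac{N+2l-2}{N}}\Bigr)\quad\text{as }\epsilon\to0^+,$$ for some constant $a>0$. In particular, $$\lambda_1[\Omega_\beta(\epsilon)]=\lambda_1[\Omega_\beta]+b\,|\Omega_\beta\setminus\Omega_\beta(\epsilon)|^{\frac{N+2l_\beta-2}{N}}+o\Bigl(|\Omega_\beta\setminus\Omega_\beta(\epsilon)|^{\frac{N+2l_\beta-2}{N}}\Bigr)\quad\text{as }\epsilon\to0^+,$$ for some constant $b>0$.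
   Context: For $\beta\in\,]0,\pi[$, $\Omega_\beta=\{x\in\mathbb{R}^N: 0<|x|<1,\ x_1>|x|\cos\beta\}$ is the spherical cone of points of the punctured unit ball whose angle with the positive $x_1$-axis is less than $\beta$; for $\epsilon\in\,]0,1[$, $\Omega_\beta(\epsilon)=\{x\in\Omega_\beta: |x|>\epsilon\}$. $|E|$ denotes the Lebesgue measure of $E$. $C_\beta=\overline{\Omega}_\beta\cap S^{N-1}$ is the corresponding spherical cap, and $\delta$ denotes the Laplace–Beltrami operator on the unit sphere $S^{N-1}$. $\Sigma_\beta$ is the set of positive real numbers $l$ such that the problem $-\delta\Theta=l(l+N-2)\Theta$ in $C_\beta$, $\Theta=0$ on $\partial C_\beta$ (boundary relative to $S^{N-1}$) has a nontrivial solution; $l_\beta=\min\Sigma_\beta$. $J_\nu$ and $Y_\nu$ denote the Bessel functions of order $\nu$ of the first and second kind. For a bounded open set $\Omega$, $\lambda_1[\Omega]$ denotes the first eigenvalue of the Dirichlet Laplacian on $\Omega$. *)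

theory Defs
  imports "HOL-Analysis.Analysis" "HOL-Library.Landau_Symbols"
begin

section \<open>Truncated spherical cones\<close>

text \<open>The index \<open>k\<close> names the coordinate that plays the role of \<open>x\<^sub>1\<close>; the dimension \<open>N\<close> is
  \<open>CARD('n)\<close>.\<close>

definition sph_cone :: "'n::finite \<Rightarrow> real \<Rightarrow> (real ^ 'n) set" where
  "sph_cone k \<beta> = {x. 0 < norm x \<and> norm x < 1 \<and> x $ k > norm x * cos \<beta>}"

definition trunc_cone :: "'n::finite \<Rightarrow> real \<Rightarrow> real \<Rightarrow> (real ^ 'n) set" where
  "trunc_cone k \<beta> \<epsilon> = {x \<in> sph_cone k \<beta>. norm x > \<epsilon>}"

definition cap :: "'n::finite \<Rightarrow> real \<Rightarrow> (real ^ 'n) set" where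
  "cap k \<beta> = closure (sph_cone k \<beta>) \<inter> sphere 0 1"


section \<open>The Laplace--Beltrami operator on the unit sphere\<close>

definition grad :: "(real ^ 'n::finite \<Rightarrow> real) \<Rightarrow> real ^ 'n \<Rightarrow> real ^ 'n" where
  "grad f x = (\<chi> i. frechet_derivative f (at x) (axis i 1))"

definition C2_on :: "(real ^ 'n::finite) set \<Rightarrow> (real ^ 'n \<Rightarrow> real) \<Rightarrow> bool" where
  "C2_on W f \<longleftrightarrow>
     (\<forall>x\<in>W. f differentiable (at x) \<and> (\<forall>i. (\<lambda>y. grad f y $ i) differentiable (at x))) \<and>
     (\<forall>i. continuous_on W (grad (\<lambda>y. grad f y $ i)))"

text \<open>Functions on the sphere are differentiated through their extension that is constant along
  rays. The gradient of that extension at a point of the sphere is tangential and is the Riemannian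
  gradient for the induced metric; the trace of the tangential derivative of a tangential vector
  field is its Riemannian divergence. Only the values of the function on the sphere enter.\<close>

definition radial_ext :: "(real ^ 'n::finite \<Rightarrow> real) \<Rightarrow> real ^ 'n \<Rightarrow> real" where
  "radial_ext \<Theta> y = \<Theta> (y /\<^sub>R norm y)"

definition sphere_grad :: "(real ^ 'n::finite \<Rightarrow> real) \<Rightarrow> real ^ 'n \<Rightarrow> real ^ 'n" where
  "sphere_grad \<Theta> x = grad (radial_ext \<Theta>) x"

definition sphere_div :: "(real ^ 'n::finite \<Rightarrow> real ^ 'n) \<Rightarrow> real ^ 'n \<Rightarrow> real" where
  "sphere_div V x = (\<Sum>i\<in>UNIV. sphere_grad (\<lambda>y. V y $ i) x $ i)"

definition laplace_beltrami :: "(real ^ 'n::finite \<Rightarrow> real) \<Rightarrow> real ^ 'n \<Rightarrow> real" where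
  "laplace_beltrami \<Theta> x = sphere_div (sphere_grad \<Theta>) x"

text \<open>Twice continuous differentiability on a relatively open subset \<open>U\<close> of the sphere.\<close>

definition sphere_C2_on :: "(real ^ 'n::finite) set \<Rightarrow> (real ^ 'n \<Rightarrow> real) \<Rightarrow> bool" where
  "sphere_C2_on U \<Theta> \<longleftrightarrow> C2_on {y. y \<noteq> 0 \<and> y /\<^sub>R norm y \<in> U} (radial_ext \<Theta>)"


section \<open>The characteristic exponents of a cone\<close>

text \<open>Solutions are classical: continuous on the closed cap, twice continuously differentiable in
  its interior relative to the sphere, where the equation holds.\<close>

definition cap_solution :: "'n::finite \<Rightarrow> real \<Rightarrow> real \<Rightarrow> (real ^ 'n \<Rightarrow> real) \<Rightarrow> bool" where
  "cap_solution k \<beta> l \<Theta> \<longleftrightarrow>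
     (let S = top_of_set (sphere (0 :: real ^ 'n) 1) in
       continuous_on (cap k \<beta>) \<Theta> \<and>
       sphere_C2_on (S interior_of cap k \<beta>) \<Theta> \<and>
       (\<forall>x \<in> S interior_of cap k \<beta>.
          - laplace_beltrami \<Theta> x = l * (l + real CARD('n) - 2) * \<Theta> x) \<and>
       (\<forall>x \<in> S frontier_of cap k \<beta>. \<Theta> x = 0))"

definition cone_exponents :: "'n::finite \<Rightarrow> real \<Rightarrow> real set" where
  "cone_exponents k \<beta> = {l. 0 < l \<and> (\<exists>\<Theta>. cap_solution k \<beta> l \<Theta> \<and> (\<exists>x\<in>cap k \<beta>. \<Theta> x \<noteq> 0))}"

definition least_exponent :: "'n::finite \<Rightarrow> real \<Rightarrow> real" where
  "least_exponent k \<beta> = (LEAST l. l \<in> cone_exponents k \<beta>)"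


section \<open>Bessel functions of real order on the positive half-line\<close>

text \<open>The reciprocal Gamma function vanishes at the poles of Gamma, so the series is the usual one
  for negative integer orders as well. Since \<open>0 powr \<nu> = 0\<close>, the value at \<open>z = 0\<close> is the usual one
  for \<open>\<nu> > 0\<close> only. For integer order the Bessel function of the second kind is
  the usual limit in the order.\<close>

definition bessel_J :: "real \<Rightarrow> real \<Rightarrow> real" where
  "bessel_J \<nu> z =
     (\<Sum>m. (- 1) ^ m / fact m * rGamma (\<nu> + real m + 1) * (z / 2) ^ (2 * m)) * (z / 2) powr \<nu>"

definition bessel_Y :: "real \<Rightarrow> real \<Rightarrow> real" where
  "bessel_Y \<nu> z =
     (let q = (\<lambda>\<mu>. (bessel_J \<mu> z * cos (\<mu> * pi) - bessel_J (- \<mu>) z) / sin (\<mu> * pi))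
      in if \<nu> \<in> \<int> then Lim (at \<nu>) q else q \<nu>)"


section \<open>The first eigenvalue of the Dirichlet Laplacian\<close>

definition test_function :: "(real ^ 'n::finite) set \<Rightarrow> (real ^ 'n \<Rightarrow> real) \<Rightarrow> bool" where
  "test_function \<Omega> \<phi> \<longleftrightarrow>
     (\<forall>x. \<phi> differentiable (at x)) \<and> continuous_on UNIV (grad \<phi>) \<and>
     compact (closure {x. \<phi> x \<noteq> 0}) \<and> closure {x. \<phi> x \<noteq> 0} \<subseteq> \<Omega>"

definition L2_on :: "(real ^ 'n::finite) set \<Rightarrow> (real ^ 'n \<Rightarrow> 'b::euclidean_space) \<Rightarrow> bool" where
  "L2_on \<Omega> f \<longleftrightarrow> f \<in> borel_measurable (lebesgue_on \<Omega>) \<and> integrable (lebesgue_on \<Omega>) (\<lambda>x. (norm (f x))\<^sup>2)"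

text \<open>\<open>H10 \<Omega> u g\<close> says that \<open>u\<close> belongs to the Sobolev space \<open>H\<^sup>1\<^sub>0(\<Omega>)\<close>, the closure of the
  \<open>C\<^sup>1\<close> functions with compact support in \<open>\<Omega>\<close> for the \<open>H\<^sup>1\<close> norm, and that \<open>g\<close> is its weak
  gradient. An eigenvalue is taken in the usual weak sense.\<close>

definition H10 ::
  "(real ^ 'n::finite) set \<Rightarrow> (real ^ 'n \<Rightarrow> real) \<Rightarrow> (real ^ 'n \<Rightarrow> real ^ 'n) \<Rightarrow> bool" where
  "H10 \<Omega> u g \<longleftrightarrow> L2_on \<Omega> u \<and> L2_on \<Omega> g \<and>
     (\<exists>\<phi>. (\<forall>n. test_function \<Omega> (\<phi> n)) \<and>
        (\<lambda>n. \<integral>x. (\<phi> n x - u x)\<^sup>2 \<partial>lebesgue_on \<Omega>) \<longlonglongrightarrow> 0 \<and>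
        (\<lambda>n. \<integral>x. (norm (grad (\<phi> n) x - g x))\<^sup>2 \<partial>lebesgue_on \<Omega>) \<longlonglongrightarrow> 0)"

definition dirichlet_eigenvalue :: "(real ^ 'n::finite) set \<Rightarrow> real \<Rightarrow> bool" where
  "dirichlet_eigenvalue \<Omega> \<Lambda> \<longleftrightarrow>
     (\<exists>u g. H10 \<Omega> u g \<and> \<not> (AE x in lebesgue_on \<Omega>. u x = 0) \<and>
        (\<forall>\<phi>. test_function \<Omega> \<phi> \<longrightarrow>
           (\<integral>x. inner (g x) (grad \<phi> x) \<partial>lebesgue_on \<Omega>) = \<Lambda> * (\<integral>x. u x * \<phi> x \<partial>lebesgue_on \<Omega>)))"

definition dirichlet_lambda1 :: "(real ^ 'n::finite) set \<Rightarrow> real" where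
  "dirichlet_lambda1 \<Omega> = (LEAST \<Lambda>. dirichlet_eigenvalue \<Omega> \<Lambda>)"

end

theory Submission
  imports Defs "HOL-Real_Asymp.Real_Asymp"
begin

text \<open>Put \<open>h = J / Y\<close> (order \<open>\<nu> > 0\<close>). Near \<open>\<lambda>\<^sub>*\<close> the cross product vanishes iff
  \<open>J (\<surd>\<mu>) = Y (\<surd>\<mu>) h (\<epsilon> \<surd>\<mu>)\<close>, and \<open>h z\<close> is asymptotic to a negative multiple of
  \<open>z\<^bsup>2\<nu>\<^esup>\<close>. The Wronskian gives \<open>J' Y < 0\<close> at a zero of \<open>J\<close>, so this is a small perturbation of a
  simple root, with a positive leading coefficient of order \<open>\<epsilon>\<^bsup>2\<nu>\<^esup>\<close>; the removed volume is a
  multiple of \<open>\<epsilon>\<^bsup>N\<^esup>\<close>.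

  For the smallest \<open>\<kappa>\<close> such that the zonal (hypergeometric) solution vanishes somewhere on the
  closed cap, that solution vanishes at the boundary only; a maximum principle against the positive zonal
  solutions for smaller \<open>\<kappa>\<close> shows that this \<open>\<kappa>\<close> belongs to the least exponent. A positive function that
  solves \<open>- \<Delta> u = L u\<close> and vanishes on the boundary forces \<open>\<lambda>\<^sub>1 = L\<close> by Jacobi's identity, so that
  \<open>\<lambda>\<^sub>1\<close> of both domains is read off from positive products of a Bessel profile and the zonal
  function.\<close>

section \<open>Gradients and integration by parts\<close>

text \<open>No spectral theory is developed. \<open>dirichlet_lambda1\<close> is a least weak
  eigenvalue, so it is enough that one number is an eigenvalue and that none is smaller. That none
  is smaller is Jacobi's argument; the delicate half is that the explicit solution lies in
  \<open>H10\<close>, since near the vertex and the edges its gradient is not controlled in advance.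
  Truncating the values of the solution, not its domain, settles this without boundary regularity.
  The order \<open>\<nu>\<close> is an arbitrary positive real, and at integers
  \<open>bessel_Y\<close> is a limit in the order. It is computed by differentiating
  \<open>bessel_J\<close> in the order, across the poles of Gamma; this is the source of the bounds
  on the derivative of \<open>rGamma\<close>, uniform on compact sets of orders. A solution on the
  cap may depend on all angles, so zonal functions alone cannot rule out a smaller exponent; hence
  the comparison argument. Zeros of \<open>bessel_J\<close> and of zonal functions both come from
  one Riccati estimate, and the smallest \<open>\<kappa>\<close> from compactness of a set of zeros
  (\<open>\<kappa>\<close>, \<open>s\<close>).\<close>

lemma GDERIV_imp_grad:
  assumes "GDERIV f x :> D"
  shows "grad f x = D"
proof -
  have "frechet_derivative f (at x) = (\<lambda>h. inner h D)"
    using frechet_derivative_at[OF assms[unfolded gderiv_def]] by simp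
  then show ?thesis
    by (simp add: grad_def vec_eq_iff inner_axis')
qed

lemma differentiable_imp_GDERIV:
  fixes f :: "real ^ 'n::finite \<Rightarrow> real"
  assumes "f differentiable (at x)"
  shows "GDERIV f x :> grad f x"
proof -
  have D: "(f has_derivative frechet_derivative f (at x)) (at x)"
    using assms frechet_derivative_works by blast
  then have "linear (frechet_derivative f (at x))"
    using has_derivative_linear by blast
  then have "frechet_derivative f (at x) h = inner h (grad f x)" for h
    by (subst (1) basis_expansion[of h, symmetric])
       (simp add: linear_sum linear_scale grad_def inner_vec_def scalar_mult_eq_scaleR del: basis_expansion)
  then show ?thesis
    using D unfolding gderiv_def by presburger
qed

lemma GDERIV_imp_differentiable: "GDERIV f x :> D \<Longrightarrow> f differentiable (at x)"
  unfolding gderiv_def differentiable_def by blast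

lemma GDERIV_line:
  assumes "GDERIV f (x + t *\<^sub>R e) :> D"
  shows "((\<lambda>t. f (x + t *\<^sub>R e)) has_real_derivative (e \<bullet> D)) (at t)"
proof -
  have 1: "((\<lambda>t. x + t *\<^sub>R e) has_derivative (\<lambda>h. h *\<^sub>R e)) (at t)"
    by (auto intro!: derivative_eq_intros)
  have "((\<lambda>t. f (x + t *\<^sub>R e)) has_derivative (\<lambda>h. (h *\<^sub>R e) \<bullet> D)) (at t)"
    using has_derivative_compose[OF 1 assms[unfolded gderiv_def]] .
  then show ?thesis
    unfolding has_field_derivative_def by (rule has_derivative_eq_rhs) auto
qed

lemma GDERIV_cong_open:
  assumes "GDERIV f x :> D" "open S" "x \<in> S" "\<And>y. y \<in> S \<Longrightarrow> f y = g y"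
  shows "GDERIV g x :> D"
  using assms unfolding gderiv_def
  by (metis has_derivative_transform_within_open)

section \<open>Translation invariance and integrals of partial derivatives\<close>

lemma lborel_distr_plus: "distr lborel borel ((+) (c :: 'a::euclidean_space)) = lborel"
  using lborel_affine[of 1 c] by (simp add: density_1)

lemma lborel_integral_translate:
  fixes f :: "'a::euclidean_space \<Rightarrow> real"
  assumes "f \<in> borel_measurable borel"
  shows "(\<integral>x. f (c + x) \<partial>lborel) = (\<integral>x. f x \<partial>lborel)"
proof -
  have "(\<integral>x. f x \<partial>lborel) = (\<integral>x. f x \<partial>distr lborel borel ((+) c))"
    by (simp add: lborel_distr_plus)
  also have "\<dots> = (\<integral>x. f (c + x) \<partial>lborel)"
    using assms by (intro integral_distr) auto
  finally show ?thesis by simp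
qed

lemma emeasure_cball_finite: "emeasure lborel (cball (a::'a::euclidean_space) R) < top"
  using emeasure_bounded_finite[OF bounded_cball[of a R]] by (simp add: less_top)

lemma integrable_cball_bounded:
  fixes f :: "'a::euclidean_space \<Rightarrow> real"
  assumes "f \<in> borel_measurable borel" "\<And>x. \<bar>f x\<bar> \<le> B" "\<And>x. norm x > R \<Longrightarrow> f x = 0"
  shows "integrable lborel f"
proof (rule Bochner_Integration.integrable_bound)
  show "integrable lborel (\<lambda>x. indicator (cball 0 R) x *\<^sub>R B)"
    by (intro integrable_scaleR_left integrable_real_indicator)
       (auto simp: emeasure_cball_finite)
  show "AE x in lborel. norm (f x) \<le> norm (indicator (cball 0 R) x *\<^sub>R B)"
  proof (rule AE_I2)
    fix x :: 'a
    show "norm (f x) \<le> norm (indicator (cball 0 R) x *\<^sub>R B)"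
      using assms(2)[of x] assms(3)[of x] by (cases "norm x \<le> R") auto
  qed
qed (use assms in auto)

text \<open>Translation invariance makes the integral of every difference quotient vanish; dominated
  convergence carries this over to the derivative.\<close>

lemma integral_partial_derivative_eq_0:
  fixes f :: "real ^ 'n::finite \<Rightarrow> real"
  assumes D: "\<And>x. GDERIV f x :> D x" and cont: "continuous_on UNIV (\<lambda>x. D x $ i)"
    and supp: "\<And>x. norm x > R \<Longrightarrow> f x = 0"
  shows "integrable lborel (\<lambda>x. D x $ i)" "(\<integral>x. D x $ i \<partial>lborel) = 0"
proof -
  let ?e = "axis i (1::real) :: real ^ 'n"
  have fcont: "continuous_on UNIV f"
    using D unfolding gderiv_def
    by (meson has_derivative_continuous continuous_at_imp_continuous_on)
  have fmeas [measurable]: "f \<in> borel_measurable borel"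
    using fcont by (rule borel_measurable_continuous_onI)
  have Dmeas [measurable]: "(\<lambda>x. D x $ i) \<in> borel_measurable borel"
    using cont by (rule borel_measurable_continuous_onI)
  have Dz: "D x = 0" if "norm x > R" for x
  proof -
    have "GDERIV f x :> 0"
      by (rule GDERIV_cong_open[OF GDERIV_const[of 0], of "- cball 0 R"])
         (use that supp in \<open>auto simp: dist_norm\<close>)
    then show ?thesis
      using GDERIV_imp_grad D by metis
  qed
  have "bounded ((\<lambda>x. D x $ i) ` cball 0 R)"
    by (intro compact_imp_bounded compact_continuous_image continuous_on_subset[OF cont]) auto
  then obtain B0 where B0: "\<And>x. norm x \<le> R \<Longrightarrow> \<bar>D x $ i\<bar> \<le> B0"
    unfolding bounded_iff by (metis imageI mem_cball_0 real_norm_def)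
  define B where "B = max B0 0"
  have B: "\<bar>D x $ i\<bar> \<le> B" for x
    using B0[of x] Dz[of x] unfolding B_def by (cases "norm x \<le> R") auto
  show I: "integrable lborel (\<lambda>x. D x $ i)"
    by (rule integrable_cball_bounded[OF Dmeas B, of R]) (simp add: Dz)
  have fI: "integrable lborel f"
  proof -
    have "bounded (f ` cball 0 R)"
      by (intro compact_imp_bounded compact_continuous_image continuous_on_subset[OF fcont]) auto
    then obtain C where C: "\<And>x. norm x \<le> R \<Longrightarrow> \<bar>f x\<bar> \<le> C"
      unfolding bounded_iff by (metis imageI mem_cball_0 real_norm_def)
    have "\<bar>f x\<bar> \<le> max C 0" for x
      using C[of x] supp[of x] by (cases "norm x \<le> R") auto
    then show ?thesis
      by (rule integrable_cball_bounded[OF fmeas, of _ R]) (simp add: supp)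
  qed
  define q where "q n x = (f (inverse (Suc n) *\<^sub>R ?e + x) - f x) * Suc n" for n :: nat and x
  have qm: "q n \<in> borel_measurable lborel" for n
    unfolding q_def by measurable
  have q0: "integral\<^sup>L lborel (q n) = 0" for n
  proof -
    have "integrable lborel (\<lambda>x. f (inverse (Suc n) *\<^sub>R ?e + x))"
    proof -
      have "integrable (distr lborel borel ((+) (inverse (Suc n) *\<^sub>R ?e))) f"
        using fI by (simp add: lborel_distr_plus)
      then show ?thesis
        by (subst (asm) integrable_distr_eq) auto
    qed
    then show ?thesis
      using fI lborel_integral_translate[OF fmeas] unfolding q_def by simp
  qed
  \<comment> \<open>By the mean value theorem each quotient is a value of the partial derivative at
    a nearby point, which gives a bound independent of \<open>n\<close>.\<close>
  have qb: "\<bar>q n x\<bar> \<le> B" for n x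
  proof -
    have "\<exists>z>0. z < inverse (real (Suc n)) \<and> f (x + inverse (real (Suc n)) *\<^sub>R ?e) - f (x + 0 *\<^sub>R ?e) =
        (inverse (real (Suc n)) - 0) * (?e \<bullet> D (x + z *\<^sub>R ?e))"
      by (rule MVT2) (auto intro!: GDERIV_line D)
    then obtain z where "f (x + inverse (real (Suc n)) *\<^sub>R ?e) - f x = inverse (real (Suc n)) * (D (x + z *\<^sub>R ?e) $ i)"
      by (auto simp: inner_axis')
    then have "q n x = D (x + z *\<^sub>R ?e) $ i"
      unfolding q_def by (simp add: add.commute)
    then show ?thesis using B by metis
  qed
  \<comment> \<open>All shifts have length at most 1, so the ball of radius \<open>R + 1\<close>
    carries every quotient.\<close>
  have qs: "q n x = 0" if "norm x > R + 1" for n x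
  proof -
    have "norm x \<le> norm (inverse (Suc n) *\<^sub>R ?e + x) + norm (inverse (Suc n) *\<^sub>R ?e)"
      using norm_triangle_ineq4[of "inverse (real (Suc n)) *\<^sub>R ?e + x" "inverse (real (Suc n)) *\<^sub>R ?e"] by simp
    also have "norm (inverse (real (Suc n)) *\<^sub>R ?e) \<le> 1"
      by (simp add: inverse_le_1_iff)
    finally show ?thesis
      using that supp[of x] supp[of "inverse (Suc n) *\<^sub>R ?e + x"] unfolding q_def by simp
  qed
  have lim: "(\<lambda>n. q n x) \<longlonglongrightarrow> D x $ i" for x
  proof -
    have "((\<lambda>t. f (x + t *\<^sub>R ?e)) has_real_derivative (?e \<bullet> D x)) (at 0)"
      using GDERIV_line[of f x 0 ?e "D x"] D by simp
    then have "(\<lambda>h. (f (x + h *\<^sub>R ?e) - f x) / h) \<midarrow>0\<rightarrow> D x $ i"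
      by (simp add: DERIV_def inner_axis')
    moreover have "filterlim (\<lambda>n. inverse (real (Suc n))) (at 0) sequentially"
      using LIMSEQ_inverse_real_of_nat by (auto simp: filterlim_at)
    ultimately have "(\<lambda>n. (f (x + inverse (real (Suc n)) *\<^sub>R ?e) - f x) / inverse (real (Suc n))) \<longlonglongrightarrow> D x $ i"
      by (rule filterlim_compose)
    then show ?thesis
      unfolding q_def by (simp add: divide_inverse add.commute)
  qed
  have "(\<lambda>n. integral\<^sup>L lborel (q n)) \<longlonglongrightarrow> (\<integral>x. D x $ i \<partial>lborel)"
  proof (rule integral_dominated_convergence)
    show "integrable lborel (\<lambda>x. indicator (cball 0 (R+1) :: (real^'n) set) x *\<^sub>R B)"
      by (intro integrable_scaleR_left integrable_real_indicator)
         (auto simp: emeasure_cball_finite)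
    show "AE x in lborel. norm (q n x) \<le> indicator (cball 0 (R+1)) x *\<^sub>R B" for n
      using qb[of n] qs[of _ n] by (intro AE_I2) (auto simp: indicator_def)
  qed (use lim qm in auto)
  then show "(\<integral>x. D x $ i \<partial>lborel) = 0"
    by (simp add: q0 LIMSEQ_const_iff)
qed

section \<open>Extension by zero of functions with compact support\<close>

lemma continuous_on_UNIV_extend_by_0:
  fixes f :: "'a::t2_space \<Rightarrow> 'b::real_normed_vector"
  assumes "open \<Omega>" "compact C" "C \<subseteq> \<Omega>" "continuous_on \<Omega> f" "\<And>x. x \<in> \<Omega> - C \<Longrightarrow> f x = 0"
  shows "continuous_on UNIV (\<lambda>x. if x \<in> \<Omega> then f x else 0)" (is "continuous_on _ ?F")
proof -
  have "continuous_on (- C) ?F"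
    by (rule continuous_on_cong[THEN iffD2, OF refl _ continuous_on_const[of _ 0]]) (use assms in auto)
  moreover have "continuous_on \<Omega> ?F"
    by (rule continuous_on_cong[THEN iffD2, OF refl _ assms(4)]) auto
  ultimately have "continuous_on (\<Omega> \<union> - C) ?F"
    using assms by (intro continuous_on_open_Un) (auto intro: compact_imp_closed)
  moreover have "\<Omega> \<union> - C = UNIV"
    using assms(3) by auto
  ultimately show ?thesis by simp
qed

text \<open>Weak equations are stated over \<open>lebesgue_on \<Omega>\<close>, while translation
  invariance lives on \<open>lborel\<close>. A Borel measurable extension by 0 identifies the two
  integrals through the completion.\<close>

lemma integral_lebesgue_on_extend_by_0:
  fixes f :: "'a::euclidean_space \<Rightarrow> real"
  assumes "open \<Omega>" "(\<lambda>x. if x \<in> \<Omega> then f x else 0) \<in> borel_measurable borel"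
  shows "integrable (lebesgue_on \<Omega>) f \<longleftrightarrow> integrable lborel (\<lambda>x. if x \<in> \<Omega> then f x else 0)"
    and "(\<integral>x. f x \<partial>lebesgue_on \<Omega>) = (\<integral>x. (if x \<in> \<Omega> then f x else 0) \<partial>lborel)"
proof -
  have eq: "(\<lambda>x. indicator \<Omega> x *\<^sub>R f x) = (\<lambda>x. if x \<in> \<Omega> then f x else 0)"
    by (auto simp: fun_eq_iff)
  have "integrable (lebesgue_on \<Omega>) f \<longleftrightarrow> integrable lebesgue (\<lambda>x. if x \<in> \<Omega> then f x else 0)"
    using integrable_restrict_space[of \<Omega> lebesgue f] assms(1) unfolding eq by simp
  then show "integrable (lebesgue_on \<Omega>) f \<longleftrightarrow> integrable lborel (\<lambda>x. if x \<in> \<Omega> then f x else 0)"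
    using assms(2) by (simp add: integrable_completion)
  have "(\<integral>x. f x \<partial>lebesgue_on \<Omega>) = (\<integral>x. (if x \<in> \<Omega> then f x else 0) \<partial>lebesgue)"
    using integral_restrict_space[of \<Omega> lebesgue f] assms(1) unfolding eq by simp
  then show "(\<integral>x. f x \<partial>lebesgue_on \<Omega>) = (\<integral>x. (if x \<in> \<Omega> then f x else 0) \<partial>lborel)"
    using assms(2) by (simp add: integral_completion)
qed

lemma integrable_compact_support:
  fixes f :: "'a::euclidean_space \<Rightarrow> real"
  assumes "open \<Omega>" "compact C" "C \<subseteq> \<Omega>" "continuous_on \<Omega> f" "\<And>x. x \<in> \<Omega> - C \<Longrightarrow> f x = 0"
  shows "integrable (lebesgue_on \<Omega>) f"
    and "(\<integral>x. f x \<partial>lebesgue_on \<Omega>) = (\<integral>x. (if x \<in> \<Omega> then f x else 0) \<partial>lborel)"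
    and "integrable lborel (\<lambda>x. if x \<in> \<Omega> then f x else 0)"
proof -
  let ?F = "\<lambda>x. if x \<in> \<Omega> then f x else 0"
  have c: "continuous_on UNIV ?F"
    by (rule continuous_on_UNIV_extend_by_0[OF assms])
  then have m: "?F \<in> borel_measurable borel"
    by (rule borel_measurable_continuous_onI)
  obtain R where R: "\<And>x. x \<in> C \<Longrightarrow> norm x \<le> R"
    using compact_imp_bounded[OF assms(2)] unfolding bounded_iff by blast
  have "bounded (?F ` C)"
    by (intro compact_imp_bounded compact_continuous_image continuous_on_subset[OF c] assms) auto
  then obtain B where "\<forall>y \<in> ?F ` C. norm y \<le> B"
    unfolding bounded_iff by blast
  then have B: "\<bar>?F x\<bar> \<le> B" if "x \<in> C" for x
    using that by (metis (no_types, lifting) image_eqI real_norm_def)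
  have z: "?F x = 0" if "x \<notin> C" for x
    using assms(5) that by auto
  have b: "\<bar>?F x\<bar> \<le> max B 0" for x
  proof (cases "x \<in> C")
    case True
    then show ?thesis using B[OF True] by linarith
  next
    case False
    then show ?thesis unfolding z[OF False] by simp
  qed
  have r: "?F x = 0" if "norm x > R" for x
    using R that by (intro z) force
  show i: "integrable lborel ?F"
    by (rule integrable_cball_bounded[OF m b r])
  show "integrable (lebesgue_on \<Omega>) f" "(\<integral>x. f x \<partial>lebesgue_on \<Omega>) = (\<integral>x. ?F x \<partial>lborel)"
    using i integral_lebesgue_on_extend_by_0[OF assms(1) m] by auto
qed

section \<open>Recognising test functions and integrating against them by parts\<close>

lemma continuous_on_vec_nth:
  "(\<And>i. continuous_on S (\<lambda>x. f x $ i)) \<Longrightarrow> continuous_on S (f :: _ \<Rightarrow> real ^ 'n::finite)"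
  using continuous_on_vec_lambda[of S "\<lambda>i x. f x $ i"] by simp

lemma continuous_on_GDERIV: "(\<And>x. x \<in> S \<Longrightarrow> GDERIV f x :> g x) \<Longrightarrow> continuous_on S f"
  unfolding gderiv_def by (meson has_derivative_continuous continuous_at_imp_continuous_on)

text \<open>\<open>\<Omega>\<close> and the complement of \<open>C\<close> are open and cover the
  space. On the second set \<open>f\<close> vanishes, so differentiability and continuity of the
  gradient have to be checked only where \<open>G\<close> is given.\<close>

lemma test_function_local:
  fixes f :: "real ^ 'n::finite \<Rightarrow> real"
  assumes "open \<Omega>" "compact C" "C \<subseteq> \<Omega>" and z: "\<And>x. x \<notin> C \<Longrightarrow> f x = 0"
    and G: "\<And>x. x \<in> \<Omega> \<Longrightarrow> GDERIV f x :> G x" and cG: "continuous_on \<Omega> G"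
  shows "test_function \<Omega> f" "x \<in> \<Omega> \<Longrightarrow> grad f x = G x" "x \<notin> C \<Longrightarrow> grad f x = 0"
proof -
  have g: "x \<in> \<Omega> \<Longrightarrow> grad f x = G x" for x
    using G GDERIV_imp_grad by metis
  have G0: "GDERIV f x :> 0" if "x \<notin> C" for x
    by (rule GDERIV_cong_open[OF GDERIV_const[of 0], of "- C"])
       (use assms that in \<open>auto intro: compact_imp_closed\<close>)
  then have g0: "x \<notin> C \<Longrightarrow> grad f x = 0" for x
    using GDERIV_imp_grad by metis
  have "continuous_on UNIV (\<lambda>x. if x \<in> \<Omega> then G x else 0)"
    by (rule continuous_on_UNIV_extend_by_0[OF assms(1-3) cG]) (metis Diff_iff g g0)
  moreover have "grad f = (\<lambda>x. if x \<in> \<Omega> then G x else 0)"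
    using g g0 assms(3) by (auto simp: fun_eq_iff)
  ultimately have c: "continuous_on UNIV (grad f)"
    by presburger
  have "{x. f x \<noteq> 0} \<subseteq> C" using z by auto
  then have "closure {x. f x \<noteq> 0} \<subseteq> C"
    by (simp add: assms(2) closure_minimal compact_imp_closed)
  moreover have "f differentiable at x" for x
    using G[of x] G0[of x] assms(3) GDERIV_imp_differentiable by blast
  ultimately show "test_function \<Omega> f"
    unfolding test_function_def using c assms(2,3)
    by (meson bounded_subset closed_closure compact_eq_bounded_closed order_trans)
  show "x \<in> \<Omega> \<Longrightarrow> grad f x = G x" "x \<notin> C \<Longrightarrow> grad f x = 0"
    using g g0 by auto
qed

lemma test_function_GDERIV: "test_function \<Omega> \<phi> \<Longrightarrow> GDERIV \<phi> x :> grad \<phi> x"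
  using differentiable_imp_GDERIV unfolding test_function_def by blast

lemma test_function_continuous:
  assumes "test_function \<Omega> \<phi>"
  shows "continuous_on S \<phi>" "continuous_on S (grad \<phi>)"
proof -
  show "continuous_on S \<phi>"
    by (rule continuous_on_GDERIV) (rule test_function_GDERIV[OF assms])
  have "continuous_on UNIV (grad \<phi>)"
    using assms by (simp add: test_function_def)
  then show "continuous_on S (grad \<phi>)"
    by (rule continuous_on_subset) simp
qed

lemma test_function_support:
  assumes "test_function \<Omega> \<phi>"
  obtains C where "compact C" "C \<subseteq> \<Omega>" "\<forall>x. x \<notin> C \<longrightarrow> \<phi> x = 0 \<and> grad \<phi> x = 0"
proof
  let ?C = "closure {x. \<phi> x \<noteq> 0}"
  show "compact ?C" "?C \<subseteq> \<Omega>"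
    using assms by (simp_all add: test_function_def)
  have z: "\<phi> x = 0" if "x \<notin> ?C" for x
    using that subsetD[OF closure_subset, of x "{x. \<phi> x \<noteq> 0}"] by auto
  have "grad \<phi> x = 0" if "x \<notin> ?C" for x
  proof -
    have "GDERIV \<phi> x :> 0"
    proof (rule GDERIV_cong_open[OF GDERIV_const[of 0], of "- ?C"])
      show "0 = \<phi> y" if "y \<in> - ?C" for y
        using z[of y] that by simp
    qed (use that in \<open>simp_all add: open_Compl\<close>)
    then show ?thesis by (rule GDERIV_imp_grad)
  qed
  then show "\<forall>x. x \<notin> ?C \<longrightarrow> \<phi> x = 0 \<and> grad \<phi> x = 0"
    using z by blast
qed

text \<open>The field \<open>\<psi> g\<close>, extended by 0, is continuously differentiable with
  compact support, so its divergence has integral 0. That divergence is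
  \<open>g \<bullet> grad \<psi>\<close> plus \<open>\<psi>\<close> times the Laplacian of
  \<open>v\<close>, and the equation replaces the Laplacian.\<close>

lemma integral_by_parts_test_function:
  fixes v :: "real ^ 'n::finite \<Rightarrow> real"
  assumes \<Omega>: "open \<Omega>" and \<psi>: "test_function \<Omega> \<psi>"
    and g: "\<And>x. x \<in> \<Omega> \<Longrightarrow> GDERIV v x :> g x"
    and K: "\<And>x i. x \<in> \<Omega> \<Longrightarrow> GDERIV (\<lambda>y. g y $ i) x :> K i x"
    and Kc: "\<And>i. continuous_on \<Omega> (K i)"
    and eq: "\<And>x. x \<in> \<Omega> \<Longrightarrow> (\<Sum>i\<in>UNIV. K i x $ i) = - L * v x"
  shows "(\<integral>x. g x \<bullet> grad \<psi> x \<partial>lebesgue_on \<Omega>) = L * (\<integral>x. v x * \<psi> x \<partial>lebesgue_on \<Omega>)"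
proof -
  obtain C where C: "compact C" "C \<subseteq> \<Omega>" "\<forall>x. x \<notin> C \<longrightarrow> \<psi> x = 0 \<and> grad \<psi> x = 0"
    using test_function_support[OF \<psi>] by blast
  obtain R where R: "\<And>x. x \<in> C \<Longrightarrow> norm x \<le> R"
    using compact_imp_bounded[OF C(1)] unfolding bounded_iff by blast
  have vc: "continuous_on \<Omega> v" and gic: "\<And>i. continuous_on \<Omega> (\<lambda>x. g x $ i)"
    using continuous_on_GDERIV g K by blast+
  have gc: "continuous_on \<Omega> g"
    using gic by (rule continuous_on_vec_nth)
  note \<psi>c = test_function_continuous[OF \<psi>]
  define D where "D i x = (if x \<in> \<Omega> then \<psi> x *\<^sub>R K i x + g x $ i *\<^sub>R grad \<psi> x else 0)" for i x
  have D: "GDERIV (\<lambda>y. \<psi> y * g y $ i) x :> D i x" for i x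
  proof (cases "x \<in> \<Omega>")
    case True
    then show ?thesis
      using GDERIV_mult[OF test_function_GDERIV[OF \<psi>] K[OF True]] unfolding D_def by simp
  next
    case False
    have "GDERIV (\<lambda>y. \<psi> y * g y $ i) x :> 0"
      by (rule GDERIV_cong_open[OF GDERIV_const[of 0], of "- C"])
         (use C False in \<open>auto intro: compact_imp_closed\<close>)
    then show ?thesis using False unfolding D_def by simp
  qed
  have Dc: "continuous_on UNIV (D i)" for i
    unfolding D_def
    by (rule continuous_on_UNIV_extend_by_0[OF \<Omega> C(1,2)])
       (use C in \<open>auto intro!: continuous_intros \<psi>c Kc gic\<close>)
  have D0: "integrable lborel (\<lambda>x. D i x $ i)" "(\<integral>x. D i x $ i \<partial>lborel) = 0" for i
    by (rule integral_partial_derivative_eq_0[OF D, where R = R];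
        use C R in \<open>force intro!: continuous_intros Dc\<close>)+
  have "(\<integral>x. (\<Sum>i\<in>UNIV. D i x $ i) \<partial>lborel) = 0"
    using D0 by simp
  moreover have "(\<Sum>i\<in>UNIV. D i x $ i) = (if x \<in> \<Omega> then g x \<bullet> grad \<psi> x - L * (v x * \<psi> x) else 0)" for x
  proof (cases "x \<in> \<Omega>")
    case True
    then have "(\<Sum>i\<in>UNIV. D i x $ i) = \<psi> x * (\<Sum>i\<in>UNIV. K i x $ i) + g x \<bullet> grad \<psi> x"
      unfolding D_def by (simp add: sum.distrib sum_distrib_left inner_vec_def)
    then show ?thesis using eq[OF True] True by simp
  qed (simp add: D_def)
  ultimately have 0: "(\<integral>x. (if x \<in> \<Omega> then g x \<bullet> grad \<psi> x - L * (v x * \<psi> x) else 0) \<partial>lborel) = 0"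
    by simp
  have I1: "integrable (lebesgue_on \<Omega>) (\<lambda>x. g x \<bullet> grad \<psi> x)"
    by (rule integrable_compact_support[OF \<Omega> C(1,2)])
       (use C in \<open>auto intro!: continuous_intros \<psi>c gc\<close>)
  have I2: "integrable (lebesgue_on \<Omega>) (\<lambda>x. v x * \<psi> x)"
    by (rule integrable_compact_support[OF \<Omega> C(1,2)])
       (use C in \<open>auto intro!: continuous_intros \<psi>c vc\<close>)
  have "(\<integral>x. g x \<bullet> grad \<psi> x - L * (v x * \<psi> x) \<partial>lebesgue_on \<Omega>) = 0"
    by (subst integrable_compact_support(2)[OF \<Omega> C(1,2)])
       (use C 0 in \<open>auto intro!: continuous_intros \<psi>c vc gc\<close>)
  then show ?thesis
    using I1 I2 by simp
qed

section \<open>Square-integrable functions and fields\<close>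

lemma L2_on_compact_support:
  fixes f :: "real ^ 'n::finite \<Rightarrow> 'b::euclidean_space"
  assumes "open \<Omega>" "compact C" "C \<subseteq> \<Omega>" "continuous_on \<Omega> f" "\<And>x. x \<in> \<Omega> - C \<Longrightarrow> f x = 0"
  shows "L2_on \<Omega> f"
  unfolding L2_on_def
proof
  show "f \<in> borel_measurable (lebesgue_on \<Omega>)"
    using assms by (intro continuous_imp_measurable_on_sets_lebesgue) auto
  show "integrable (lebesgue_on \<Omega>) (\<lambda>x. (norm (f x))\<^sup>2)"
    by (rule integrable_compact_support[OF assms(1-3)])
       (use assms in \<open>auto intro!: continuous_intros\<close>)
qed

lemma L2_on_test_function:
  assumes "open \<Omega>" "test_function \<Omega> \<phi>"
  shows "L2_on \<Omega> \<phi>" "L2_on \<Omega> (grad \<phi>)"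
proof -
  obtain C where C: "compact C" "C \<subseteq> \<Omega>" "\<forall>x. x \<notin> C \<longrightarrow> \<phi> x = 0 \<and> grad \<phi> x = 0"
    using test_function_support[OF assms(2)] by blast
  show "L2_on \<Omega> \<phi>" "L2_on \<Omega> (grad \<phi>)"
    by (rule L2_on_compact_support[OF assms(1) C(1,2) test_function_continuous(1)[OF assms(2)]],
        use C in simp)
       (rule L2_on_compact_support[OF assms(1) C(1,2) test_function_continuous(2)[OF assms(2)]],
        use C in simp)
qed

lemma L2_on_integrable_inner:
  assumes "L2_on \<Omega> f" "L2_on \<Omega> h"
  shows "integrable (lebesgue_on \<Omega>) (\<lambda>x. f x \<bullet> h x)"
proof (rule Bochner_Integration.integrable_bound)
  show "integrable (lebesgue_on \<Omega>) (\<lambda>x. (norm (f x))\<^sup>2 + (norm (h x))\<^sup>2)"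
    using assms unfolding L2_on_def by auto
  have "\<bar>f x \<bullet> h x\<bar> \<le> (norm (f x))\<^sup>2 + (norm (h x))\<^sup>2" for x
    using Cauchy_Schwarz_ineq2[of "f x" "h x"] sum_squares_bound[of "norm (f x)" "norm (h x)"]
      mult_nonneg_nonneg[OF norm_ge_zero[of "f x"] norm_ge_zero[of "h x"]]
    by linarith
  then show "AE x in lebesgue_on \<Omega>. norm (f x \<bullet> h x) \<le> norm ((norm (f x))\<^sup>2 + (norm (h x))\<^sup>2)"
    by simp
qed (use assms in \<open>auto simp: L2_on_def\<close>)

lemma L2_on_diff:
  assumes "L2_on \<Omega> f" "L2_on \<Omega> h"
  shows "L2_on \<Omega> (\<lambda>x. f x - h x)"
  unfolding L2_on_def
proof
  show m: "(\<lambda>x. f x - h x) \<in> borel_measurable (lebesgue_on \<Omega>)"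
    using assms unfolding L2_on_def by auto
  have "integrable (lebesgue_on \<Omega>) (\<lambda>x. (norm (f x))\<^sup>2 + (norm (h x))\<^sup>2 - 2 * (f x \<bullet> h x))"
    using assms L2_on_integrable_inner[OF assms] unfolding L2_on_def by auto
  moreover have "(norm (f x))\<^sup>2 + (norm (h x))\<^sup>2 - 2 * (f x \<bullet> h x) = (norm (f x - h x))\<^sup>2" for x
    by (simp add: power2_norm_eq_inner inner_diff inner_commute)
  ultimately show "integrable (lebesgue_on \<Omega>) (\<lambda>x. (norm (f x - h x))\<^sup>2)" by simp
qed

text \<open>In place of Cauchy-Schwarz for integrals, the weighted inequality
  \<open>2 * a * b \<le> d * a^2 + b^2 / d\<close> is applied under the integral.\<close>

lemma L2_on_inner_tendsto_0:
  assumes f: "L2_on \<Omega> f" and h: "\<And>n. L2_on \<Omega> (h n)"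
    and lim: "(\<lambda>n. \<integral>x. (norm (h n x))\<^sup>2 \<partial>lebesgue_on \<Omega>) \<longlonglongrightarrow> 0"
  shows "(\<lambda>n. \<integral>x. f x \<bullet> h n x \<partial>lebesgue_on \<Omega>) \<longlonglongrightarrow> 0"
proof (rule LIMSEQ_I)
  fix e :: real assume "e > 0"
  define A where "A = (\<integral>x. (norm (f x))\<^sup>2 \<partial>lebesgue_on \<Omega>)"
  have A: "A \<ge> 0" unfolding A_def by simp
  \<comment> \<open>Adding 1 to \<open>A\<close> covers the case \<open>A = 0\<close>. With this
    \<open>d\<close> each of the two terms of the weighted bound is eventually below
    \<open>e\<close>, hence so is half of their sum.\<close>
  define d where "d = e / (A + 1)"
  have d: "d > 0" "d * A < e"
    using \<open>e > 0\<close> A unfolding d_def by (auto simp: field_simps)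
  obtain n0 where n0: "\<And>n. n \<ge> n0 \<Longrightarrow> (\<integral>x. (norm (h n x))\<^sup>2 \<partial>lebesgue_on \<Omega>) < d * e"
    using LIMSEQ_D[OF lim, of "d * e"] \<open>e > 0\<close> d by fastforce
  have "\<bar>\<integral>x. f x \<bullet> h n x \<partial>lebesgue_on \<Omega>\<bar> < e" if "n \<ge> n0" for n
  proof -
    have I: "integrable (lebesgue_on \<Omega>) (\<lambda>x. (d * (norm (f x))\<^sup>2 + (norm (h n x))\<^sup>2 / d) / 2)"
      using f h unfolding L2_on_def by auto
    have "\<bar>f x \<bullet> h n x\<bar> \<le> (d * (norm (f x))\<^sup>2 + (norm (h n x))\<^sup>2 / d) / 2" for x
    proof -
      have "0 \<le> (d * norm (f x) - norm (h n x))\<^sup>2 / d"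
        using d by simp
      also have "\<dots> = d * (norm (f x))\<^sup>2 + (norm (h n x))\<^sup>2 / d - 2 * (norm (f x) * norm (h n x))"
        using d by (simp add: field_simps power2_eq_square)
      finally show ?thesis
        using Cauchy_Schwarz_ineq2[of "f x" "h n x"] by simp
    qed
    then have "(\<integral>x. \<bar>f x \<bullet> h n x\<bar> \<partial>lebesgue_on \<Omega>) \<le>
        (\<integral>x. (d * (norm (f x))\<^sup>2 + (norm (h n x))\<^sup>2 / d) / 2 \<partial>lebesgue_on \<Omega>)"
      using L2_on_integrable_inner[OF f h] I by (intro integral_mono) auto
    also have "\<dots> = (d * A + (\<integral>x. (norm (h n x))\<^sup>2 \<partial>lebesgue_on \<Omega>) / d) / 2"
      using f h unfolding L2_on_def A_def by simp
    also have "\<dots> < e"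
    proof -
      have "(\<integral>x. (norm (h n x))\<^sup>2 \<partial>lebesgue_on \<Omega>) / d < e"
        using n0[OF that] d by (simp add: divide_less_eq mult.commute)
      then show ?thesis using add_strict_mono[OF d(2)] by fastforce
    qed
    finally show ?thesis
      using integral_abs_bound[of "lebesgue_on \<Omega>" "\<lambda>x. f x \<bullet> h n x"] by linarith
  qed
  then show "\<exists>n0. \<forall>n\<ge>n0. norm ((\<integral>x. f x \<bullet> h n x \<partial>lebesgue_on \<Omega>) - 0) < e"
    by (metis diff_zero real_norm_def)
qed

section \<open>Positive Dirichlet solutions\<close>

text \<open>A \<open>C\<^sup>1\<close> truncation that vanishes for \<open>t \<le> d\<close>; its derivative lies between 0 and 1 and
  increases to 1 as \<open>d\<close> decreases to 0, so that composing with a positive solution gives test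
  functions of bounded energy.\<close>

definition soft_cut :: "real \<Rightarrow> real \<Rightarrow> real" where
  "soft_cut d t = (max (t - d) 0)\<^sup>2 / t"

text \<open>Squaring the positive part removes its corner at 0; this is what makes
  \<open>soft_cut\<close> continuously differentiable.\<close>

lemma DERIV_max_0_power2: "((\<lambda>t::real. (max t 0)\<^sup>2) has_real_derivative 2 * max t 0) (at t)"
proof -
  consider "t > 0" | "t < 0" | "t = 0" by linarith
  then show ?thesis
  proof cases
    case 1
    have "((\<lambda>t::real. t\<^sup>2) has_real_derivative 2 * t) (at t)"
      by (auto intro!: derivative_eq_intros)
    then have "((\<lambda>t::real. (max t 0)\<^sup>2) has_real_derivative 2 * t) (at t)"
      by (rule has_field_derivative_transform_within_open[where S = "{0<..}"]) (use 1 in auto)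
    then show ?thesis using 1 by simp
  next
    case 2
    have "((\<lambda>t::real. (max t 0)\<^sup>2) has_real_derivative 0) (at t)"
      by (rule has_field_derivative_transform_within_open[OF DERIV_const[of 0], where S = "{..<0}"]) (use 2 in auto)
    then show ?thesis using 2 by simp
  next
    case 3
    have "(\<lambda>h. (max h 0)\<^sup>2 / h) \<midarrow>0\<rightarrow> (0::real)"
    proof (rule Lim_null_comparison)
      show "\<forall>\<^sub>F h in at 0. norm ((max h 0)\<^sup>2 / h) \<le> \<bar>h\<bar>" for h :: real
        by (rule always_eventually) (auto simp: max_def power2_eq_square)
      show "(\<lambda>h. \<bar>h\<bar>) \<midarrow>0\<rightarrow> (0::real)"
        by (auto intro!: tendsto_eq_intros)
    qed
    then show ?thesis using 3 by (simp add: DERIV_def)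
  qed
qed

text \<open>With \<open>m = max (t - d) 0 / t\<close> the derivative is
  \<open>m * (2 - m) = 1 - (1 - m)^2\<close>, a form that shows its bounds and its growth in
  \<open>m\<close> for \<open>m\<close> between 0 and 1.\<close>

lemma soft_cut_deriv:
  assumes "t > 0"
  shows "(soft_cut d has_real_derivative (max (t - d) 0 / t) * (2 - max (t - d) 0 / t)) (at t)"
proof -
  have 1: "((\<lambda>t. (max (t - d) 0)\<^sup>2) has_real_derivative 2 * max (t - d) 0 * 1) (at t)"
    by (rule DERIV_chain2[OF DERIV_max_0_power2]) (auto intro!: derivative_eq_intros)
  show ?thesis
    unfolding soft_cut_def
    by (rule DERIV_cong[OF DERIV_divide[OF 1 DERIV_ident]])
       (use assms in \<open>simp_all add: field_simps power2_eq_square\<close>)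
qed

lemma soft_cut_bounds:
  assumes "t > 0" "d > 0"
  shows "0 \<le> max (t - d) 0 / t" "max (t - d) 0 / t \<le> 1"
    "0 \<le> soft_cut d t" "soft_cut d t \<le> t" "\<bar>soft_cut d t - t\<bar> \<le> 2 * d"
proof -
  let ?m = "max (t - d) 0 / t"
  show m: "0 \<le> ?m" "?m \<le> 1"
    using assms by auto
  have e: "soft_cut d t = ?m\<^sup>2 * t"
    using assms unfolding soft_cut_def by (simp add: power2_eq_square)
  have m2: "?m\<^sup>2 \<le> 1"
    using m by (simp add: power_le_one)
  show "0 \<le> soft_cut d t" using assms unfolding e by simp
  show "soft_cut d t \<le> t" using assms m2 unfolding e by (simp add: mult_left_le_one_le)
  \<comment> \<open>The first factor is \<open>min t d\<close> and the second is at most 2, whence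
    the bound \<open>2 * d\<close>.\<close>
  have "t - soft_cut d t = (t * (1 - ?m)) * (1 + ?m)"
    unfolding e by (simp add: algebra_simps power2_eq_square)
  also have "\<dots> \<le> d * 2"
    by (rule mult_mono) (use assms m in \<open>auto simp: field_simps max_def\<close>)
  finally show "\<bar>soft_cut d t - t\<bar> \<le> 2 * d"
    using \<open>soft_cut d t \<le> t\<close> by simp
qed

text \<open>The pointwise core of Jacobi's argument. For \<open>a = grad \<phi>\<close>,
  \<open>b = grad v\<close> and \<open>c = \<phi> / v\<close> the vector paired with
  \<open>b\<close> is the gradient of \<open>\<phi>^2 / v\<close>.\<close>

lemma norm_diff_scaleR_power2:
  fixes a b :: "'a::real_inner"
  shows "(norm (a - c *\<^sub>R b))\<^sup>2 = (norm a)\<^sup>2 - b \<bullet> ((2 * c) *\<^sub>R a - c\<^sup>2 *\<^sub>R b)"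
  unfolding power2_norm_eq_inner
  by (simp add: inner_diff inner_commute power2_eq_square algebra_simps)

text \<open>\<open>K\<close> plays the part of the closure of \<open>\<Omega>\<close>. Only
  \<open>v\<close> is controlled up to the boundary, while \<open>g\<close> and \<open>H\<close> are
  continuous inside; this admits the vertex and the edges of a cone, where the gradient may blow
  up.\<close>

locale positive_dirichlet_solution =
  fixes \<Omega> K :: "(real ^ 'n::finite) set" and v :: "real ^ 'n \<Rightarrow> real"
    and g :: "real ^ 'n \<Rightarrow> real ^ 'n" and H :: "'n \<Rightarrow> real ^ 'n \<Rightarrow> real ^ 'n" and L :: real
  assumes open_dom: "open \<Omega>" and dom_nonempty: "\<Omega> \<noteq> {}"
    and compact_K: "compact K" and dom_subset: "\<Omega> \<subseteq> K"
    and cont: "continuous_on K v" and boundary: "\<And>x. x \<in> K - \<Omega> \<Longrightarrow> v x = 0"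
    and pos: "\<And>x. x \<in> \<Omega> \<Longrightarrow> 0 < v x"
    and grad_v: "\<And>x. x \<in> \<Omega> \<Longrightarrow> GDERIV v x :> g x"
    and hess_v: "\<And>x i. x \<in> \<Omega> \<Longrightarrow> GDERIV (\<lambda>y. g y $ i) x :> H i x"
    and cont_hess: "\<And>i. continuous_on \<Omega> (H i)"
    and eqn: "\<And>x. x \<in> \<Omega> \<Longrightarrow> (\<Sum>i\<in>UNIV. H i x $ i) = - L * v x"
begin

lemma cont_grad: "continuous_on \<Omega> g"
  by (rule continuous_on_vec_nth) (rule continuous_on_GDERIV, rule hess_v)

lemma cont_dom: "continuous_on \<Omega> v"
  using cont dom_subset continuous_on_subset by blast

lemma pos_neq: "x \<in> \<Omega> \<Longrightarrow> v x \<noteq> 0"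
  using pos by force

lemma by_parts:
  assumes "test_function \<Omega> \<psi>"
  shows "(\<integral>x. g x \<bullet> grad \<psi> x \<partial>lebesgue_on \<Omega>) = L * (\<integral>x. v x * \<psi> x \<partial>lebesgue_on \<Omega>)"
  by (rule integral_by_parts_test_function[OF open_dom assms grad_v hess_v cont_hess eqn])

text \<open>Jacobi's argument: with \<open>\<psi> = \<phi>\<^sup>2 / v\<close> one has
  \<open>\<bar>\<nabla>\<phi>\<bar>\<^sup>2 - \<nabla>v \<bullet> \<nabla>\<psi> = \<bar>\<nabla>\<phi> - (\<phi> / v) \<nabla>v\<bar>\<^sup>2\<close>.\<close>

lemma rayleigh:
  assumes "test_function \<Omega> \<phi>"
  shows "L * (\<integral>x. (\<phi> x)\<^sup>2 \<partial>lebesgue_on \<Omega>) \<le> (\<integral>x. (norm (grad \<phi> x))\<^sup>2 \<partial>lebesgue_on \<Omega>)"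
proof -
  obtain C where C: "compact C" "C \<subseteq> \<Omega>" "\<forall>x. x \<notin> C \<longrightarrow> \<phi> x = 0 \<and> grad \<phi> x = 0"
    using test_function_support[OF assms] by blast
  note \<phi>c = test_function_continuous[OF assms]
  define \<psi> where "\<psi> x = (if x \<in> \<Omega> then (\<phi> x)\<^sup>2 / v x else 0)" for x
  define G where "G x = (2 * \<phi> x / v x) *\<^sub>R grad \<phi> x - ((\<phi> x)\<^sup>2 / (v x)\<^sup>2) *\<^sub>R g x" for x
  have Gc: "continuous_on \<Omega> G"
    unfolding G_def using pos
    by (auto intro!: continuous_intros \<phi>c cont_grad cont_dom simp: pos_neq)
  have G\<psi>: "GDERIV \<psi> x :> G x" if "x \<in> \<Omega>" for x
  proof -
    have "GDERIV (\<lambda>x. (\<phi> x * \<phi> x) * inverse (v x)) x :>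
       (\<phi> x * \<phi> x) *\<^sub>R (- (inverse (v x))\<^sup>2 *\<^sub>R g x) + inverse (v x) *\<^sub>R (\<phi> x *\<^sub>R grad \<phi> x + \<phi> x *\<^sub>R grad \<phi> x)"
      by (intro GDERIV_mult GDERIV_inverse grad_v test_function_GDERIV[OF assms] that)
         (use pos[OF that] in simp)
    also have "(\<phi> x * \<phi> x) *\<^sub>R (- (inverse (v x))\<^sup>2 *\<^sub>R g x) + inverse (v x) *\<^sub>R (\<phi> x *\<^sub>R grad \<phi> x + \<phi> x *\<^sub>R grad \<phi> x) = G x"
      unfolding G_def by (simp add: power2_eq_square divide_inverse vec_eq_iff algebra_simps)
    finally show ?thesis
      by (rule GDERIV_cong_open[OF _ open_dom that]) (simp add: \<psi>_def power2_eq_square divide_inverse)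
  qed
  have \<psi>0: "\<psi> x = 0" if "x \<notin> C" for x
    using C(3) that by (simp add: \<psi>_def)
  have t\<psi>: "test_function \<Omega> \<psi>" and grad\<psi>: "\<And>x. x \<in> \<Omega> \<Longrightarrow> grad \<psi> x = G x"
    using test_function_local[OF open_dom C(1,2) \<psi>0 G\<psi> Gc] by blast+
  have "L * (\<integral>x. (\<phi> x)\<^sup>2 \<partial>lebesgue_on \<Omega>) = L * (\<integral>x. v x * \<psi> x \<partial>lebesgue_on \<Omega>)"
  proof -
    have "(\<integral>x. (\<phi> x)\<^sup>2 \<partial>lebesgue_on \<Omega>) = (\<integral>x. v x * \<psi> x \<partial>lebesgue_on \<Omega>)"
    proof (rule Bochner_Integration.integral_cong)
      fix x assume "x \<in> space (lebesgue_on \<Omega>)"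
      then have "x \<in> \<Omega>" by simp
      then show "(\<phi> x)\<^sup>2 = v x * \<psi> x" using pos[of x] by (simp add: \<psi>_def)
    qed simp
    then show ?thesis by simp
  qed
  also have "\<dots> = (\<integral>x. g x \<bullet> grad \<psi> x \<partial>lebesgue_on \<Omega>)"
    using by_parts[OF t\<psi>] by simp
  also have "\<dots> \<le> (\<integral>x. (norm (grad \<phi> x))\<^sup>2 \<partial>lebesgue_on \<Omega>)"
  proof (rule integral_mono)
    show "integrable (lebesgue_on \<Omega>) (\<lambda>x. g x \<bullet> grad \<psi> x)"
    proof (rule integrable_compact_support(1)[OF open_dom C(1,2)])
      show "continuous_on \<Omega> (\<lambda>x. g x \<bullet> grad \<psi> x)"
        by (intro continuous_intros cont_grad test_function_continuous[OF t\<psi>])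
      show "g x \<bullet> grad \<psi> x = 0" if "x \<in> \<Omega> - C" for x
        using grad\<psi>[of x] C(3) that by (simp add: G_def)
    qed
    show "integrable (lebesgue_on \<Omega>) (\<lambda>x. (norm (grad \<phi> x))\<^sup>2)"
      using L2_on_test_function(2)[OF open_dom assms] by (simp add: L2_on_def)
    fix x assume "x \<in> space (lebesgue_on \<Omega>)"
    then have x: "x \<in> \<Omega>" by simp
    have "0 \<le> (norm (grad \<phi> x - (\<phi> x / v x) *\<^sub>R g x))\<^sup>2" by simp
    also have "\<dots> = (norm (grad \<phi> x))\<^sup>2 - g x \<bullet> G x"
      unfolding norm_diff_scaleR_power2 G_def by (simp add: power_divide)
    finally show "g x \<bullet> grad \<psi> x \<le> (norm (grad \<phi> x))\<^sup>2"
      using grad\<psi>[OF x] by simp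
  qed
  finally show ?thesis .
qed

text \<open>Testing the weak equation of \<open>u\<close> with its own approximations
  \<open>\<phi> n\<close> shows in the limit that the energy of \<open>u\<close> is
  \<open>\<Lambda>\<close> times its squared norm. The inequality \<open>rayleigh\<close> for
  \<open>\<phi> n\<close> survives the limit, and the squared norm of \<open>u\<close> is
  positive.\<close>

lemma eigenvalue_ge:
  assumes "dirichlet_eigenvalue \<Omega> \<Lambda>"
  shows "L \<le> \<Lambda>"
proof -
  obtain u h where uh: "H10 \<Omega> u h" and nz: "\<not> (AE x in lebesgue_on \<Omega>. u x = 0)"
    and weak: "\<And>\<phi>. test_function \<Omega> \<phi> \<Longrightarrow>
           (\<integral>x. h x \<bullet> grad \<phi> x \<partial>lebesgue_on \<Omega>) = \<Lambda> * (\<integral>x. u x * \<phi> x \<partial>lebesgue_on \<Omega>)"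
    using assms unfolding dirichlet_eigenvalue_def by blast
  obtain \<phi> where L2: "L2_on \<Omega> u" "L2_on \<Omega> h" and t: "\<And>n. test_function \<Omega> (\<phi> n)"
    and lim: "(\<lambda>n. \<integral>x. (\<phi> n x - u x)\<^sup>2 \<partial>lebesgue_on \<Omega>) \<longlonglongrightarrow> 0"
      "(\<lambda>n. \<integral>x. (norm (grad (\<phi> n) x - h x))\<^sup>2 \<partial>lebesgue_on \<Omega>) \<longlonglongrightarrow> 0"
    using uh unfolding H10_def by blast
  note L2t = L2_on_test_function[OF open_dom t]
  note L2d = L2_on_diff[OF L2t(1) L2(1)] L2_on_diff[OF L2t(2) L2(2)]
  let ?U = "\<integral>x. (u x)\<^sup>2 \<partial>lebesgue_on \<Omega>" and ?E = "\<integral>x. (norm (h x))\<^sup>2 \<partial>lebesgue_on \<Omega>"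
  define a where "a n = (\<integral>x. u x * (\<phi> n x - u x) \<partial>lebesgue_on \<Omega>)" for n
  define b where "b n = (\<integral>x. h x \<bullet> (grad (\<phi> n) x - h x) \<partial>lebesgue_on \<Omega>)" for n
  have lim': "(\<lambda>n. \<integral>x. (norm (\<phi> n x - u x))\<^sup>2 \<partial>lebesgue_on \<Omega>) \<longlonglongrightarrow> 0"
    using lim(1) by simp
  have a0: "a \<longlonglongrightarrow> 0"
    using L2_on_inner_tendsto_0[OF L2(1) L2d(1) lim'] unfolding a_def by simp
  have b0: "b \<longlonglongrightarrow> 0"
    using L2_on_inner_tendsto_0[OF L2(2) L2d(2) lim(2)] unfolding b_def by simp
  note int1 = L2_on_integrable_inner[OF L2(1) L2d(1), simplified]
  note int2 = L2_on_integrable_inner[OF L2(2) L2d(2)]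
  have sq: "integrable (lebesgue_on \<Omega>) (\<lambda>x. (u x)\<^sup>2)" "integrable (lebesgue_on \<Omega>) (\<lambda>x. (norm (h x))\<^sup>2)"
    "integrable (lebesgue_on \<Omega>) (\<lambda>x. (\<phi> n x - u x)\<^sup>2)"
    "integrable (lebesgue_on \<Omega>) (\<lambda>x. (norm (grad (\<phi> n) x - h x))\<^sup>2)" for n
    using L2 L2d[of n] unfolding L2_on_def by simp_all
  have A: "(\<integral>x. u x * \<phi> n x \<partial>lebesgue_on \<Omega>) = ?U + a n" for n
  proof -
    have "(\<integral>x. u x * \<phi> n x \<partial>lebesgue_on \<Omega>) = (\<integral>x. (u x)\<^sup>2 + u x * (\<phi> n x - u x) \<partial>lebesgue_on \<Omega>)"
      by (simp add: algebra_simps power2_eq_square)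
    then show ?thesis using sq int1 unfolding a_def by simp
  qed
  have B: "(\<integral>x. h x \<bullet> grad (\<phi> n) x \<partial>lebesgue_on \<Omega>) = ?E + b n" for n
  proof -
    have "(\<integral>x. h x \<bullet> grad (\<phi> n) x \<partial>lebesgue_on \<Omega>) = (\<integral>x. (norm (h x))\<^sup>2 + h x \<bullet> (grad (\<phi> n) x - h x) \<partial>lebesgue_on \<Omega>)"
      by (simp add: inner_diff power2_norm_eq_inner)
    then show ?thesis using sq int2 unfolding b_def by simp
  qed
  have "?E + b n = \<Lambda> * (?U + a n)" for n
    using weak[OF t, of n] A B by simp
  then have "(\<lambda>n. ?E + b n) = (\<lambda>n. \<Lambda> * (?U + a n))" by (rule ext)
  moreover have "(\<lambda>n. ?E + b n) \<longlonglongrightarrow> ?E + 0" "(\<lambda>n. \<Lambda> * (?U + a n)) \<longlonglongrightarrow> \<Lambda> * (?U + 0)"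
    by (intro tendsto_intros a0 b0)+
  ultimately have "?E + 0 = \<Lambda> * (?U + 0)"
    by (metis (no_types) LIMSEQ_unique)
  then have E: "?E = \<Lambda> * ?U" by simp
  have C: "(\<integral>x. (\<phi> n x)\<^sup>2 \<partial>lebesgue_on \<Omega>) = ?U + 2 * a n + (\<integral>x. (\<phi> n x - u x)\<^sup>2 \<partial>lebesgue_on \<Omega>)" for n
  proof -
    have "(\<integral>x. (\<phi> n x)\<^sup>2 \<partial>lebesgue_on \<Omega>) =
        (\<integral>x. ((u x)\<^sup>2 + 2 * (u x * (\<phi> n x - u x))) + (\<phi> n x - u x)\<^sup>2 \<partial>lebesgue_on \<Omega>)"
      by (rule Bochner_Integration.integral_cong) (simp_all add: algebra_simps power2_eq_square)
    then show ?thesis using sq int1 unfolding a_def by simp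
  qed
  have D: "(\<integral>x. (norm (grad (\<phi> n) x))\<^sup>2 \<partial>lebesgue_on \<Omega>) =
      ?E + 2 * b n + (\<integral>x. (norm (grad (\<phi> n) x - h x))\<^sup>2 \<partial>lebesgue_on \<Omega>)" for n
  proof -
    have "(\<integral>x. (norm (grad (\<phi> n) x))\<^sup>2 \<partial>lebesgue_on \<Omega>) =
        (\<integral>x. ((norm (h x))\<^sup>2 + 2 * (h x \<bullet> (grad (\<phi> n) x - h x))) + (norm (grad (\<phi> n) x - h x))\<^sup>2 \<partial>lebesgue_on \<Omega>)"
      by (rule Bochner_Integration.integral_cong)
         (simp_all add: algebra_simps power2_norm_eq_inner inner_diff inner_commute)
    then show ?thesis using sq int2 unfolding b_def by simp
  qed
  have "L * (?U + 2 * 0 + 0) \<le> ?E + 2 * 0 + 0"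
  proof (rule LIMSEQ_le)
    show "(\<lambda>n. L * (?U + 2 * a n + (\<integral>x. (\<phi> n x - u x)\<^sup>2 \<partial>lebesgue_on \<Omega>))) \<longlonglongrightarrow> L * (?U + 2 * 0 + 0)"
      by (intro tendsto_intros a0 lim)
    show "(\<lambda>n. ?E + 2 * b n + (\<integral>x. (norm (grad (\<phi> n) x - h x))\<^sup>2 \<partial>lebesgue_on \<Omega>)) \<longlonglongrightarrow> ?E + 2 * 0 + 0"
      by (intro tendsto_intros b0 lim)
    show "\<exists>N. \<forall>n\<ge>N. L * (?U + 2 * a n + (\<integral>x. (\<phi> n x - u x)\<^sup>2 \<partial>lebesgue_on \<Omega>))
        \<le> ?E + 2 * b n + (\<integral>x. (norm (grad (\<phi> n) x - h x))\<^sup>2 \<partial>lebesgue_on \<Omega>)"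
      using rayleigh[OF t] unfolding C D by blast
  qed
  then have "L * ?U \<le> \<Lambda> * ?U" using E by simp
  moreover have "?U > 0"
  proof -
    have "?U \<noteq> 0"
      using nz sq(1) by (subst integral_nonneg_eq_0_iff_AE) auto
    moreover have "0 \<le> ?U" by (rule Bochner_Integration.integral_nonneg) simp
    ultimately show ?thesis by linarith
  qed
  ultimately show ?thesis by simp
qed

lemma finite_measure: "finite_measure (lebesgue_on \<Omega>)"
proof (rule finite_measureI)
  have "bounded \<Omega>"
    using compact_K dom_subset bounded_subset compact_imp_bounded by blast
  then have "emeasure lborel \<Omega> < \<infinity>"
    by (rule emeasure_bounded_finite)
  then show "emeasure (lebesgue_on \<Omega>) (space (lebesgue_on \<Omega>)) \<noteq> \<infinity>"
    using open_dom by (simp add: emeasure_restrict_space)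
qed

lemma L2_v: "L2_on \<Omega> v"
  unfolding L2_on_def
proof
  interpret finite_measure "lebesgue_on \<Omega>" by (rule finite_measure)
  show m: "v \<in> borel_measurable (lebesgue_on \<Omega>)"
    using cont_dom open_dom by (intro continuous_imp_measurable_on_sets_lebesgue) auto
  have "bounded (v ` K)"
    using compact_continuous_image[OF cont compact_K] compact_imp_bounded by blast
  then obtain B where B: "\<And>x. x \<in> K \<Longrightarrow> \<bar>v x\<bar> \<le> B"
    unfolding bounded_iff by (metis imageI real_norm_def)
  have "\<bar>(v x)\<^sup>2\<bar> \<le> B\<^sup>2" if "x \<in> \<Omega>" for x
    using power_mono[OF B[of x], of 2] that dom_subset by auto
  then show "integrable (lebesgue_on \<Omega>) (\<lambda>x. (norm (v x))\<^sup>2)"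
    using m by (intro integrable_const_bound[of _ "B\<^sup>2"]) (auto intro!: AE_I2)
qed

definition cut :: "nat \<Rightarrow> real ^ 'n \<Rightarrow> real" where
  "cut n x = (if x \<in> \<Omega> then soft_cut (inverse (Suc n)) (v x) else 0)"

definition ratio :: "nat \<Rightarrow> real ^ 'n \<Rightarrow> real" where
  "ratio n x = max (v x - inverse (Suc n)) 0 / v x"

text \<open>\<open>cut n\<close> is supported where \<open>v\<close> is at least
  \<open>1 / (n + 1)\<close>. This set is closed in \<open>K\<close>, hence compact, and it avoids
  \<open>K - \<Omega>\<close> because \<open>v\<close> vanishes there; the shape of the boundary
  does not enter.\<close>

lemma test_function_cut: "test_function \<Omega> (cut n)"
    and grad_cut: "x \<in> \<Omega> \<Longrightarrow> grad (cut n) x = (ratio n x * (2 - ratio n x)) *\<^sub>R g x"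
proof -
  define C where "C = {x \<in> K. v x \<ge> inverse (real (Suc n))}"
  have "closed C"
    unfolding C_def using cont compact_K
    by (intro continuous_on_closed_Collect_le continuous_intros compact_imp_closed) auto
  moreover have "C \<subseteq> K" unfolding C_def by auto
  ultimately have C: "compact C"
    using compact_K by (metis compact_Int_closed inf.absorb_iff2 inf_commute)
  have C\<Omega>: "C \<subseteq> \<Omega>"
  proof
    fix x assume "x \<in> C"
    then have "x \<in> K" "v x \<noteq> 0" unfolding C_def by (auto dest: order_trans)
    then show "x \<in> \<Omega>" using boundary by blast
  qed
  have z: "cut n x = 0" if "x \<notin> C" for x
    using that dom_subset unfolding cut_def C_def soft_cut_def by auto
  let ?G = "\<lambda>x. (ratio n x * (2 - ratio n x)) *\<^sub>R g x"
  have G: "GDERIV (cut n) x :> ?G x" if "x \<in> \<Omega>" for x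
    by (rule GDERIV_cong_open[OF GDERIV_DERIV_compose[OF grad_v[OF that] soft_cut_deriv[OF pos[OF that], of "inverse (Suc n)"], folded ratio_def] open_dom that])
       (simp add: cut_def)
  have Gc: "continuous_on \<Omega> ?G"
    unfolding ratio_def using pos
    by (auto intro!: continuous_intros cont_dom cont_grad simp: pos_neq)
  show "test_function \<Omega> (cut n)" "x \<in> \<Omega> \<Longrightarrow> grad (cut n) x = ?G x"
    using test_function_local[OF open_dom C C\<Omega> z G Gc] by blast+
qed

lemma ratio_bounds: "x \<in> \<Omega> \<Longrightarrow> 0 \<le> ratio n x \<and> ratio n x \<le> 1"
  using soft_cut_bounds(1,2)[OF pos, of x "inverse (Suc n)"] unfolding ratio_def by simp

lemma ratio_tendsto:
  assumes "x \<in> \<Omega>"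
  shows "(\<lambda>n. ratio n x) \<longlonglongrightarrow> 1"
proof -
  have "(\<lambda>n. max (v x - inverse (Suc n)) 0 / v x) \<longlonglongrightarrow> max (v x - 0) 0 / v x"
    using pos[OF assms] by (intro tendsto_intros LIMSEQ_inverse_real_of_nat) auto
  then show ?thesis using pos[OF assms] unfolding ratio_def by simp
qed

lemma measurable_ratio: "ratio n \<in> borel_measurable (lebesgue_on \<Omega>)"
proof -
  have "continuous_on \<Omega> (ratio n)"
    unfolding ratio_def using pos
    by (auto intro!: continuous_intros cont_dom simp: pos_neq)
  then show ?thesis
    using open_dom by (intro continuous_imp_measurable_on_sets_lebesgue) auto
qed

lemma measurable_grad: "g \<in> borel_measurable (lebesgue_on \<Omega>)"
  using open_dom cont_grad by (intro continuous_imp_measurable_on_sets_lebesgue) auto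

text \<open>Testing the equation of \<open>v\<close> with \<open>cut n\<close> expresses the
  integral of \<open>ratio * (2 - ratio) * |g|^2\<close> as \<open>L\<close> times the integral of
  \<open>v * cut n\<close>, which is at most \<open>|L|\<close> times that of \<open>v^2\<close>.
  The integrands increase to \<open>|g|^2\<close>, so monotone convergence gives finite energy from
  information on \<open>v\<close> alone.\<close>

lemma energy_finite: "L2_on \<Omega> g"
  unfolding L2_on_def
proof
  show "g \<in> borel_measurable (lebesgue_on \<Omega>)" by (rule measurable_grad)
  note [measurable] = measurable_grad measurable_ratio
  define f where "f n x = (ratio n x * (2 - ratio n x)) * (norm (g x))\<^sup>2" for n x
  have fI: "integrable (lebesgue_on \<Omega>) (f n)"
    and fle: "(\<integral>x. f n x \<partial>lebesgue_on \<Omega>) \<le> \<bar>L\<bar> * (\<integral>x. (v x)\<^sup>2 \<partial>lebesgue_on \<Omega>)" for n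
  proof -
    note t = test_function_cut[of n]
    obtain C where C: "compact C" "C \<subseteq> \<Omega>" "\<forall>x. x \<notin> C \<longrightarrow> cut n x = 0 \<and> grad (cut n) x = 0"
      using test_function_support[OF t] by blast
    have e: "g x \<bullet> grad (cut n) x = f n x" if "x \<in> \<Omega>" for x
      using that unfolding f_def by (simp add: grad_cut power2_norm_eq_inner)
    have "integrable (lebesgue_on \<Omega>) (\<lambda>x. g x \<bullet> grad (cut n) x)"
      by (rule integrable_compact_support(1)[OF open_dom C(1,2)])
         (use C in \<open>auto intro!: continuous_intros cont_grad test_function_continuous[OF t]\<close>)
    then show "integrable (lebesgue_on \<Omega>) (f n)"
      by (rule Bochner_Integration.integrable_cong[THEN iffD1, rotated -1]) (use e in auto)
    have "(\<integral>x. f n x \<partial>lebesgue_on \<Omega>) = (\<integral>x. g x \<bullet> grad (cut n) x \<partial>lebesgue_on \<Omega>)"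
      by (rule Bochner_Integration.integral_cong) (use e in auto)
    also have "\<dots> = L * (\<integral>x. v x * cut n x \<partial>lebesgue_on \<Omega>)"
      by (rule by_parts[OF t])
    also have "\<dots> \<le> \<bar>L\<bar> * (\<integral>x. (v x)\<^sup>2 \<partial>lebesgue_on \<Omega>)"
    proof (rule mult_mono)
      have b: "0 \<le> v x * cut n x \<and> v x * cut n x \<le> (v x)\<^sup>2" if "x \<in> \<Omega>" for x
        using pos[OF that] soft_cut_bounds(3,4)[OF pos[OF that], of "inverse (Suc n)"] that
        unfolding cut_def power2_eq_square by (auto intro: mult_left_mono)
      show "(\<integral>x. v x * cut n x \<partial>lebesgue_on \<Omega>) \<le> (\<integral>x. (v x)\<^sup>2 \<partial>lebesgue_on \<Omega>)"
        using L2_v L2_on_integrable_inner[OF L2_v L2_on_test_function(1)[OF open_dom t]] b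
        by (intro integral_mono) (auto simp: L2_on_def)
      show "0 \<le> (\<integral>x. v x * cut n x \<partial>lebesgue_on \<Omega>)"
        using b by (intro Bochner_Integration.integral_nonneg_AE AE_I2) auto
    qed auto
    finally show "(\<integral>x. f n x \<partial>lebesgue_on \<Omega>) \<le> \<bar>L\<bar> * (\<integral>x. (v x)\<^sup>2 \<partial>lebesgue_on \<Omega>)" .
  qed
  have fmono: "f m x \<le> f n x" if "m \<le> n" "x \<in> \<Omega>" for m n x
  proof -
    have "inverse (real (Suc n)) \<le> inverse (real (Suc m))"
      using that by simp
    then have r: "ratio m x \<le> ratio n x"
      unfolding ratio_def using pos[OF that(2)]
      by (intro divide_right_mono max.mono diff_left_mono) simp_all
    \<comment> \<open>This product is the difference of the two values of
      \<open>m * (2 - m)\<close>; it is nonnegative because both ratios are at most 1.\<close>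
    have "0 \<le> (ratio n x - ratio m x) * (2 - ratio n x - ratio m x)"
      using r ratio_bounds[OF that(2)] by (intro mult_nonneg_nonneg) (smt (verit))+
    then have "ratio m x * (2 - ratio m x) \<le> ratio n x * (2 - ratio n x)"
      by (simp add: algebra_simps)
    then show ?thesis unfolding f_def by (rule mult_right_mono) simp
  qed
  have inc: "incseq (\<lambda>n. \<integral>x. f n x \<partial>lebesgue_on \<Omega>)"
    by (rule incseq_SucI) (auto intro!: integral_mono fI fmono)
  obtain E where E: "(\<lambda>n. \<integral>x. f n x \<partial>lebesgue_on \<Omega>) \<longlonglongrightarrow> E"
    using incseq_convergent[OF inc] fle by blast
  show "integrable (lebesgue_on \<Omega>) (\<lambda>x. (norm (g x))\<^sup>2)"
  proof (rule integrable_monotone_convergence[OF fI])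
    show "AE x in lebesgue_on \<Omega>. mono (\<lambda>n. f n x)"
      using fmono by (intro AE_I2) (auto simp: mono_def)
    show "AE x in lebesgue_on \<Omega>. (\<lambda>n. f n x) \<longlonglongrightarrow> (norm (g x))\<^sup>2"
    proof (rule AE_I2)
      fix x assume "x \<in> space (lebesgue_on \<Omega>)"
      then have x: "x \<in> \<Omega>" by simp
      have "(\<lambda>n. f n x) \<longlonglongrightarrow> (1 * (2 - 1)) * (norm (g x))\<^sup>2"
        unfolding f_def by (intro tendsto_intros ratio_tendsto x)
      then show "(\<lambda>n. f n x) \<longlonglongrightarrow> (norm (g x))\<^sup>2" by simp
    qed
    show "(\<lambda>x. (norm (g x))\<^sup>2) \<in> borel_measurable (lebesgue_on \<Omega>)" by measurable
  qed (rule E)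
qed

text \<open>\<open>cut n\<close> is within \<open>2 / (n + 1)\<close> of \<open>v\<close>,
  uniformly. The gradient error has size \<open>(1 - ratio)^2 * |g|\<close>; it tends to 0
  pointwise, and \<open>energy_finite\<close> supplies the dominating function.\<close>

lemma in_H10: "H10 \<Omega> v g"
proof -
  interpret finite_measure "lebesgue_on \<Omega>" by (rule finite_measure)
  note [measurable] = measurable_grad measurable_ratio
  have vm: "v \<in> borel_measurable (lebesgue_on \<Omega>)"
    using L2_v by (simp add: L2_on_def)
  have cm: "cut n \<in> borel_measurable (lebesgue_on \<Omega>)" for n
    using L2_on_test_function(1)[OF open_dom test_function_cut] by (simp add: L2_on_def)
  note [measurable] = vm cm
  have "(\<lambda>n. \<integral>x. (cut n x - v x)\<^sup>2 \<partial>lebesgue_on \<Omega>) \<longlonglongrightarrow> (\<integral>x. 0 \<partial>lebesgue_on \<Omega>)"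
  proof (rule integral_dominated_convergence)
    have d: "\<bar>cut n x - v x\<bar> \<le> 2 * inverse (real (Suc n))" if "x \<in> \<Omega>" for n x
      using soft_cut_bounds(5)[OF pos[OF that], of "inverse (Suc n)"] that by (simp add: cut_def)
    show "AE x in lebesgue_on \<Omega>. (\<lambda>n. (cut n x - v x)\<^sup>2) \<longlonglongrightarrow> 0"
    proof (rule AE_I2)
      fix x assume "x \<in> space (lebesgue_on \<Omega>)"
      then have x: "x \<in> \<Omega>" by simp
      have "(\<lambda>n. 2 * inverse (real (Suc n))) \<longlonglongrightarrow> 2 * 0"
        by (intro tendsto_intros LIMSEQ_inverse_real_of_nat)
      then have z: "(\<lambda>n. 2 * inverse (real (Suc n))) \<longlonglongrightarrow> 0"
        by simp
      have "(\<lambda>n. cut n x - v x) \<longlonglongrightarrow> 0"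
        by (rule Lim_null_comparison[OF always_eventually z]) (metis d x real_norm_def)
      from tendsto_power[OF this, of 2] show "(\<lambda>n. (cut n x - v x)\<^sup>2) \<longlonglongrightarrow> 0" by simp
    qed
    show "AE x in lebesgue_on \<Omega>. norm ((cut n x - v x)\<^sup>2) \<le> 4" for n
    proof (rule AE_I2)
      fix x assume "x \<in> space (lebesgue_on \<Omega>)"
      then have "\<bar>cut n x - v x\<bar> \<le> 2 * inverse (real (Suc n))" using d by simp
      also have "\<dots> \<le> 2 * 1" by (intro mult_left_mono) (auto simp: inverse_le_1_iff)
      finally have "\<bar>cut n x - v x\<bar>\<^sup>2 \<le> 2\<^sup>2" by (intro power_mono) auto
      then show "norm ((cut n x - v x)\<^sup>2) \<le> 4" by simp
    qed
  qed auto
  moreover have "(\<lambda>n. \<integral>x. (norm (grad (cut n) x - g x))\<^sup>2 \<partial>lebesgue_on \<Omega>) \<longlonglongrightarrow> 0"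
  proof -
    have eq: "(\<integral>x. (norm (grad (cut n) x - g x))\<^sup>2 \<partial>lebesgue_on \<Omega>) =
        (\<integral>x. ((1 - ratio n x)\<^sup>2)\<^sup>2 * (norm (g x))\<^sup>2 \<partial>lebesgue_on \<Omega>)" for n
    proof (rule Bochner_Integration.integral_cong)
      fix x assume "x \<in> space (lebesgue_on \<Omega>)"
      then have x: "x \<in> \<Omega>" by simp
      have "grad (cut n) x - g x = (- ((1 - ratio n x)\<^sup>2)) *\<^sub>R g x"
        unfolding grad_cut[OF x] by (simp add: vec_eq_iff algebra_simps power2_eq_square)
      then show "(norm (grad (cut n) x - g x))\<^sup>2 = ((1 - ratio n x)\<^sup>2)\<^sup>2 * (norm (g x))\<^sup>2"
        by (simp add: power_mult_distrib)
    qed simp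
    have "(\<lambda>n. \<integral>x. ((1 - ratio n x)\<^sup>2)\<^sup>2 * (norm (g x))\<^sup>2 \<partial>lebesgue_on \<Omega>) \<longlonglongrightarrow> (\<integral>x. 0 \<partial>lebesgue_on \<Omega>)"
    proof (rule integral_dominated_convergence)
      show "integrable (lebesgue_on \<Omega>) (\<lambda>x. (norm (g x))\<^sup>2)"
        using energy_finite by (simp add: L2_on_def)
      show "AE x in lebesgue_on \<Omega>. (\<lambda>n. ((1 - ratio n x)\<^sup>2)\<^sup>2 * (norm (g x))\<^sup>2) \<longlonglongrightarrow> 0"
      proof (rule AE_I2)
        fix x assume "x \<in> space (lebesgue_on \<Omega>)"
        then have x: "x \<in> \<Omega>" by simp
        have "(\<lambda>n. ((1 - ratio n x)\<^sup>2)\<^sup>2 * (norm (g x))\<^sup>2) \<longlonglongrightarrow> ((1 - 1)\<^sup>2)\<^sup>2 * (norm (g x))\<^sup>2"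
          by (intro tendsto_intros ratio_tendsto x)
        then show "(\<lambda>n. ((1 - ratio n x)\<^sup>2)\<^sup>2 * (norm (g x))\<^sup>2) \<longlonglongrightarrow> 0" by simp
      qed
      show "AE x in lebesgue_on \<Omega>. norm (((1 - ratio n x)\<^sup>2)\<^sup>2 * (norm (g x))\<^sup>2) \<le> (norm (g x))\<^sup>2" for n
      proof (rule AE_I2)
        fix x assume "x \<in> space (lebesgue_on \<Omega>)"
        then have "0 \<le> 1 - ratio n x" "1 - ratio n x \<le> 1" using ratio_bounds[of x n] by auto
        then have "((1 - ratio n x)\<^sup>2)\<^sup>2 \<le> 1"
          by (intro power_le_one) auto
        then show "norm (((1 - ratio n x)\<^sup>2)\<^sup>2 * (norm (g x))\<^sup>2) \<le> (norm (g x))\<^sup>2"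
          by (simp add: mult_left_le_one_le)
      qed
      show "(\<lambda>x. ((1 - ratio n x)\<^sup>2)\<^sup>2 * (norm (g x))\<^sup>2) \<in> borel_measurable (lebesgue_on \<Omega>)" for n
        by measurable
    qed auto
    then show ?thesis unfolding eq by simp
  qed
  ultimately show ?thesis
    unfolding H10_def using L2_v energy_finite test_function_cut by auto
qed

lemma eigenvalue: "dirichlet_eigenvalue \<Omega> L"
proof -
  have "\<not> (AE x in lebesgue_on \<Omega>. v x = 0)"
  proof
    assume "AE x in lebesgue_on \<Omega>. v x = 0"
    then have "AE x in lebesgue_on \<Omega>. False"
      by (rule AE_mp) (auto intro!: AE_I2 simp: pos_neq)
    then have "emeasure (lebesgue_on \<Omega>) \<Omega> = 0"
      by (subst (asm) AE_iff_measurable[of \<Omega>]) (use open_dom in \<open>auto simp: sets_restrict_space\<close>)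
    then have "negligible \<Omega>"
      using open_dom by (simp add: emeasure_restrict_space negligible_iff_emeasure0)
    then show False
      using open_not_negligible[OF open_dom dom_nonempty] by simp
  qed
  then show ?thesis
    unfolding dirichlet_eigenvalue_def using in_H10 by_parts by blast
qed

theorem dirichlet_lambda1_eq: "dirichlet_lambda1 \<Omega> = L"
  unfolding dirichlet_lambda1_def
  by (rule Least_equality) (use eigenvalue eigenvalue_ge in auto)

end

section \<open>Entire series\<close>

text \<open>A bound of the size of exponential coefficients. It makes the power series entire and
  survives multiplication of the coefficients by polynomials in \<open>m\<close>, which is how Euler
  derivatives act on them.\<close>

definition fact_decay :: "(nat \<Rightarrow> real) \<Rightarrow> bool" where
  "fact_decay c \<longleftrightarrow> (\<exists>B r. \<forall>m. \<bar>c m\<bar> \<le> B * r ^ m / fact m)"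

lemma fact_decay_summable:
  assumes "fact_decay c"
  shows "summable (\<lambda>m. c m * x ^ m)"
proof -
  obtain B r where B: "\<And>m. \<bar>c m\<bar> \<le> B * r ^ m / fact m"
    using assms unfolding fact_decay_def by blast
  have "summable (\<lambda>m. B * (inverse (fact m) * (r * \<bar>x\<bar>) ^ m))"
    by (intro summable_mult summable_exp)
  then show ?thesis
  proof (rule summable_comparison_test')
    show "norm (c m * x ^ m) \<le> B * (inverse (fact m) * (r * \<bar>x\<bar>) ^ m)" for m
    proof -
      have "norm (c m * x ^ m) \<le> B * r ^ m / fact m * \<bar>x\<bar> ^ m"
        by (simp only: real_norm_def abs_mult power_abs) (rule mult_right_mono[OF B], simp)
      then show ?thesis by (simp add: field_simps)
    qed
  qed
qed

text \<open>A linear factor in \<open>m\<close> is at most a constant times \<open>2 ^ m\<close>,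
  which is absorbed by doubling the rate \<open>r\<close>.\<close>

lemma fact_decay_linear:
  assumes "fact_decay c"
  shows "fact_decay (\<lambda>m. (a * real m + b) * c m)"
proof -
  obtain B r where B: "\<And>m. \<bar>c m\<bar> \<le> B * r ^ m / fact m"
    using assms unfolding fact_decay_def by blast
  have "\<bar>(a * real m + b) * c m\<bar> \<le> ((\<bar>a\<bar> + \<bar>b\<bar>) * B) * (2 * r) ^ m / fact m" for m
  proof -
    have "\<bar>a * real m + b\<bar> \<le> \<bar>a\<bar> * real m + \<bar>b\<bar>"
      by (rule order_trans[OF abs_triangle_ineq]) (simp add: abs_mult)
    also have "\<dots> \<le> \<bar>a\<bar> * 2 ^ m + \<bar>b\<bar> * 2 ^ m"
      using of_nat_less_two_power[of m, where 'a = real]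
      by (intro add_mono mult_left_mono) (auto simp: mult_le_cancel_left1)
    finally have 1: "\<bar>a * real m + b\<bar> \<le> (\<bar>a\<bar> + \<bar>b\<bar>) * 2 ^ m"
      by (simp add: distrib_right)
    have "\<bar>(a * real m + b) * c m\<bar> \<le> ((\<bar>a\<bar> + \<bar>b\<bar>) * 2 ^ m) * (B * r ^ m / fact m)"
      unfolding abs_mult by (rule mult_mono[OF 1 B]) auto
    then show ?thesis by (simp add: power_mult_distrib mult_ac)
  qed
  then show ?thesis unfolding fact_decay_def by blast
qed

lemma DERIV_power_series:
  assumes "fact_decay c"
  shows "((\<lambda>x. \<Sum>m. c m * x ^ m) has_real_derivative (\<Sum>m. diffs c m * x ^ m)) (at x)"
    and "x * (\<Sum>m. diffs c m * x ^ m) = (\<Sum>m. (real m * c m) * x ^ m)"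
proof -
  show "((\<lambda>x. \<Sum>m. c m * x ^ m) has_real_derivative (\<Sum>m. diffs c m * x ^ m)) (at x)"
    by (rule termdiffs_strong_converges_everywhere) (rule fact_decay_summable[OF assms])
  have s: "summable (\<lambda>m. (real m * c m) * x ^ m)"
    using fact_decay_summable[OF fact_decay_linear[OF assms, of 1 0]] by simp
  have s1: "summable (\<lambda>m. diffs c m * x ^ m)"
    by (rule termdiff_converges_all) (rule fact_decay_summable[OF assms])
  have "(\<Sum>m. (real m * c m) * x ^ m) = (\<Sum>m. (real (Suc m) * c (Suc m)) * x ^ Suc m)"
    using suminf_split_head[OF s] by simp
  also have "\<dots> = (\<Sum>m. x * (diffs c m * x ^ m))"
    by (simp add: diffs_def mult_ac)
  also have "\<dots> = x * (\<Sum>m. diffs c m * x ^ m)"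
    by (rule suminf_mult[OF s1])
  finally show "x * (\<Sum>m. diffs c m * x ^ m) = (\<Sum>m. (real m * c m) * x ^ m)" by simp
qed

text \<open>A Frobenius series at the singular point 0, scaled as for Bessel functions. On such
  series \<open>z d/dz\<close> multiplies the m-th coefficient by \<open>2 * m + p\<close>, so that
  differential equations become recurrences.\<close>

definition frobenius :: "(nat \<Rightarrow> real) \<Rightarrow> real \<Rightarrow> real \<Rightarrow> real" where
  "frobenius c p z = (\<Sum>m. c m * ((z / 2)\<^sup>2) ^ m) * (z / 2) powr p"

lemma DERIV_frobenius:
  assumes "fact_decay c" "z > 0"
  shows "(frobenius c p has_real_derivative frobenius (\<lambda>m. (2 * real m + p) * c m) p z / z) (at z)"
proof -
  let ?x = "(z / 2)\<^sup>2"
  let ?S = "\<lambda>c. \<Sum>m. c m * ?x ^ m"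
  have 1: "((\<lambda>z. \<Sum>m. c m * ((z / 2)\<^sup>2) ^ m) has_real_derivative ?S (diffs c) * (z / 2)) (at z)"
    by (rule DERIV_chain2[OF DERIV_power_series(1)[OF assms(1)]])
       (auto intro!: derivative_eq_intros)
  have 2: "((\<lambda>z. (z / 2) powr p) has_real_derivative p * (z / 2) powr p / z) (at z)"
  proof -
    have "((\<lambda>z. (z / 2) powr p) has_real_derivative (p * (z / 2) powr (p - 1)) * (1 / 2)) (at z)"
      by (rule DERIV_chain2[OF has_real_derivative_powr]) (use assms in \<open>auto intro!: derivative_eq_intros\<close>)
    moreover have "(z / 2) powr (p - 1) = (z / 2) powr p / (z / 2)"
      using assms by (simp add: powr_diff)
    ultimately show ?thesis by simp
  qed
  have s: "summable (\<lambda>m. (2 * (real m * c m)) * ?x ^ m)" "summable (\<lambda>m. (p * c m) * ?x ^ m)"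
    using fact_decay_summable[OF fact_decay_linear[OF assms(1), of 2 0]]
      fact_decay_summable[OF fact_decay_linear[OF assms(1), of 0 p]]
    by (simp_all add: mult.assoc)
  have "(\<Sum>m. ((2 * real m + p) * c m) * ?x ^ m) = (\<Sum>m. (2 * (real m * c m)) * ?x ^ m + (p * c m) * ?x ^ m)"
    by (simp add: algebra_simps)
  also have "\<dots> = (\<Sum>m. (2 * (real m * c m)) * ?x ^ m) + (\<Sum>m. (p * c m) * ?x ^ m)"
    by (rule suminf_add[OF s, symmetric])
  also have "(\<Sum>m. (2 * (real m * c m)) * ?x ^ m) = 2 * ?S (\<lambda>m. real m * c m)"
    using suminf_mult[OF fact_decay_summable[OF fact_decay_linear[OF assms(1), of 1 0]], of 2 ?x]
    by (simp add: mult.assoc)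
  also have "?S (\<lambda>m. real m * c m) = ?x * ?S (diffs c)"
    by (rule DERIV_power_series(2)[OF assms(1), symmetric])
  also have "(\<Sum>m. (p * c m) * ?x ^ m) = p * ?S c"
    using suminf_mult[OF fact_decay_summable[OF assms(1)], of p ?x] by (simp add: mult.assoc)
  finally have S: "(\<Sum>m. ((2 * real m + p) * c m) * ?x ^ m) = 2 * (?x * ?S (diffs c)) + p * ?S c" .
  show ?thesis
    unfolding frobenius_def S
    by (rule DERIV_cong[OF DERIV_mult[OF 1 2]]) (use assms(2) in \<open>simp add: field_simps power2_eq_square\<close>)
qed

lemma frobenius_tendsto:
  assumes "fact_decay c"
  shows "((\<lambda>z. (z / 2) powr (- p) * frobenius c p z) \<longlongrightarrow> c 0) (at_right 0)"
proof -
  let ?P = "\<lambda>x. \<Sum>m. c m * x ^ m"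
  have "isCont ?P 0"
    by (rule DERIV_isCont[OF DERIV_power_series(1)[OF assms]])
  moreover have "((\<lambda>z::real. (z / 2)\<^sup>2) \<longlongrightarrow> 0) (at_right 0)"
    by (auto intro!: tendsto_eq_intros)
  ultimately have "((\<lambda>z. ?P ((z / 2)\<^sup>2)) \<longlongrightarrow> ?P 0) (at_right 0)"
    by (rule isCont_tendsto_compose)
  moreover have "?P 0 = c 0"
    using powser_zero[of c] by simp
  moreover have "\<forall>\<^sub>F z in at_right 0. ?P ((z / 2)\<^sup>2) = (z / 2) powr (- p) * frobenius c p z"
    using eventually_at_right_less[of "0::real"]
    by eventually_elim (simp add: frobenius_def powr_minus field_simps)
  ultimately show ?thesis
    using tendsto_cong by force
qed

lemma frobenius_add:
  assumes "fact_decay c" "fact_decay d"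
  shows "frobenius (\<lambda>m. c m + d m) p z = frobenius c p z + frobenius d p z"
proof -
  have "(\<Sum>m. c m * ((z / 2)\<^sup>2) ^ m + d m * ((z / 2)\<^sup>2) ^ m) =
      (\<Sum>m. c m * ((z / 2)\<^sup>2) ^ m) + (\<Sum>m. d m * ((z / 2)\<^sup>2) ^ m)"
    by (rule suminf_add[OF assms[THEN fact_decay_summable], symmetric])
  then show ?thesis
    by (simp only: frobenius_def distrib_right)
qed

lemma frobenius_cmult:
  assumes "fact_decay c"
  shows "frobenius (\<lambda>m. a * c m) p z = a * frobenius c p z"
  unfolding frobenius_def
  using suminf_mult[OF fact_decay_summable[OF assms], of a "(z / 2)\<^sup>2"]
  by (simp add: mult.assoc)

lemma frobenius_shift:
  assumes "fact_decay c" "fact_decay d" "d 0 = 0" "\<And>m. d (Suc m) = c m"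
  shows "frobenius d p z = (z / 2)\<^sup>2 * frobenius c p z"
proof -
  let ?x = "(z / 2)\<^sup>2"
  have "(\<Sum>m. d m * ?x ^ m) = (\<Sum>m. d (Suc m) * ?x ^ Suc m)"
    using suminf_split_head[OF fact_decay_summable[OF assms(2)], of ?x] assms(3) by simp
  also have "\<dots> = (\<Sum>m. ?x * (c m * ?x ^ m))"
    by (simp add: assms(4) mult_ac)
  also have "\<dots> = ?x * (\<Sum>m. c m * ?x ^ m)"
    by (rule suminf_mult[OF fact_decay_summable[OF assms(1)]])
  finally show ?thesis unfolding frobenius_def by simp
qed

section \<open>The derivative of the reciprocal Gamma function\<close>

definition rGamma_deriv :: "real \<Rightarrow> real" where
  "rGamma_deriv x = deriv rGamma x"

lemma DERIV_rGamma: "(rGamma has_real_derivative rGamma_deriv x) (at x)"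
  unfolding rGamma_deriv_def
  using has_field_derivative_rGamma_real'[of x UNIV] DERIV_imp_deriv by fastforce

text \<open>Obtained by differentiating \<open>rGamma x = x * rGamma (x + 1)\<close>. It carries
  facts from positive arguments, where the Digamma formula is available, across the poles of
  Gamma.\<close>

lemma rGamma_deriv_step: "rGamma_deriv x = rGamma (x + 1) + x * rGamma_deriv (x + 1)"
proof -
  have 1: "((\<lambda>x. rGamma (x + 1)) has_real_derivative rGamma_deriv (x + 1) * 1) (at x)"
    by (rule DERIV_chain2[OF DERIV_rGamma]) (auto intro!: derivative_eq_intros)
  have "((\<lambda>x. x * rGamma (x + 1)) has_real_derivative rGamma (x + 1) + x * rGamma_deriv (x + 1)) (at x)"
    by (rule DERIV_cong[OF DERIV_mult[OF DERIV_ident 1]]) simp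
  then have "(rGamma has_real_derivative rGamma (x + 1) + x * rGamma_deriv (x + 1)) (at x)"
    by (simp add: rGamma_plus1)
  then show ?thesis
    using DERIV_unique DERIV_rGamma by blast
qed

lemma rGamma_deriv_pos: "x > 0 \<Longrightarrow> rGamma_deriv x = - rGamma x * Digamma x"
  using has_field_derivative_rGamma_real'[of x UNIV] DERIV_unique[OF DERIV_rGamma[of x]]
  by (metis nonpos_Ints_nonpos not_le)

text \<open>For positive \<open>x\<close> the Digamma formula applies; each use of
  \<open>rGamma_deriv_step\<close> then extends continuity one unit further to the left.\<close>

lemma isCont_rGamma_deriv: "isCont rGamma_deriv x"
proof -
  have "x > - real k \<Longrightarrow> isCont rGamma_deriv x" for k
  proof (induction k arbitrary: x)
    case 0
    have "isCont (\<lambda>x. - rGamma x * Digamma x) x"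
      using 0 by (intro continuous_intros) (auto dest: nonpos_Ints_nonpos)
    moreover have "\<forall>\<^sub>F y in nhds x. rGamma_deriv y = - rGamma y * Digamma y"
      using eventually_nhds_in_open[of "{0<..}" x] 0
      by (auto elim!: eventually_mono simp: rGamma_deriv_pos)
    ultimately show ?case
      using isCont_cong by fast
  next
    case (Suc k)
    have "isCont rGamma_deriv (x + 1)"
      using Suc by simp
    then have "isCont (\<lambda>x. rGamma (x + 1) + x * rGamma_deriv (x + 1)) x"
      by (intro continuous_intros isCont_o2[where g = rGamma_deriv and f = "\<lambda>x. x + 1"]) auto
    moreover have "rGamma_deriv = (\<lambda>x. rGamma (x + 1) + x * rGamma_deriv (x + 1))"
      using rGamma_deriv_step by (rule ext)
    ultimately show ?case by metis
  qed
  moreover obtain k where "- x < real k"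
    using reals_Archimedean2 by blast
  ultimately show ?thesis
    using minus_less_iff by blast
qed

text \<open>Both functions are bounded on a compact interval. Each unit step to the right divides by
  some \<open>t \<ge> 1\<close>, so \<open>rGamma\<close> keeps its bound and its derivative gains
  at most one further \<open>C\<close>; the linear growth is absorbed in
  \<open>2 ^ m\<close>.\<close>

lemma rGamma_bounds:
  assumes "0 \<le> M"
  shows "\<exists>C. \<forall>m. \<forall>\<mu>\<in>{-M..M}. \<bar>rGamma (\<mu> + real m + 1)\<bar> \<le> C * 2 ^ m \<and> \<bar>rGamma_deriv (\<mu> + real m + 1)\<bar> \<le> C * 2 ^ m"
proof -
  \<comment> \<open>The base interval is to end at \<open>2 + real k\<close>: beyond it
    \<open>t = y - 1\<close> is at least 1, and after \<open>m\<close> unit steps it contains every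
    \<open>\<mu> + m + 1\<close> with \<open>\<mu> \<le> M < k\<close>.\<close>
  obtain k :: nat where k: "M < real k"
    using reals_Archimedean2 by blast
  have "bounded (rGamma ` {- M..2 + real k})"
    by (intro compact_imp_bounded compact_continuous_image continuous_on_rGamma) auto
  then obtain C1 where C1: "\<And>y. y \<in> {- M..2 + real k} \<Longrightarrow> \<bar>rGamma y\<bar> \<le> C1"
    unfolding bounded_iff by (metis imageI real_norm_def)
  have "bounded (rGamma_deriv ` {- M..2 + real k})"
    by (intro compact_imp_bounded compact_continuous_image continuous_at_imp_continuous_on)
       (auto simp: isCont_rGamma_deriv)
  then obtain C2 where C2: "\<And>y. y \<in> {- M..2 + real k} \<Longrightarrow> \<bar>rGamma_deriv y\<bar> \<le> C2"
    unfolding bounded_iff by (metis imageI real_norm_def)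
  define C where "C = max 0 (max C1 C2)"
  have C: "0 \<le> C" "C1 \<le> C" "C2 \<le> C" unfolding C_def by auto
  have *: "\<bar>rGamma y\<bar> \<le> C \<and> \<bar>rGamma_deriv y\<bar> \<le> C * (1 + real j)"
    if "- M \<le> y" "y \<le> 2 + real k + real j" for j y
    using that
  proof (induction j arbitrary: y)
    case 0
    then show ?case using C1[of y] C2[of y] C by auto
  next
    case (Suc j)
    show ?case
    proof (cases "y \<le> 2 + real k + real j")
      case True
      then have "\<bar>rGamma y\<bar> \<le> C \<and> \<bar>rGamma_deriv y\<bar> \<le> C * (1 + real j)" using Suc by blast
      moreover have "C * (1 + real j) \<le> C * (1 + real (Suc j))"
        using C by (intro mult_left_mono) auto
      ultimately show ?thesis by linarith
    next
      case False
      define t where "t = y - 1"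
      have t: "t \<ge> 1" "y = t + 1" using False unfolding t_def by auto
      have "- M \<le> t" using t assms by linarith
      then have IH: "\<bar>rGamma t\<bar> \<le> C" "\<bar>rGamma_deriv t\<bar> \<le> C * (1 + real j)"
        using Suc.IH[of t] Suc.prems t by auto
      have r: "rGamma y = rGamma t / t"
        using rGamma_plus1[of t] t by (simp add: field_simps)
      have "\<bar>rGamma y\<bar> \<le> \<bar>rGamma t\<bar> / 1"
        unfolding r abs_divide using t by (intro divide_left_mono) auto
      then have 1: "\<bar>rGamma y\<bar> \<le> C" using IH by simp
      have "rGamma_deriv y = (rGamma_deriv t - rGamma y) / t"
        using rGamma_deriv_step[of t] t by (simp add: field_simps)
      then have "\<bar>rGamma_deriv y\<bar> \<le> \<bar>rGamma_deriv t - rGamma y\<bar> / 1"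
        using t by (simp only: abs_divide) (intro divide_left_mono; simp)
      also have "\<dots> \<le> C * (1 + real j) + C"
        unfolding div_by_1
        using IH(2) 1 abs_triangle_ineq4[of "rGamma_deriv t" "rGamma y"] by linarith
      finally show ?thesis using 1 by (simp add: algebra_simps)
    qed
  qed
  have "\<bar>rGamma (\<mu> + real m + 1)\<bar> \<le> C * 2 ^ m \<and> \<bar>rGamma_deriv (\<mu> + real m + 1)\<bar> \<le> C * 2 ^ m"
    if "\<mu> \<in> {-M..M}" for \<mu> m
  proof -
    have "\<bar>rGamma (\<mu> + real m + 1)\<bar> \<le> C" "\<bar>rGamma_deriv (\<mu> + real m + 1)\<bar> \<le> C * (1 + real m)"
      using *[of "\<mu> + real m + 1" m] that k by auto
    moreover have "C * (1 + real m) \<le> C * 2 ^ m"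
    proof -
      have "1 + m \<le> 2 ^ m"
        using Suc_leI[OF less_exp[of m]] by simp
      then have "real (1 + m) \<le> real (2 ^ m)" by (simp only: of_nat_le_iff)
      then show ?thesis using C by (intro mult_left_mono) auto
    qed
    moreover have "C * 1 \<le> C * 2 ^ m" using C by (intro mult_left_mono) auto
    ultimately show ?thesis by linarith
  qed
  then show ?thesis by blast
qed

section \<open>Coefficients and differential equation of the Bessel functions of the first
  kind\<close>

definition bessel_coeff :: "real \<Rightarrow> nat \<Rightarrow> real" where
  "bessel_coeff \<mu> m = (- 1) ^ m / fact m * rGamma (\<mu> + real m + 1)"

text \<open>The derivative of \<open>bessel_coeff \<mu> m\<close> with respect to the order
  \<open>\<mu>\<close>.\<close>

definition bessel_coeff' :: "real \<Rightarrow> nat \<Rightarrow> real" where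
  "bessel_coeff' \<mu> m = (- 1) ^ m / fact m * rGamma_deriv (\<mu> + real m + 1)"

lemma bessel_J_frobenius: "bessel_J \<nu> = frobenius (bessel_coeff \<nu>) \<nu>"
  by (simp add: fun_eq_iff bessel_J_def frobenius_def bessel_coeff_def power_mult)

lemma bessel_coeff_bounds:
  assumes "0 \<le> M"
  obtains C where "\<And>\<mu> m. \<mu> \<in> {-M..M} \<Longrightarrow> \<bar>bessel_coeff \<mu> m\<bar> \<le> C * 2 ^ m / fact m"
    "\<And>\<mu> m. \<mu> \<in> {-M..M} \<Longrightarrow> \<bar>bessel_coeff' \<mu> m\<bar> \<le> C * 2 ^ m / fact m"
proof -
  obtain C where "\<And>m \<mu>. \<mu>\<in>{-M..M} \<Longrightarrow> \<bar>rGamma (\<mu> + real m + 1)\<bar> \<le> C * 2 ^ m \<and> \<bar>rGamma_deriv (\<mu> + real m + 1)\<bar> \<le> C * 2 ^ m"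
    using rGamma_bounds[OF assms] by blast
  then show ?thesis
    by (intro that[of C]) (auto simp: bessel_coeff_def bessel_coeff'_def abs_mult intro!: divide_right_mono)
qed

lemma fact_decay_bessel: "fact_decay (bessel_coeff \<mu>)" "fact_decay (bessel_coeff' \<mu>)"
proof -
  obtain C where C: "\<And>\<mu>' m. \<mu>' \<in> {-\<bar>\<mu>\<bar>..\<bar>\<mu>\<bar>} \<Longrightarrow> \<bar>bessel_coeff \<mu>' m\<bar> \<le> C * 2 ^ m / fact m"
    "\<And>\<mu>' m. \<mu>' \<in> {-\<bar>\<mu>\<bar>..\<bar>\<mu>\<bar>} \<Longrightarrow> \<bar>bessel_coeff' \<mu>' m\<bar> \<le> C * 2 ^ m / fact m"
    using bessel_coeff_bounds[OF abs_ge_zero[of \<mu>]] by blast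
  have "\<mu> \<in> {-\<bar>\<mu>\<bar>..\<bar>\<mu>\<bar>}" by auto
  then show "fact_decay (bessel_coeff \<mu>)" "fact_decay (bessel_coeff' \<mu>)"
    unfolding fact_decay_def using C by blast+
qed

lemma Suc_times_alternating_fact:
  "real (Suc m) * ((- 1) ^ Suc m / fact (Suc m) * t) = - ((- 1) ^ m / fact m * t)"
  by (simp del: of_nat_Suc)

lemma Suc_times_bessel_coeff:
  "real (Suc m) * bessel_coeff \<mu> (Suc m) = - ((- 1) ^ m / fact m * rGamma (\<mu> + real m + 1 + 1))"
  "real (Suc m) * bessel_coeff' \<mu> (Suc m) = - ((- 1) ^ m / fact m * rGamma_deriv (\<mu> + real m + 1 + 1))"
  unfolding bessel_coeff_def bessel_coeff'_def Suc_times_alternating_fact by (simp_all add: add_ac)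

text \<open>\<open>rGamma_plus1\<close> holds at the poles of Gamma too, so the recurrence covers
  every real order, negative integers included.\<close>

lemma bessel_coeff_Suc:
  "real (Suc m) * (real (Suc m) + \<mu>) * bessel_coeff \<mu> (Suc m) = - bessel_coeff \<mu> m"
proof -
  have "real (Suc m) * (real (Suc m) + \<mu>) * bessel_coeff \<mu> (Suc m)
      = (\<mu> + real m + 1) * (real (Suc m) * bessel_coeff \<mu> (Suc m))"
    by (simp add: algebra_simps)
  also have "\<dots> = - ((- 1) ^ m / fact m * ((\<mu> + real m + 1) * rGamma (\<mu> + real m + 1 + 1)))"
    unfolding Suc_times_bessel_coeff by simp
  also have "\<dots> = - bessel_coeff \<mu> m"
    unfolding rGamma_plus1 bessel_coeff_def ..
  finally show ?thesis .
qed

text \<open>This is the derivative in \<open>\<mu>\<close> of the recurrence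
  \<open>bessel_coeff_Suc\<close>; the additional term comes from the factor
  \<open>m + 1 + \<mu>\<close>.\<close>

lemma bessel_coeff'_Suc:
  "real (Suc m) * (real (Suc m) + \<mu>) * bessel_coeff' \<mu> (Suc m) + real (Suc m) * bessel_coeff \<mu> (Suc m)
    = - bessel_coeff' \<mu> m"
proof -
  define s :: real where "s = (- 1) ^ m / fact m"
  have "real (Suc m) * (real (Suc m) + \<mu>) * bessel_coeff' \<mu> (Suc m) + real (Suc m) * bessel_coeff \<mu> (Suc m)
      = (\<mu> + real m + 1) * (real (Suc m) * bessel_coeff' \<mu> (Suc m)) + real (Suc m) * bessel_coeff \<mu> (Suc m)"
    by (simp add: algebra_simps)
  also have "\<dots> = - (s * (rGamma (\<mu> + real m + 1 + 1) + (\<mu> + real m + 1) * rGamma_deriv (\<mu> + real m + 1 + 1)))"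
    unfolding Suc_times_bessel_coeff s_def[symmetric] by (simp add: algebra_simps)
  also have "\<dots> = - bessel_coeff' \<mu> m"
    unfolding rGamma_deriv_step[symmetric] bessel_coeff'_def s_def ..
  finally show ?thesis .
qed

text \<open>The pair \<open>(f, f')\<close> solves Bessel's equation written as a first-order system in the Euler
  derivative \<open>z d/dz\<close>; that is, \<open>f' z = z * deriv f z\<close>.\<close>

definition bessel_sol :: "real \<Rightarrow> (real \<Rightarrow> real) \<Rightarrow> (real \<Rightarrow> real) \<Rightarrow> bool" where
  "bessel_sol \<nu> f f' \<longleftrightarrow> (\<forall>z>0. (f has_real_derivative f' z / z) (at z) \<and>
      (f' has_real_derivative (\<nu>\<^sup>2 - z\<^sup>2) * f z / z) (at z))"

lemma bessel_sol_linear: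
  assumes "bessel_sol \<nu> f f'" "bessel_sol \<nu> g g'"
  shows "bessel_sol \<nu> (\<lambda>z. a * f z + b * g z) (\<lambda>z. a * f' z + b * g' z)"
  unfolding bessel_sol_def
proof (intro allI impI conjI)
  fix z :: real assume z: "z > 0"
  have d: "(f has_real_derivative f' z / z) (at z)" "(f' has_real_derivative (\<nu>\<^sup>2 - z\<^sup>2) * f z / z) (at z)"
    "(g has_real_derivative g' z / z) (at z)" "(g' has_real_derivative (\<nu>\<^sup>2 - z\<^sup>2) * g z / z) (at z)"
    using assms z unfolding bessel_sol_def by auto
  show "((\<lambda>z. a * f z + b * g z) has_real_derivative (a * f' z + b * g' z) / z) (at z)"
    by (rule DERIV_cong[OF DERIV_add[OF DERIV_cmult[OF d(1)] DERIV_cmult[OF d(3)]]])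
       (simp add: add_divide_distrib)
  show "((\<lambda>z. a * f' z + b * g' z) has_real_derivative (\<nu>\<^sup>2 - z\<^sup>2) * (a * f z + b * g z) / z) (at z)"
    by (rule DERIV_cong[OF DERIV_add[OF DERIV_cmult[OF d(2)] DERIV_cmult[OF d(4)]]])
       (use z in \<open>simp add: field_simps\<close>)
qed

text \<open>The Euler derivative \<open>z d/dz\<close> of \<open>bessel_J \<mu>\<close>, read off
  the series; the ordinary derivative is \<open>bessel_J' \<mu> z / z\<close>.\<close>

definition bessel_J' :: "real \<Rightarrow> real \<Rightarrow> real" where
  "bessel_J' \<mu> = frobenius (\<lambda>m. (2 * real m + \<mu>) * bessel_coeff \<mu> m) \<mu>"

text \<open>Two Euler derivatives multiply the coefficients by
  \<open>(2 * m + \<mu>)^2 = \<mu>^2 + 4 * m * (m + \<mu>)\<close>. By the recurrence the second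
  summand produces minus the series shifted by one place, that is, \<open>- z^2\<close> times the
  function.\<close>

lemma bessel_sol_J: "bessel_sol \<mu> (bessel_J \<mu>) (bessel_J' \<mu>)"
  unfolding bessel_sol_def
proof (intro allI impI conjI)
  fix z :: real assume z: "z > 0"
  let ?c = "bessel_coeff \<mu>"
  note d = fact_decay_bessel(1)[of \<mu>]
  note d1 = fact_decay_linear[OF d, of 2 \<mu>]
  show "(bessel_J \<mu> has_real_derivative bessel_J' \<mu> z / z) (at z)"
    unfolding bessel_J_frobenius bessel_J'_def by (rule DERIV_frobenius[OF d z])
  have "frobenius (\<lambda>m. (2 * real m + \<mu>) * ((2 * real m + \<mu>) * ?c m)) \<mu> z
      = frobenius (\<lambda>m. \<mu>\<^sup>2 * ?c m + (- 4) * (- (real m * (real m + \<mu>) * ?c m))) \<mu> z"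
    by (intro arg_cong[of _ _ "\<lambda>c. frobenius c \<mu> z"] ext) (simp add: algebra_simps power2_eq_square)
  also have "\<dots> = frobenius (\<lambda>m. \<mu>\<^sup>2 * ?c m) \<mu> z + frobenius (\<lambda>m. (- 4) * (- (real m * (real m + \<mu>) * ?c m))) \<mu> z"
  proof (rule frobenius_add)
    show "fact_decay (\<lambda>m. \<mu>\<^sup>2 * ?c m)"
      using fact_decay_linear[OF d, of 0 "\<mu>\<^sup>2"] by simp
    show "fact_decay (\<lambda>m. (- 4) * (- (real m * (real m + \<mu>) * ?c m)))"
      using fact_decay_linear[OF fact_decay_linear[OF d, of 1 \<mu>], of 4 0] by (simp add: mult.assoc)
  qed
  also have "frobenius (\<lambda>m. (- 4) * (- (real m * (real m + \<mu>) * ?c m))) \<mu> z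
      = (- 4) * frobenius (\<lambda>m. - (real m * (real m + \<mu>) * ?c m)) \<mu> z"
    using fact_decay_linear[OF fact_decay_linear[OF d, of 1 \<mu>], of "- 1" 0]
    by (intro frobenius_cmult) (simp add: mult.assoc)
  also have "frobenius (\<lambda>m. - (real m * (real m + \<mu>) * ?c m)) \<mu> z = (z / 2)\<^sup>2 * frobenius ?c \<mu> z"
    using fact_decay_linear[OF fact_decay_linear[OF d, of 1 \<mu>], of "- 1" 0] bessel_coeff_Suc[of _ \<mu>]
    by (intro frobenius_shift[OF d]) (simp_all add: mult.assoc)
  also have "frobenius (\<lambda>m. \<mu>\<^sup>2 * ?c m) \<mu> z = \<mu>\<^sup>2 * frobenius ?c \<mu> z"
    by (rule frobenius_cmult[OF d])
  finally have e: "frobenius (\<lambda>m. (2 * real m + \<mu>) * ((2 * real m + \<mu>) * ?c m)) \<mu> z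
      = (\<mu>\<^sup>2 - z\<^sup>2) * bessel_J \<mu> z"
    by (simp add: bessel_J_frobenius algebra_simps power2_eq_square)
  show "(bessel_J' \<mu> has_real_derivative (\<mu>\<^sup>2 - z\<^sup>2) * bessel_J \<mu> z / z) (at z)"
    using DERIV_frobenius[OF d1 z, of \<mu>] unfolding e bessel_J'_def .
qed

lemma bessel_J_tendsto:
  "((\<lambda>z. (z / 2) powr (- \<mu>) * bessel_J \<mu> z) \<longlongrightarrow> rGamma (\<mu> + 1)) (at_right 0)"
  "((\<lambda>z. (z / 2) powr (- \<mu>) * bessel_J' \<mu> z) \<longlongrightarrow> \<mu> * rGamma (\<mu> + 1)) (at_right 0)"
proof -
  show "((\<lambda>z. (z / 2) powr (- \<mu>) * bessel_J \<mu> z) \<longlongrightarrow> rGamma (\<mu> + 1)) (at_right 0)"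
    unfolding bessel_J_frobenius
    by (rule tendsto_eq_rhs[OF frobenius_tendsto[OF fact_decay_bessel(1)]]) (simp add: bessel_coeff_def)
  show "((\<lambda>z. (z / 2) powr (- \<mu>) * bessel_J' \<mu> z) \<longlongrightarrow> \<mu> * rGamma (\<mu> + 1)) (at_right 0)"
    unfolding bessel_J'_def
    by (rule tendsto_eq_rhs[OF frobenius_tendsto[OF fact_decay_linear[OF fact_decay_bessel(1)]]])
       (simp add: bessel_coeff_def)
qed

section \<open>Differentiation with respect to the order\<close>

text \<open>The coefficient bounds are uniform for orders in \<open>{-M..M}\<close>, which permits
  termwise differentiation; \<open>M = \<bar>\<nu>\<bar> + 1\<close> puts \<open>\<nu>\<close> in
  the interior.\<close>

lemma DERIV_bessel_series_order:
  "((\<lambda>\<mu>. \<Sum>m. bessel_coeff \<mu> m * x ^ m) has_real_derivative (\<Sum>m. bessel_coeff' \<nu> m * x ^ m)) (at \<nu>)"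
proof -
  define M where "M = \<bar>\<nu>\<bar> + 1"
  have M: "0 \<le> M" "\<nu> \<in> interior {-M..M}" unfolding M_def by auto
  obtain C where "\<And>\<mu> m. \<mu> \<in> {-M..M} \<Longrightarrow> \<bar>bessel_coeff \<mu> m\<bar> \<le> C * 2 ^ m / fact m"
    and C: "\<And>\<mu> m. \<mu> \<in> {-M..M} \<Longrightarrow> \<bar>bessel_coeff' \<mu> m\<bar> \<le> C * 2 ^ m / fact m"
    using bessel_coeff_bounds[OF M(1)] by blast
  have u: "uniformly_convergent_on {-M..M} (\<lambda>n \<mu>. \<Sum>i<n. bessel_coeff' \<mu> i * x ^ i)"
  proof (rule Weierstrass_m_test')
    show "norm (bessel_coeff' \<mu> n * x ^ n) \<le> C * (inverse (fact n) * (2 * \<bar>x\<bar>) ^ n)" if "\<mu> \<in> {-M..M}" for n \<mu>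
    proof -
      have "norm (bessel_coeff' \<mu> n * x ^ n) \<le> (C * 2 ^ n / fact n) * \<bar>x\<bar> ^ n"
        by (simp only: real_norm_def abs_mult power_abs) (rule mult_right_mono[OF C[OF that]], simp)
      then show ?thesis by (simp add: field_simps)
    qed
    show "summable (\<lambda>n. C * (inverse (fact n) * (2 * \<bar>x\<bar>) ^ n))"
      by (intro summable_mult summable_exp)
  qed
  have d: "((\<lambda>\<mu>. bessel_coeff \<mu> n * x ^ n) has_real_derivative bessel_coeff' \<mu> n * x ^ n) (at \<mu> within {-M..M})" for n \<mu>
  proof -
    have "((\<lambda>\<mu>. rGamma (\<mu> + real n + 1)) has_real_derivative rGamma_deriv (\<mu> + real n + 1) * 1) (at \<mu>)"
      by (rule DERIV_chain2[OF DERIV_rGamma]) (auto intro!: derivative_eq_intros)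
    then have "((\<lambda>\<mu>. (- 1) ^ n / fact n * rGamma (\<mu> + real n + 1) * x ^ n) has_real_derivative
        (- 1) ^ n / fact n * (rGamma_deriv (\<mu> + real n + 1) * 1) * x ^ n) (at \<mu>)"
      by (intro DERIV_cmult DERIV_cmult_right)
    then show ?thesis
      unfolding bessel_coeff_def bessel_coeff'_def by (simp add: has_field_derivative_at_within)
  qed
  show ?thesis
    by (rule has_field_derivative_series'(2)[where S = "{-M..M}" and f = "\<lambda>n \<mu>. bessel_coeff \<mu> n * x ^ n"
          and f' = "\<lambda>n \<mu>. bessel_coeff' \<mu> n * x ^ n" and x0 = \<nu>])
       (use M u d in \<open>auto intro: fact_decay_summable fact_decay_bessel simp: M_def\<close>)
qed

text \<open>The logarithm stems from differentiating \<open>(z / 2) powr \<mu>\<close> in the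
  exponent.\<close>

definition bessel_J_order_deriv :: "real \<Rightarrow> real \<Rightarrow> real" where
  "bessel_J_order_deriv \<mu> z = frobenius (bessel_coeff' \<mu>) \<mu> z + ln (z / 2) * bessel_J \<mu> z"

lemma DERIV_bessel_J_order:
  assumes "z > 0"
  shows "((\<lambda>\<mu>. bessel_J \<mu> z) has_real_derivative bessel_J_order_deriv \<nu> z) (at \<nu>)"
proof -
  have "((\<lambda>\<mu>. (z / 2) powr \<mu>) has_real_derivative ln (z / 2) * (z / 2) powr \<nu>) (at \<nu>)"
    using assms by (auto intro!: derivative_eq_intros simp: powr_def)
  from DERIV_mult[OF DERIV_bessel_series_order this] show ?thesis
    unfolding bessel_J_frobenius bessel_J_order_deriv_def frobenius_def
    by (rule DERIV_cong) (simp add: algebra_simps)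
qed

section \<open>The Bessel function of the second kind\<close>

lemma rGamma_real_pos: "(x::real) > 0 \<Longrightarrow> rGamma x > 0"
  by (simp add: rGamma_inverse_Gamma Gamma_real_pos)

lemma rGamma_reflection_real:
  assumes "(x::real) > 0"
  shows "rGamma (1 - x) = sin (x * pi) * Gamma x / pi"
proof -
  have "complex_of_real (rGamma x * rGamma (1 - x)) = complex_of_real (sin (pi * x) / pi)"
    using rGamma_reflection_complex[of "complex_of_real x"]
    by (simp add: rGamma_complex_of_real[symmetric] sin_of_real[symmetric])
  then have "rGamma x * rGamma (1 - x) = sin (pi * x) / pi"
    by (simp only: of_real_eq_iff)
  moreover have "rGamma x * Gamma x = 1"
    using Gamma_real_pos[OF assms] by (simp add: rGamma_inverse_Gamma)
  ultimately show ?thesis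
    by (metis (no_types, opaque_lifting) mult.assoc mult.commute mult_1 times_divide_eq_right)
qed

text \<open>The two limits fix the growth at 0. Multiplied with the corresponding limits for
  \<open>bessel_J\<close>, they determine the Wronskian.\<close>

definition bessel_second_kind :: "real \<Rightarrow> (real \<Rightarrow> real) \<Rightarrow> (real \<Rightarrow> real) \<Rightarrow> bool" where
  "bessel_second_kind \<nu> f f' \<longleftrightarrow> bessel_sol \<nu> f f' \<and>
     ((\<lambda>z. (z / 2) powr \<nu> * f z) \<longlongrightarrow> - Gamma \<nu> / pi) (at_right 0) \<and>
     ((\<lambda>z. (z / 2) powr \<nu> * f' z) \<longlongrightarrow> \<nu> * Gamma \<nu> / pi) (at_right 0)"

text \<open>\<open>bessel_J\<close> and its Euler derivative are at most of the order of
  \<open>z powr \<nu>\<close>, so the products are bounded by multiples of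
  \<open>z powr (2 * \<nu>)\<close>, with or without a logarithm, and \<open>\<nu>\<close> is
  positive.\<close>

lemma powr_mult_J_tendsto_0:
  assumes "\<nu> > 0"
  shows "((\<lambda>z. (z / 2) powr \<nu> * bessel_J \<nu> z) \<longlongrightarrow> 0) (at_right 0)"
    "((\<lambda>z. (z / 2) powr \<nu> * bessel_J' \<nu> z) \<longlongrightarrow> 0) (at_right 0)"
    "((\<lambda>z. (z / 2) powr \<nu> * (ln (z / 2) * bessel_J \<nu> z)) \<longlongrightarrow> 0) (at_right 0)"
    "((\<lambda>z. (z / 2) powr \<nu> * (ln (z / 2) * bessel_J' \<nu> z)) \<longlongrightarrow> 0) (at_right 0)"
proof -
  have p: "((\<lambda>z::real. (z / 2) powr (2 * \<nu>)) \<longlongrightarrow> 0) (at_right 0)"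
    "((\<lambda>z::real. (z / 2) powr (2 * \<nu>) * ln (z / 2)) \<longlongrightarrow> 0) (at_right 0)"
    using assms by real_asymp+
  have e: "(z / 2) powr (2 * \<nu>) * ((z / 2) powr (- \<nu>) * a) = (z / 2) powr \<nu> * a" if "z > 0" for z a :: real
    using that by (simp add: powr_add[symmetric] mult.assoc[symmetric])
  have "\<forall>\<^sub>F z in at_right 0. (z / 2) powr (2 * \<nu>) * ((z / 2) powr (- \<nu>) * f z) = (z / 2) powr \<nu> * f z" for f :: "real \<Rightarrow> real"
    using eventually_at_right_less[of "0::real"] by eventually_elim (rule e)
  then have c: "((\<lambda>z. (z / 2) powr \<nu> * f z) \<longlongrightarrow> 0) (at_right 0)"
    if "((\<lambda>z. (z / 2) powr (2 * \<nu>) * ((z / 2) powr (- \<nu>) * f z)) \<longlongrightarrow> 0) (at_right 0)" for f :: "real \<Rightarrow> real"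
    using that by (rule Lim_transform_eventually[rotated])
  show "((\<lambda>z. (z / 2) powr \<nu> * bessel_J \<nu> z) \<longlongrightarrow> 0) (at_right 0)"
    by (rule c) (use tendsto_mult[OF p(1) bessel_J_tendsto(1)] in simp)
  show "((\<lambda>z. (z / 2) powr \<nu> * bessel_J' \<nu> z) \<longlongrightarrow> 0) (at_right 0)"
    by (rule c) (use tendsto_mult[OF p(1) bessel_J_tendsto(2)] in simp)
  show "((\<lambda>z. (z / 2) powr \<nu> * (ln (z / 2) * bessel_J \<nu> z)) \<longlongrightarrow> 0) (at_right 0)"
    by (rule c) (use tendsto_mult[OF p(2) bessel_J_tendsto(1)[of \<nu>]] in \<open>simp add: mult_ac\<close>)
  show "((\<lambda>z. (z / 2) powr \<nu> * (ln (z / 2) * bessel_J' \<nu> z)) \<longlongrightarrow> 0) (at_right 0)"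
    by (rule c) (use tendsto_mult[OF p(2) bessel_J_tendsto(2)[of \<nu>]] in \<open>simp add: mult_ac\<close>)
qed

text \<open>At 0 the part with \<open>bessel_J (- \<nu>)\<close> dominates. Its leading constant,
  \<open>rGamma (1 - \<nu>)\<close> over the sine, becomes \<open>Gamma \<nu> / pi\<close> by the
  reflection formula.\<close>

lemma bessel_Y_noninteger:
  assumes "\<nu> > 0" "\<nu> \<notin> \<int>"
  shows "\<exists>Y'. bessel_second_kind \<nu> (bessel_Y \<nu>) Y'"
proof -
  define s where "s = sin (\<nu> * pi)"
  have s0: "s \<noteq> 0"
    using assms(2) by (simp add: s_def sin_times_pi_eq_0)
  define a where "a = cos (\<nu> * pi) / s"
  define b where "b = - 1 / s"
  have Y: "bessel_Y \<nu> = (\<lambda>z. a * bessel_J \<nu> z + b * bessel_J (- \<nu>) z)"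
    using assms(2) s0 by (auto simp: fun_eq_iff bessel_Y_def Let_def a_def b_def s_def field_simps)
  define Y' where "Y' = (\<lambda>z. a * bessel_J' \<nu> z + b * bessel_J' (- \<nu>) z)"
  have "bessel_sol \<nu> (bessel_J (- \<nu>)) (bessel_J' (- \<nu>))"
    using bessel_sol_J[of "- \<nu>"] by (simp add: bessel_sol_def)
  then have "bessel_sol \<nu> (bessel_Y \<nu>) Y'"
    unfolding Y Y'_def by (intro bessel_sol_linear bessel_sol_J)
  moreover have b: "b * rGamma (- \<nu> + 1) = - Gamma \<nu> / pi"
    using rGamma_reflection_real[OF assms(1)] s0 by (simp add: b_def s_def)
  have "((\<lambda>z. a * ((z / 2) powr \<nu> * bessel_J \<nu> z) + b * ((z / 2) powr (- (- \<nu>)) * bessel_J (- \<nu>) z))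
      \<longlongrightarrow> a * 0 + b * rGamma (- \<nu> + 1)) (at_right 0)"
    by (intro tendsto_intros powr_mult_J_tendsto_0 bessel_J_tendsto assms)
  then have "((\<lambda>z. (z / 2) powr \<nu> * bessel_Y \<nu> z) \<longlongrightarrow> - Gamma \<nu> / pi) (at_right 0)"
    unfolding b Y by (simp add: algebra_simps)
  moreover have "((\<lambda>z. a * ((z / 2) powr \<nu> * bessel_J' \<nu> z) + b * ((z / 2) powr (- (- \<nu>)) * bessel_J' (- \<nu>) z))
      \<longlongrightarrow> a * 0 + b * (- \<nu> * rGamma (- \<nu> + 1))) (at_right 0)"
    by (intro tendsto_intros powr_mult_J_tendsto_0 bessel_J_tendsto assms)
  then have "((\<lambda>z. (z / 2) powr \<nu> * Y' z) \<longlongrightarrow> - \<nu> * (b * rGamma (- \<nu> + 1))) (at_right 0)"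
    unfolding Y'_def by (simp add: algebra_simps)
  then have "((\<lambda>z. (z / 2) powr \<nu> * Y' z) \<longlongrightarrow> \<nu> * Gamma \<nu> / pi) (at_right 0)"
    unfolding b by simp
  ultimately show ?thesis
    unfolding bessel_second_kind_def by blast
qed

text \<open>The first \<open>n\<close> coefficients of order \<open>- n\<close> vanish because
  \<open>rGamma\<close> vanishes at nonpositive integers; the remaining ones are those of order
  \<open>n\<close>, shifted by \<open>n\<close> places and multiplied by
  \<open>(- 1) ^ n\<close>.\<close>

lemma bessel_J_neg_int: "bessel_J (- real n) z = (- 1) ^ n * bessel_J (real n) z" if "z > 0"
proof -
  let ?x = "(z / 2)\<^sup>2"
  have z0: "bessel_coeff (- real n) m = 0" if "m < n" for m
  proof -
    have "- real n + real m + 1 = - of_nat (n - Suc m)"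
      using that by (simp add: of_nat_diff)
    then have "- real n + real m + 1 \<in> \<int>\<^sub>\<le>\<^sub>0" by (simp only: minus_of_nat_in_nonpos_Ints)
    then show ?thesis by (simp add: bessel_coeff_def rGamma_eq_zero_iff)
  qed
  have s: "bessel_coeff (- real n) (m + n) = (- 1) ^ n * bessel_coeff (real n) m" for m
  proof -
    have "rGamma (real m + 1) = 1 / fact m" "rGamma (real n + real m + 1) = 1 / fact (n + m)"
      using Gamma_fact[of m, where 'a = real] Gamma_fact[of "n + m", where 'a = real]
      by (simp_all add: rGamma_inverse_Gamma add_ac divide_inverse)
    then show ?thesis
      by (simp add: bessel_coeff_def power_add add_ac mult_ac)
  qed
  have "(\<Sum>m. bessel_coeff (- real n) m * ?x ^ m) = (\<Sum>m. bessel_coeff (- real n) (m + n) * ?x ^ (m + n))"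
    using suminf_split_initial_segment[OF fact_decay_summable[OF fact_decay_bessel(1)[of "- real n"]], of ?x n] z0
    by simp
  also have "\<dots> = (\<Sum>m. ((- 1) ^ n * ?x ^ n) * (bessel_coeff (real n) m * ?x ^ m))"
    unfolding s by (simp add: power_add mult_ac)
  also have "\<dots> = ((- 1) ^ n * ?x ^ n) * (\<Sum>m. bessel_coeff (real n) m * ?x ^ m)"
    by (rule suminf_mult[OF fact_decay_summable[OF fact_decay_bessel(1)]])
  finally have e: "(\<Sum>m. bessel_coeff (- real n) m * ?x ^ m) = ((- 1) ^ n * ?x ^ n) * (\<Sum>m. bessel_coeff (real n) m * ?x ^ m)" .
  have "?x ^ n * (z / 2) powr (- real n) = (z / 2) powr (real n)"
  proof -
    have "?x ^ n = (z / 2) ^ (2 * n)" by (simp only: power_mult)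
    also have "\<dots> = (z / 2) powr real (2 * n)" using that by (intro powr_realpow[symmetric]) simp
    finally show ?thesis by (simp add: powr_add[symmetric])
  qed
  then show ?thesis
    unfolding bessel_J_frobenius frobenius_def e by (simp add: mult_ac)
qed

lemma bessel_J'_neg_int:
  assumes "z > 0"
  shows "bessel_J' (- real n) z = (- 1) ^ n * bessel_J' (real n) z"
proof -
  have 1: "(bessel_J (- real n) has_real_derivative bessel_J' (- real n) z / z) (at z)"
    using bessel_sol_J[of "- real n"] assms unfolding bessel_sol_def by blast
  have "(bessel_J (real n) has_real_derivative bessel_J' (real n) z / z) (at z)"
    using bessel_sol_J[of "real n"] assms unfolding bessel_sol_def by blast
  then have "((\<lambda>z. (- 1) ^ n * bessel_J (real n) z) has_real_derivative (- 1) ^ n * (bessel_J' (real n) z / z)) (at z)"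
    by (rule DERIV_cmult)
  then have "(bessel_J (- real n) has_real_derivative (- 1) ^ n * (bessel_J' (real n) z / z)) (at z)"
    by (rule has_field_derivative_transform_within_open[where S = "{0<..}"])
       (use assms bessel_J_neg_int in auto)
  from DERIV_unique[OF 1 this] show ?thesis
    using assms by simp
qed

text \<open>Bessel's equation differentiated with respect to the order. The order derivative of
  \<open>bessel_J\<close> is this series plus \<open>ln (z / 2) * bessel_J\<close>; moving the
  logarithmic part to the other side leaves the source
  \<open>- 2 * bessel_J' + 2 * \<mu> * bessel_J\<close>.\<close>

lemma bessel_order_part:
  assumes "z > 0"
  shows "(frobenius (bessel_coeff' \<mu>) \<mu> has_real_derivative
      frobenius (\<lambda>m. (2 * real m + \<mu>) * bessel_coeff' \<mu> m) \<mu> z / z) (at z)"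
    and "(frobenius (\<lambda>m. (2 * real m + \<mu>) * bessel_coeff' \<mu> m) \<mu> has_real_derivative
      ((\<mu>\<^sup>2 - z\<^sup>2) * frobenius (bessel_coeff' \<mu>) \<mu> z - 2 * bessel_J' \<mu> z + 2 * \<mu> * bessel_J \<mu> z) / z) (at z)"
proof -
  let ?c = "bessel_coeff \<mu>" and ?d = "bessel_coeff' \<mu>"
  note c = fact_decay_bessel(1)[of \<mu>] and d = fact_decay_bessel(2)[of \<mu>]
  note d1 = fact_decay_linear[OF d, of 2 \<mu>]
  show "(frobenius ?d \<mu> has_real_derivative frobenius (\<lambda>m. (2 * real m + \<mu>) * ?d m) \<mu> z / z) (at z)"
    by (rule DERIV_frobenius[OF d assms])
  \<comment> \<open>By \<open>bessel_coeff'_Suc\<close> the sequence \<open>?h\<close> is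
    \<open>?d\<close> shifted by one place, with value 0 at \<open>m = 0\<close>;
    \<open>frobenius_shift\<close> then produces the \<open>z^2\<close> term.\<close>
  let ?h = "\<lambda>m. - (real m * (real m + \<mu>) * ?d m + real m * ?c m)"
  have hd: "fact_decay (\<lambda>m. real m * ?c m)" "fact_decay (\<lambda>m. real m * (real m + \<mu>) * ?d m)"
    using fact_decay_linear[OF c, of 1 0] fact_decay_linear[OF fact_decay_linear[OF d, of 1 \<mu>], of 1 0]
    by (simp_all add: mult.assoc)
  have add: "fact_decay (\<lambda>m. a m + b m)" if "fact_decay a" "fact_decay b" for a b
  proof -
    obtain B r where B: "\<And>m. \<bar>a m\<bar> \<le> B * r ^ m / fact m"
      using \<open>fact_decay a\<close> unfolding fact_decay_def by blast
    obtain C t where C: "\<And>m. \<bar>b m\<bar> \<le> C * t ^ m / fact m"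
      using \<open>fact_decay b\<close> unfolding fact_decay_def by blast
    have "\<bar>a m + b m\<bar> \<le> (\<bar>B\<bar> + \<bar>C\<bar>) * (\<bar>r\<bar> + \<bar>t\<bar>) ^ m / fact m" for m
    proof -
      have "B * r ^ m \<le> \<bar>B\<bar> * (\<bar>r\<bar> + \<bar>t\<bar>) ^ m"
      proof -
        have "B * r ^ m \<le> \<bar>B\<bar> * \<bar>r\<bar> ^ m"
          by (metis abs_ge_self abs_mult power_abs)
        also have "\<dots> \<le> \<bar>B\<bar> * (\<bar>r\<bar> + \<bar>t\<bar>) ^ m"
          by (intro mult_left_mono power_mono) auto
        finally show ?thesis .
      qed
      moreover have "C * t ^ m \<le> \<bar>C\<bar> * (\<bar>r\<bar> + \<bar>t\<bar>) ^ m"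
      proof -
        have "C * t ^ m \<le> \<bar>C\<bar> * \<bar>t\<bar> ^ m"
          by (metis abs_ge_self abs_mult power_abs)
        also have "\<dots> \<le> \<bar>C\<bar> * (\<bar>r\<bar> + \<bar>t\<bar>) ^ m"
          by (intro mult_left_mono power_mono) auto
        finally show ?thesis .
      qed
      ultimately have "(B * r ^ m + C * t ^ m) / fact m \<le> (\<bar>B\<bar> + \<bar>C\<bar>) * (\<bar>r\<bar> + \<bar>t\<bar>) ^ m / fact m"
        by (intro divide_right_mono) (auto simp: distrib_right)
      moreover have "\<bar>a m + b m\<bar> \<le> (B * r ^ m + C * t ^ m) / fact m"
        using B[of m] C[of m] abs_triangle_ineq[of "a m" "b m"] by (simp add: add_divide_distrib)
      ultimately show ?thesis by linarith
    qed
    then show ?thesis unfolding fact_decay_def by blast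
  qed
  have mul: "fact_decay (\<lambda>m. a * b m)" if "fact_decay b" for a b
    using fact_decay_linear[OF that, of 0 a] by simp
  have hd3: "fact_decay ?h"
    using mul[OF add[OF hd(2) hd(1)], of "- 1"] by simp
  have "frobenius (\<lambda>m. (2 * real m + \<mu>) * ((2 * real m + \<mu>) * ?d m)) \<mu> z
      = frobenius (\<lambda>m. (\<mu>\<^sup>2 * ?d m + (- 4) * ?h m) + ((- 2) * ((2 * real m + \<mu>) * ?c m) + (2 * \<mu>) * ?c m)) \<mu> z"
    by (intro arg_cong[of _ _ "\<lambda>c. frobenius c \<mu> z"] ext) (simp add: algebra_simps power2_eq_square)
  also have "\<dots> = frobenius (\<lambda>m. \<mu>\<^sup>2 * ?d m + (- 4) * ?h m) \<mu> z
      + frobenius (\<lambda>m. (- 2) * ((2 * real m + \<mu>) * ?c m) + (2 * \<mu>) * ?c m) \<mu> z"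
    by (intro frobenius_add add mul hd3 d c fact_decay_linear)
  also have "frobenius (\<lambda>m. \<mu>\<^sup>2 * ?d m + (- 4) * ?h m) \<mu> z = \<mu>\<^sup>2 * frobenius ?d \<mu> z + (- 4) * frobenius ?h \<mu> z"
    by (subst frobenius_add[OF mul[OF d] mul[OF hd3]]) (simp only: frobenius_cmult[OF d] frobenius_cmult[OF hd3])
  also have "frobenius (\<lambda>m. (- 2) * ((2 * real m + \<mu>) * ?c m) + (2 * \<mu>) * ?c m) \<mu> z
      = (- 2) * bessel_J' \<mu> z + (2 * \<mu>) * bessel_J \<mu> z"
    unfolding bessel_J'_def bessel_J_frobenius
    by (subst frobenius_add[OF mul[OF fact_decay_linear[OF c]] mul[OF c]])
       (simp only: frobenius_cmult[OF c] frobenius_cmult[OF fact_decay_linear[OF c]])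
  also have "frobenius ?h \<mu> z = (z / 2)\<^sup>2 * frobenius ?d \<mu> z"
    by (rule frobenius_shift[OF d hd3]) (simp, use bessel_coeff'_Suc[of _ \<mu>] in simp)
  finally have e: "frobenius (\<lambda>m. (2 * real m + \<mu>) * ((2 * real m + \<mu>) * ?d m)) \<mu> z
      = (\<mu>\<^sup>2 - z\<^sup>2) * frobenius ?d \<mu> z - 2 * bessel_J' \<mu> z + 2 * \<mu> * bessel_J \<mu> z"
    by (simp add: algebra_simps power2_eq_square)
  show "(frobenius (\<lambda>m. (2 * real m + \<mu>) * ?d m) \<mu> has_real_derivative
      ((\<mu>\<^sup>2 - z\<^sup>2) * frobenius ?d \<mu> z - 2 * bessel_J' \<mu> z + 2 * \<mu> * bessel_J \<mu> z) / z) (at z)"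
    using DERIV_frobenius[OF d1 assms, of \<mu>] unfolding e .
qed

text \<open>Numerator and sine both vanish at \<open>n\<close>, so the limit in the order is the
  quotient of their derivatives. The two logarithmic terms are equal by
  \<open>bessel_J_neg_int\<close>, whence the factor 2.\<close>

lemma bessel_Y_int_eq:
  assumes "z > 0"
  shows "pi * bessel_Y (real n) z = frobenius (bessel_coeff' (real n)) (real n) z
      + (- 1) ^ n * frobenius (bessel_coeff' (- real n)) (- real n) z + 2 * (ln (z / 2) * bessel_J (real n) z)"
proof -
  let ?n = "real n"
  let ?N = "\<lambda>\<mu>. bessel_J \<mu> z * cos (\<mu> * pi) - bessel_J (- \<mu>) z"
  let ?D = "bessel_J_order_deriv"
  have cs: "cos (?n * pi) = (- 1) ^ n" "sin (?n * pi) = 0"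
    by (simp_all add: mult.commute)
  have 1: "((\<lambda>\<mu>. bessel_J (- \<mu>) z) has_real_derivative ?D (- ?n) z * (- 1)) (at ?n)"
    by (rule DERIV_chain2[OF DERIV_bessel_J_order[OF assms]]) (auto intro!: derivative_eq_intros)
  have 2: "((\<lambda>\<mu>. cos (\<mu> * pi)) has_real_derivative - sin (?n * pi) * pi) (at ?n)"
    by (auto intro!: derivative_eq_intros)
  have N: "(?N has_real_derivative (- 1) ^ n * ?D ?n z + ?D (- ?n) z) (at ?n)"
    by (rule DERIV_cong[OF DERIV_diff[OF DERIV_mult[OF DERIV_bessel_J_order[OF assms] 2] 1]]) (simp add: cs)
  have N0: "?N ?n = 0"
    using bessel_J_neg_int[OF assms, of n] cs by simp
  have S: "((\<lambda>\<mu>. sin (\<mu> * pi)) has_real_derivative (- 1) ^ n * pi) (at ?n)"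
    by (rule derivative_eq_intros refl | simp add: cs)+
  have N1: "((\<lambda>\<mu>. ?N \<mu> / (\<mu> - ?n)) \<longlongrightarrow> (- 1) ^ n * ?D ?n z + ?D (- ?n) z) (at ?n)"
    using N unfolding has_field_derivative_iff N0 diff_0_right .
  have "((\<lambda>\<mu>. (?N \<mu> / (\<mu> - ?n)) / (sin (\<mu> * pi) / (\<mu> - ?n))) \<longlongrightarrow>
      ((- 1) ^ n * ?D ?n z + ?D (- ?n) z) / ((- 1) ^ n * pi)) (at ?n)"
    using N1 S[unfolded has_field_derivative_iff]
    by (intro tendsto_divide) (simp_all add: cs)
  then have "((\<lambda>\<mu>. ?N \<mu> / sin (\<mu> * pi)) \<longlongrightarrow>
      ((- 1) ^ n * ?D ?n z + ?D (- ?n) z) / ((- 1) ^ n * pi)) (at ?n)"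
    by (rule Lim_transform_eventually) (auto simp: eventually_at_filter)
  then have "Lim (at ?n) (\<lambda>\<mu>. ?N \<mu> / sin (\<mu> * pi)) = ((- 1) ^ n * ?D ?n z + ?D (- ?n) z) / ((- 1) ^ n * pi)"
    by (intro tendsto_Lim) auto
  then have "bessel_Y ?n z = ((- 1) ^ n * ?D ?n z + ?D (- ?n) z) / ((- 1) ^ n * pi)"
    by (simp add: bessel_Y_def Let_def)
  also have "\<dots> = (?D ?n z + (- 1) ^ n * ?D (- ?n) z) / pi"
    by (cases "even n") (simp_all add: field_simps)
  finally have "pi * bessel_Y ?n z = ?D ?n z + (- 1) ^ n * ?D (- ?n) z" by simp
  moreover have "(- 1) ^ n * ((- 1) ^ n * x) = (x::real)" for x
    by (cases "even n") simp_all
  ultimately show ?thesis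
    unfolding bessel_J_order_deriv_def bessel_J_neg_int[OF assms]
    by (simp add: algebra_simps)
qed

lemma powr_mult_tendsto_0:
  fixes f :: "real \<Rightarrow> real"
  assumes "\<nu> > 0" "((\<lambda>z. (z / 2) powr (- \<nu>) * f z) \<longlongrightarrow> L) (at_right 0)"
  shows "((\<lambda>z. (z / 2) powr \<nu> * f z) \<longlongrightarrow> 0) (at_right 0)"
proof (rule Lim_transform_eventually)
  have "((\<lambda>z::real. (z / 2) powr (2 * \<nu>)) \<longlongrightarrow> 0) (at_right 0)"
    using assms by real_asymp
  then show "((\<lambda>z. (z / 2) powr (2 * \<nu>) * ((z / 2) powr (- \<nu>) * f z)) \<longlongrightarrow> 0) (at_right 0)"
    using tendsto_mult[OF _ assms(2)] by force
  show "\<forall>\<^sub>F z in at_right 0. (z / 2) powr (2 * \<nu>) * ((z / 2) powr (- \<nu>) * f z) = (z / 2) powr \<nu> * f z"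
    using eventually_at_right_less[of "0::real"]
    by eventually_elim (simp add: powr_add[symmetric] mult.assoc[symmetric])
qed

text \<open>\<open>F\<close> is \<open>pi * bessel_Y\<close> on the positive axis. Its parts of
  orders \<open>n\<close> and \<open>- n\<close> have sources \<open>- 2 * J' + 2 * n * J\<close>
  and, after the sign \<open>(- 1) ^ n\<close>, \<open>- 2 * J' - 2 * n * J\<close>; differentiating
  the logarithm in the last part contributes \<open>4 * J'\<close>. The sources cancel, so
  \<open>F\<close> solves the homogeneous equation.\<close>

lemma bessel_Y_integer:
  assumes "n > 0"
  shows "\<exists>Y'. bessel_second_kind (real n) (bessel_Y (real n)) Y'"
proof -
  let ?n = "real n" and ?J = "bessel_J (real n)" and ?J' = "bessel_J' (real n)"
  let ?c = "bessel_coeff' (real n)" and ?d = "bessel_coeff' (- real n)"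
  define P where "P = frobenius ?c ?n"
  define P' where "P' = frobenius (\<lambda>m. (2 * real m + ?n) * ?c m) ?n"
  define Q where "Q = frobenius ?d (- ?n)"
  define Q' where "Q' = frobenius (\<lambda>m. (2 * real m + - ?n) * ?d m) (- ?n)"
  define F where "F z = P z + (- 1) ^ n * Q z + 2 * (ln (z / 2) * ?J z)" for z
  define F' where "F' z = P' z + (- 1) ^ n * Q' z + 2 * (?J z + ln (z / 2) * ?J' z)" for z
  have Y: "bessel_Y ?n z = F z / pi" if "z > 0" for z
    using bessel_Y_int_eq[OF that, of n] by (simp add: F_def P_def Q_def field_simps)
  have sq: "(- 1) ^ n * ((- 1) ^ n * x) = (x::real)" for x
    by (cases "even n") simp_all
  have F: "bessel_sol ?n F F'"
    unfolding bessel_sol_def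
  proof (intro allI impI conjI)
    fix z :: real assume z: "z > 0"
    have J: "(?J has_real_derivative ?J' z / z) (at z)" "(?J' has_real_derivative (?n\<^sup>2 - z\<^sup>2) * ?J z / z) (at z)"
      using bessel_sol_J[of ?n] z unfolding bessel_sol_def by auto
    have l: "((\<lambda>z. ln (z / 2)) has_real_derivative 1 / z) (at z)"
      using z by (auto intro!: derivative_eq_intros)
    note p = bessel_order_part[OF z, of ?n, folded P_def P'_def]
    note q = bessel_order_part[OF z, of "- ?n", folded Q_def Q'_def]
    show "(F has_real_derivative F' z / z) (at z)"
      unfolding F_def
      by (rule DERIV_cong[OF DERIV_add[OF DERIV_add[OF p(1) DERIV_cmult[OF q(1)]] DERIV_cmult[OF DERIV_mult[OF l J(1)]]]])
         (use z in \<open>simp add: F'_def field_simps\<close>)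
    have "(- 1) ^ n * (((- ?n)\<^sup>2 - z\<^sup>2) * Q z - 2 * bessel_J' (- ?n) z + 2 * - ?n * bessel_J (- ?n) z)
       = (?n\<^sup>2 - z\<^sup>2) * ((- 1) ^ n * Q z) - 2 * ?J' z - 2 * ?n * ?J z"
      unfolding bessel_J'_neg_int[OF z] bessel_J_neg_int[OF z] by (simp add: algebra_simps sq)
    then have q2: "((\<lambda>z. (- 1) ^ n * Q' z) has_real_derivative
        ((?n\<^sup>2 - z\<^sup>2) * ((- 1) ^ n * Q z) - 2 * ?J' z - 2 * ?n * ?J z) / z) (at z)"
      using DERIV_cmult[OF q(2), of "(- 1) ^ n"] by (simp only: times_divide_eq_right)
    show "(F' has_real_derivative (?n\<^sup>2 - z\<^sup>2) * F z / z) (at z)"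
      unfolding F'_def
      by (rule DERIV_cong[OF DERIV_add[OF DERIV_add[OF p(2) q2] DERIV_cmult[OF DERIV_add[OF J(1) DERIV_mult[OF l J(2)]]]]])
         (use z in \<open>simp add: F_def field_simps\<close>)
  qed
  \<comment> \<open>The singular part at 0 comes from the derivative of \<open>rGamma\<close> at its
    zero \<open>1 - n\<close>, which is \<open>(- 1) ^ (n - 1)\<close> times the factorial of
    \<open>n - 1\<close>.\<close>
  have d0: "(- 1) ^ n * ?d 0 = - Gamma ?n"
  proof -
    obtain k where k: "n = Suc k" using assms gr0_implies_Suc by blast
    have "rGamma_deriv (- real k) = (- 1) ^ k * fact k"
      using DERIV_unique[OF DERIV_rGamma has_field_derivative_rGamma_nonpos_int[of k]] by simp
    moreover have "Gamma ?n = fact k"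
      using Gamma_fact[of k, where 'a = real] k by (simp add: add.commute)
    moreover have "- ?n + 1 = - real k" using k by simp
    ultimately show ?thesis
      by (simp add: bessel_coeff'_def k)
  qed
  have n: "?n > 0" using assms by simp
  have P0: "((\<lambda>z. (z / 2) powr ?n * P z) \<longlongrightarrow> 0) (at_right 0)" "((\<lambda>z. (z / 2) powr ?n * P' z) \<longlongrightarrow> 0) (at_right 0)"
    unfolding P_def P'_def
    by (rule powr_mult_tendsto_0[OF n frobenius_tendsto]; intro fact_decay_linear fact_decay_bessel)+
  have Q0: "((\<lambda>z. (z / 2) powr (- (- ?n)) * Q z) \<longlongrightarrow> ?d 0) (at_right 0)"
    "((\<lambda>z. (z / 2) powr (- (- ?n)) * Q' z) \<longlongrightarrow> (2 * real 0 + - ?n) * ?d 0) (at_right 0)"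
    unfolding Q_def Q'_def
    by (rule frobenius_tendsto; intro fact_decay_linear fact_decay_bessel)+
  have "((\<lambda>z. (z / 2) powr ?n * P z + (- 1) ^ n * ((z / 2) powr (- (- ?n)) * Q z) + 2 * ((z / 2) powr ?n * (ln (z / 2) * ?J z)))
     \<longlongrightarrow> 0 + (- 1) ^ n * ?d 0 + 2 * 0) (at_right 0)"
    by (intro tendsto_intros P0 Q0 powr_mult_J_tendsto_0 n)
  then have F0: "((\<lambda>z. (z / 2) powr ?n * F z) \<longlongrightarrow> - Gamma ?n) (at_right 0)"
    unfolding d0 F_def by (simp add: algebra_simps)
  have "((\<lambda>z. (z / 2) powr ?n * P' z + (- 1) ^ n * ((z / 2) powr (- (- ?n)) * Q' z)
      + 2 * ((z / 2) powr ?n * ?J z + (z / 2) powr ?n * (ln (z / 2) * ?J' z)))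
     \<longlongrightarrow> 0 + (- 1) ^ n * ((2 * real 0 + - ?n) * ?d 0) + 2 * (0 + 0)) (at_right 0)"
    by (intro tendsto_intros P0 Q0 powr_mult_J_tendsto_0 n)
  moreover have "0 + (- 1) ^ n * ((2 * real 0 + - ?n) * ?d 0) + 2 * (0 + 0) = ?n * Gamma ?n"
    using arg_cong[OF d0, of "\<lambda>t. - ?n * t"] by (simp add: mult.left_commute)
  ultimately have F'0: "((\<lambda>z. (z / 2) powr ?n * F' z) \<longlongrightarrow> ?n * Gamma ?n) (at_right 0)"
    unfolding F'_def by (simp add: algebra_simps)
  have "bessel_sol ?n (bessel_Y ?n) (\<lambda>z. F' z / pi)"
    unfolding bessel_sol_def
  proof (intro allI impI conjI)
    fix z :: real assume z: "z > 0"
    have d: "(F has_real_derivative F' z / z) (at z)" "(F' has_real_derivative (?n\<^sup>2 - z\<^sup>2) * F z / z) (at z)"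
      using F z unfolding bessel_sol_def by auto
    have "((\<lambda>z. F z / pi) has_real_derivative F' z / pi / z) (at z)"
      using DERIV_cdivide[OF d(1), of pi] by (simp add: mult.commute)
    then show "(bessel_Y ?n has_real_derivative F' z / pi / z) (at z)"
      by (rule has_field_derivative_transform_within_open[where S = "{0<..}"]) (use z Y in auto)
    show "((\<lambda>z. F' z / pi) has_real_derivative (?n\<^sup>2 - z\<^sup>2) * bessel_Y ?n z / z) (at z)"
      using DERIV_cdivide[OF d(2), of pi] Y[OF z] by (simp add: mult.commute)
  qed
  moreover have "((\<lambda>z. (z / 2) powr ?n * bessel_Y ?n z) \<longlongrightarrow> - Gamma ?n / pi) (at_right 0)"
  proof (rule Lim_transform_eventually[OF tendsto_divide[OF F0 tendsto_const[of pi]]])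
    show "\<forall>\<^sub>F z in at_right 0. (z / 2) powr ?n * F z / pi = (z / 2) powr ?n * bessel_Y ?n z"
      using eventually_at_right_less[of "0::real"] by eventually_elim (simp add: Y)
  qed simp
  moreover have "((\<lambda>z. (z / 2) powr ?n * (F' z / pi)) \<longlongrightarrow> ?n * Gamma ?n / pi) (at_right 0)"
    using tendsto_divide[OF F'0 tendsto_const[of pi]] by simp
  ultimately show ?thesis
    unfolding bessel_second_kind_def by blast
qed

lemma bessel_Y_second_kind:
  assumes "\<nu> > 0"
  shows "\<exists>Y'. bessel_second_kind \<nu> (bessel_Y \<nu>) Y'"
proof (cases "\<nu> \<in> \<int>")
  case True
  then obtain i where i: "\<nu> = of_int i" by (auto elim: Ints_cases)
  then have "\<nu> = real (nat i)" "nat i > 0" using assms by auto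
  then show ?thesis using bessel_Y_integer by metis
qed (use bessel_Y_noninteger assms in auto)

text \<open>An Euler derivative of \<open>bessel_Y\<close>; the choice gives one name to the integer
  and the noninteger case.\<close>

definition bessel_Y' :: "real \<Rightarrow> real \<Rightarrow> real" where
  "bessel_Y' \<nu> = (SOME Y'. bessel_second_kind \<nu> (bessel_Y \<nu>) Y')"

lemma bessel_Y_props:
  assumes "\<nu> > 0"
  shows "bessel_sol \<nu> (bessel_Y \<nu>) (bessel_Y' \<nu>)"
    "((\<lambda>z. (z / 2) powr \<nu> * bessel_Y \<nu> z) \<longlongrightarrow> - Gamma \<nu> / pi) (at_right 0)"
    "((\<lambda>z. (z / 2) powr \<nu> * bessel_Y' \<nu> z) \<longlongrightarrow> \<nu> * Gamma \<nu> / pi) (at_right 0)"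
proof -
  have "bessel_second_kind \<nu> (bessel_Y \<nu>) (bessel_Y' \<nu>)"
    unfolding bessel_Y'_def by (rule someI_ex[OF bessel_Y_second_kind[OF assms]])
  then show "bessel_sol \<nu> (bessel_Y \<nu>) (bessel_Y' \<nu>)"
    "((\<lambda>z. (z / 2) powr \<nu> * bessel_Y \<nu> z) \<longlongrightarrow> - Gamma \<nu> / pi) (at_right 0)"
    "((\<lambda>z. (z / 2) powr \<nu> * bessel_Y' \<nu> z) \<longlongrightarrow> \<nu> * Gamma \<nu> / pi) (at_right 0)"
    unfolding bessel_second_kind_def by blast+
qed

text \<open>Formed with Euler derivatives, the Wronskian is constant, so it equals its limit at 0.
  There the powers of \<open>z\<close> cancel, and each of the two products contributes
  \<open>1 / pi\<close>.\<close>

lemma bessel_wronskian: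
  assumes "\<nu> > 0" "z > 0"
  shows "bessel_J \<nu> z * bessel_Y' \<nu> z - bessel_J' \<nu> z * bessel_Y \<nu> z = 2 / pi"
proof -
  let ?W = "\<lambda>z. bessel_J \<nu> z * bessel_Y' \<nu> z - bessel_J' \<nu> z * bessel_Y \<nu> z"
  have W: "(?W has_real_derivative 0) (at z)" if "z > 0" for z
  proof -
    have d: "(bessel_J \<nu> has_real_derivative bessel_J' \<nu> z / z) (at z)"
      "(bessel_J' \<nu> has_real_derivative (\<nu>\<^sup>2 - z\<^sup>2) * bessel_J \<nu> z / z) (at z)"
      "(bessel_Y \<nu> has_real_derivative bessel_Y' \<nu> z / z) (at z)"
      "(bessel_Y' \<nu> has_real_derivative (\<nu>\<^sup>2 - z\<^sup>2) * bessel_Y \<nu> z / z) (at z)"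
      using bessel_sol_J[of \<nu>] bessel_Y_props(1)[OF assms(1)] that unfolding bessel_sol_def by auto
    show ?thesis
      by (rule DERIV_cong[OF DERIV_diff[OF DERIV_mult[OF d(1,4)] DERIV_mult[OF d(2,3)]]])
         (use that in \<open>simp add: field_simps\<close>)
  qed
  have "\<exists>k. \<forall>y\<in>{0<..}. ?W y = k"
    by (rule has_field_derivative_zero_constant) (auto intro: has_field_derivative_at_within W)
  then obtain k where k: "\<And>y. y > 0 \<Longrightarrow> ?W y = k" by auto
  have c: "?W y = ?W z" if "y > 0" for y
    unfolding k[OF that] k[OF assms(2)] ..
  have g: "rGamma (\<nu> + 1) * (\<nu> * Gamma \<nu>) = 1"
  proof -
    have "\<nu> * Gamma \<nu> = Gamma (\<nu> + 1)"
      using Gamma_plus1[of \<nu>] assms nonpos_Ints_nonpos[of \<nu>] by linarith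
    moreover have "Gamma (\<nu> + 1) > 0" using assms by (intro Gamma_real_pos) simp
    ultimately show ?thesis by (simp add: rGamma_inverse_Gamma)
  qed
  have "((\<lambda>z. ((z / 2) powr (- \<nu>) * bessel_J \<nu> z) * ((z / 2) powr \<nu> * bessel_Y' \<nu> z)
     - ((z / 2) powr (- \<nu>) * bessel_J' \<nu> z) * ((z / 2) powr \<nu> * bessel_Y \<nu> z)) \<longlongrightarrow>
     rGamma (\<nu> + 1) * (\<nu> * Gamma \<nu> / pi) - (\<nu> * rGamma (\<nu> + 1)) * (- Gamma \<nu> / pi)) (at_right 0)"
    by (intro tendsto_intros bessel_J_tendsto bessel_Y_props assms)
  moreover have "rGamma (\<nu> + 1) * (\<nu> * Gamma \<nu> / pi) - (\<nu> * rGamma (\<nu> + 1)) * (- Gamma \<nu> / pi) = 2 / pi"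
    using g by (simp add: field_simps)
  moreover have "\<forall>\<^sub>F y in at_right 0. ((y / 2) powr (- \<nu>) * bessel_J \<nu> y) * ((y / 2) powr \<nu> * bessel_Y' \<nu> y)
     - ((y / 2) powr (- \<nu>) * bessel_J' \<nu> y) * ((y / 2) powr \<nu> * bessel_Y \<nu> y) = ?W z"
    using eventually_at_right_less[of "0::real"]
  proof eventually_elim
    case (elim y)
    have "(y / 2) powr (- \<nu>) * (y / 2) powr \<nu> = 1"
      using elim by (simp add: powr_minus)
    then have e: "((y / 2) powr (- \<nu>) * a) * ((y / 2) powr \<nu> * b) = a * b" for a b
      by (metis (no_types, opaque_lifting) mult.assoc mult.left_commute mult_1)
    show ?case unfolding e using c[OF elim] .
  qed
  ultimately have "((\<lambda>y. ?W z) \<longlongrightarrow> 2 / pi) (at_right (0::real))"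
    using Lim_transform_eventually by fastforce
  then show ?thesis
    by (simp add: tendsto_const_iff)
qed

section \<open>Oscillation\<close>

text \<open>The Riccati variable \<open>- y' / y\<close> satisfies \<open>w' \<ge> (w\<^sup>2 + c\<^sup>2) / 2\<close>, so that \<open>arctan (w / c)\<close>
  grows at least at the rate \<open>c / 2\<close> while it stays within \<open>(-\<pi>/2, \<pi>/2)\<close>.\<close>

lemma positive_solution_interval_bound:
  fixes y y' P Q :: "real \<Rightarrow> real"
  assumes "a < b" "c > 0"
    and y: "\<And>t. t \<in> {a..b} \<Longrightarrow> (y has_real_derivative y' t) (at t)"
    and y': "\<And>t. t \<in> {a..b} \<Longrightarrow> (y' has_real_derivative - P t * y' t - Q t * y t) (at t)"
    and pos: "\<And>t. t \<in> {a..b} \<Longrightarrow> y t > 0"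
    and P: "\<And>t. t \<in> {a..b} \<Longrightarrow> \<bar>P t\<bar> \<le> K"
    and Q: "\<And>t. t \<in> {a..b} \<Longrightarrow> (c\<^sup>2 + K\<^sup>2) / 2 \<le> Q t"
  shows "c * (b - a) < 2 * pi"
proof -
  define w where "w t = - y' t / y t" for t
  define D where "D t = (P t * y' t + Q t * y t) / y t + (w t)\<^sup>2" for t
  have w: "(w has_real_derivative D t) (at t)" if "t \<in> {a..b}" for t
    unfolding w_def
    by (rule DERIV_cong[OF DERIV_divide[OF DERIV_minus[OF y'[OF that]] y[OF that]]])
       (use pos[OF that] in \<open>auto simp: D_def w_def field_simps power2_eq_square\<close>)
  \<comment> \<open>The damping term \<open>P * w\<close> costs at most
    \<open>(K^2 + w^2) / 2\<close>. The threshold assumed for \<open>Q\<close> pays for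
    \<open>K^2 / 2\<close> and leaves \<open>c^2 / 2\<close>.\<close>
  have D: "((w t)\<^sup>2 + c\<^sup>2) / 2 \<le> D t" if "t \<in> {a..b}" for t
  proof -
    have "D t = Q t - P t * w t + (w t)\<^sup>2"
      using pos[OF that] by (simp add: D_def w_def field_simps)
    moreover have "P t * w t \<le> (K\<^sup>2 + (w t)\<^sup>2) / 2"
    proof -
      have "2 * (P t * w t) \<le> (P t)\<^sup>2 + (w t)\<^sup>2"
        using sum_squares_bound[of "P t" "w t"] by simp
      moreover have "(P t)\<^sup>2 \<le> K\<^sup>2"
        using power_mono[OF P[OF that], of 2] by simp
      ultimately show ?thesis by simp
    qed
    ultimately show ?thesis using Q[OF that] by (simp add: field_simps)
  qed
  define h where "h t = arctan (w t / c) - c / 2 * t" for t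
  have "h a \<le> h b"
  proof (rule DERIV_nonneg_imp_nondecreasing[where f = h])
    show "a \<le> b" using assms(1) by simp
    fix t assume "a \<le> t" "t \<le> b"
    then have t: "t \<in> {a..b}" by simp
    have "(h has_real_derivative inverse (1 + (w t / c)\<^sup>2) * (D t / c) - c / 2) (at t)"
      unfolding h_def using t
      by (intro DERIV_diff DERIV_chain2[OF DERIV_arctan] DERIV_cdivide w DERIV_cmult_Id)
    moreover have "0 \<le> inverse (1 + (w t / c)\<^sup>2) * (D t / c) - c / 2"
    proof -
      have p: "1 + (w t / c)\<^sup>2 > 0" by (simp add: add_pos_nonneg)
      have "c / 2 * (1 + (w t / c)\<^sup>2) = ((w t)\<^sup>2 + c\<^sup>2) / 2 / c"
        using assms(2) by (simp add: field_simps power2_eq_square)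
      also have "\<dots> \<le> D t / c"
        using D[OF t] assms(2) by (intro divide_right_mono) auto
      finally have "c / 2 \<le> (D t / c) / (1 + (w t / c)\<^sup>2)"
        using p by (simp only: pos_le_divide_eq)
      also have "\<dots> = inverse (1 + (w t / c)\<^sup>2) * (D t / c)"
        by (simp only: divide_inverse mult.commute)
      finally show ?thesis by simp
    qed
    ultimately show "\<exists>D. (h has_real_derivative D) (at t) \<and> 0 \<le> D" by blast
  qed
  then have "c / 2 * (b - a) \<le> arctan (w b / c) - arctan (w a / c)"
    by (simp add: h_def right_diff_distrib)
  also have "\<dots> < pi"
    using arctan_ubound[of "w b / c"] arctan_lbound[of "w a / c"] by simp
  finally show ?thesis by simp
qed

section \<open>Zeros of Bessel functions and of cross products\<close>

locale bessel_order =
  fixes \<nu> :: real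
  assumes \<nu>_pos: "\<nu> > 0"
begin

abbreviation "J \<equiv> bessel_J \<nu>"
abbreviation "J' \<equiv> bessel_J' \<nu>"
abbreviation "Y \<equiv> bessel_Y \<nu>"
abbreviation "Y' \<equiv> bessel_Y' \<nu>"

text \<open>The function \<open>h\<close> of the overview.\<close>

definition quot :: "real \<Rightarrow> real" where "quot z = J z / Y z"

lemma derivs:
  assumes "z > 0"
  shows "(J has_real_derivative J' z / z) (at z)"
    "(J' has_real_derivative (\<nu>\<^sup>2 - z\<^sup>2) * J z / z) (at z)"
    "(Y has_real_derivative Y' z / z) (at z)"
    "(Y' has_real_derivative (\<nu>\<^sup>2 - z\<^sup>2) * Y z / z) (at z)"
  using bessel_sol_J[of \<nu>] bessel_Y_props(1)[OF \<nu>_pos] assms unfolding bessel_sol_def by auto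

lemma continuous:
  assumes "S \<subseteq> {0<..}"
  shows "continuous_on S J" "continuous_on S J'" "continuous_on S Y" "continuous_on S Y'"
proof -
  have *: "continuous_on S f" if "\<And>z. z > 0 \<Longrightarrow> (f has_real_derivative f' z) (at z)" for f f' :: "real \<Rightarrow> real"
    using that assms by (intro continuous_at_imp_continuous_on) (blast intro: DERIV_isCont)
  show "continuous_on S J" "continuous_on S J'" "continuous_on S Y" "continuous_on S Y'"
    using *[OF derivs(1)] *[OF derivs(2)] *[OF derivs(3)] *[OF derivs(4)] by blast+
qed

lemma wronskian: "z > 0 \<Longrightarrow> J z * Y' z - J' z * Y z = 2 / pi"
  by (rule bessel_wronskian[OF \<nu>_pos])

lemma signs_near_0:
  obtains z0 where "z0 > 0" "\<And>z. 0 < z \<Longrightarrow> z \<le> z0 \<Longrightarrow> J z > 0 \<and> Y z < 0"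
proof -
  have g: "rGamma (\<nu> + 1) > 0" "- Gamma \<nu> / pi < 0"
    using \<nu>_pos by (auto intro: rGamma_real_pos Gamma_real_pos)
  have "\<forall>\<^sub>F z in at_right 0. (z / 2) powr (- \<nu>) * J z > 0"
    using order_tendstoD(1)[OF bessel_J_tendsto(1) g(1)] .
  moreover have "\<forall>\<^sub>F z in at_right 0. (z / 2) powr \<nu> * Y z < 0"
    using order_tendstoD(2)[OF bessel_Y_props(2)[OF \<nu>_pos] g(2)] .
  ultimately have "\<forall>\<^sub>F z in at_right 0. J z > 0 \<and> Y z < 0"
    using eventually_at_right_less[of "0::real"]
    by eventually_elim (auto simp: zero_less_mult_iff mult_less_0_iff dest: less_asym)
  then obtain b where "b > 0" "\<And>z. z > 0 \<Longrightarrow> z < b \<Longrightarrow> J z > 0 \<and> Y z < 0"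
    unfolding eventually_at_right_field by auto
  then show ?thesis by (intro that[of "b / 2"]) auto
qed

lemma J_has_zero: "\<exists>z>0. J z = 0"
proof (rule ccontr)
  assume no: "\<not> (\<exists>z>0. J z = 0)"
  obtain z0 where z0: "z0 > 0" "J z0 > 0" using signs_near_0 by (metis order_refl)
  have pos: "J z > 0" if "z > 0" for z
  proof (rule ccontr)
    assume "\<not> J z > 0"
    then have "J z \<le> 0" by simp
    have "connected (J ` {0<..})"
      by (intro connected_continuous_image continuous) auto
    then have "0 \<in> J ` {0<..}"
      using connectedD_interval[of "J ` {0<..}" "J z" "J z0" 0] that z0 \<open>J z \<le> 0\<close> by auto
    then show False using no by auto
  qed
  \<comment> \<open>Beyond \<open>Z\<close> one has \<open>1 / t \<le> 1 / 2\<close> and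
    \<open>\<nu>^2 / t^2 \<le> 1 / 4\<close>, so the estimate applies with \<open>c = 1\<close> and
    \<open>K = 1 / 2\<close>, because \<open>5 / 8 \<le> 3 / 4\<close>. An interval of length
    exactly \<open>2 * pi\<close> contradicts its strict bound.\<close>
  define Z where "Z = 2 * (\<nu> + 1)"
  have Z: "Z \<ge> 2" "\<nu> \<le> Z / 2" using \<nu>_pos unfolding Z_def by auto
  have "1 * ((Z + 2 * pi) - Z) < 2 * pi"
  proof (rule positive_solution_interval_bound[where y = J and y' = "\<lambda>z. J' z / z"
        and P = "\<lambda>z. 1 / z" and Q = "\<lambda>z. 1 - \<nu>\<^sup>2 / z\<^sup>2" and K = "1 / 2"])
    fix t assume t: "t \<in> {Z..Z + 2 * pi}"
    then have t0: "t > 0" "t \<ge> 2" using Z by auto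
    show "(J has_real_derivative J' t / t) (at t)" using derivs t0 by blast
    show "((\<lambda>z. J' z / z) has_real_derivative - (1 / t) * (J' t / t) - (1 - \<nu>\<^sup>2 / t\<^sup>2) * J t) (at t)"
      by (rule DERIV_cong[OF DERIV_divide[OF derivs(2)[OF t0(1)] DERIV_ident]])
         (use t0 in \<open>simp_all add: field_simps power2_eq_square\<close>)
    show "J t > 0" using pos t0 by blast
    show "\<bar>1 / t\<bar> \<le> 1 / 2" using t0 by (simp add: field_simps)
    have "\<nu> / t \<le> 1 / 2" using Z t t0 by (simp add: field_simps)
    then have "(\<nu> / t)\<^sup>2 \<le> (1 / 2)\<^sup>2"
      using \<nu>_pos t0 by (intro power_mono) auto
    then have "\<nu>\<^sup>2 / t\<^sup>2 \<le> 1 / 4"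
      by (simp add: power_divide power2_eq_square)
    moreover have "(1\<^sup>2 + (1 / 2)\<^sup>2) / 2 = (5 / 8 :: real)"
      by (simp add: power2_eq_square)
    ultimately show "(1\<^sup>2 + (1 / 2)\<^sup>2) / 2 \<le> 1 - \<nu>\<^sup>2 / t\<^sup>2"
      by linarith
  qed auto
  then show False by simp
qed

lemma first_zero:
  obtains j where "j > 0" "J j = 0" "\<And>z. 0 < z \<Longrightarrow> z < j \<Longrightarrow> J z > 0"
proof -
  obtain z0 where z0: "z0 > 0" "\<And>z. 0 < z \<Longrightarrow> z \<le> z0 \<Longrightarrow> J z > 0" using signs_near_0 by metis
  obtain b where b: "b > 0" "J b = 0" using J_has_zero by blast
  have zb: "z0 \<le> b" using z0 b by force
  define S where "S = {z \<in> {z0..b}. J z = 0}"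
  have "closed S"
    unfolding S_def using z0
    by (intro continuous_closed_preimage_constant continuous) auto
  moreover have "bounded S"
    by (rule bounded_subset[of "{z0..b}"]) (auto simp: S_def)
  ultimately have "compact S" by (simp add: compact_eq_bounded_closed)
  moreover have "b \<in> S" using zb b by (simp add: S_def)
  ultimately obtain j where j: "j \<in> S" "\<And>z. z \<in> S \<Longrightarrow> j \<le> z"
    using compact_attains_inf[of S] by blast
  have j0: "z0 \<le> j" "j \<le> b" "J j = 0" using j(1) by (auto simp: S_def)
  show ?thesis
  proof (rule that[of j])
    show "j > 0" "J j = 0" using j0 z0 by auto
    fix z assume z: "0 < z" "z < j"
    show "J z > 0"
    proof (rule ccontr)
      assume n: "\<not> J z > 0"
      then have "z0 < z" using z0 z by (meson not_le_imp_less)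
      have "\<exists>x. z0 \<le> x \<and> x \<le> z \<and> J x = 0"
        using n z0(1) z0(2)[of z0] \<open>z0 < z\<close> by (intro IVT2' continuous) auto
      then obtain x where "z0 \<le> x" "x \<le> z" "J x = 0" by blast
      then have "x \<in> S" using z j0 by (simp add: S_def)
      then show False using j(2)[of x] \<open>x \<le> z\<close> z by simp
    qed
  qed
qed

text \<open>The Wronskian collapses the quotient rule; in particular \<open>quot\<close> decreases
  strictly on intervals where \<open>Y\<close> has no zero.\<close>

lemma DERIV_quot:
  assumes "z > 0" "Y z \<noteq> 0"
  shows "(quot has_real_derivative - 2 / (pi * (Y z)\<^sup>2) / z) (at z)"
proof -
  have e: "(J' z / z * Y z - J z * (Y' z / z)) / (Y z * Y z) = - 2 / (pi * (Y z)\<^sup>2) / z"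
  proof -
    have "J' z / z * Y z - J z * (Y' z / z) = - (J z * Y' z - J' z * Y z) / z"
      by (simp add: diff_divide_distrib algebra_simps)
    then show ?thesis
      unfolding wronskian[OF assms(1)] by (simp add: power2_eq_square)
  qed
  show ?thesis
    unfolding quot_def[abs_def]
    by (rule DERIV_cong[OF DERIV_divide[OF derivs(1)[OF assms(1)] derivs(3)[OF assms(1)] assms(2)] e])
qed

definition quot_lim :: real where "quot_lim = rGamma (\<nu> + 1) / (- Gamma \<nu> / pi)"

lemma quot_lim_neg: "quot_lim < 0"
  unfolding quot_lim_def
  by (rule divide_pos_neg) (use \<nu>_pos in \<open>auto intro: rGamma_real_pos Gamma_real_pos\<close>)

text \<open>The expression in the third limit is \<open>- z\<close> times the derivative of
  \<open>quot\<close>; it controls how the perturbation term varies with the eigenvalue.\<close>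

lemma quot_tendsto:
  "((\<lambda>z. quot z / (z / 2) powr (2 * \<nu>)) \<longlongrightarrow> quot_lim) (at_right 0)"
  "(quot \<longlongrightarrow> 0) (at_right 0)"
  "((\<lambda>z. 2 / (pi * (Y z)\<^sup>2)) \<longlongrightarrow> 0) (at_right 0)"
proof -
  have g: "- Gamma \<nu> / pi \<noteq> 0"
    using Gamma_real_pos[OF \<nu>_pos] by simp
  have pp: "(z / 2) powr (2 * \<nu>) = (z / 2) powr \<nu> * (z / 2) powr \<nu>" for z
    by (simp add: powr_add[symmetric])
  show 1: "((\<lambda>z. quot z / (z / 2) powr (2 * \<nu>)) \<longlongrightarrow> quot_lim) (at_right 0)"
    unfolding quot_lim_def
  proof (rule Lim_transform_eventually[OF tendsto_divide[OF bessel_J_tendsto(1) bessel_Y_props(2)[OF \<nu>_pos] g]])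
    show "\<forall>\<^sub>F z in at_right 0. (z / 2) powr - \<nu> * J z / ((z / 2) powr \<nu> * Y z) = quot z / (z / 2) powr (2 * \<nu>)"
      using eventually_at_right_less[of "0::real"]
      by eventually_elim (simp only: quot_def pp powr_minus, simp add: field_simps)
  qed
  have p: "((\<lambda>z::real. (z / 2) powr (2 * \<nu>)) \<longlongrightarrow> 0) (at_right 0)"
    using \<nu>_pos by real_asymp
  show "(quot \<longlongrightarrow> 0) (at_right 0)"
  proof (rule Lim_transform_eventually)
    show "((\<lambda>z. quot z / (z / 2) powr (2 * \<nu>) * (z / 2) powr (2 * \<nu>)) \<longlongrightarrow> 0) (at_right 0)"
      using tendsto_mult[OF 1 p] by simp
    show "\<forall>\<^sub>F z in at_right 0. quot z / (z / 2) powr (2 * \<nu>) * (z / 2) powr (2 * \<nu>) = quot z"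
      using eventually_at_right_less[of "0::real"] by eventually_elim simp
  qed
  have gg: "pi * (- Gamma \<nu> / pi)\<^sup>2 \<noteq> 0"
    using g by simp
  show "((\<lambda>z. 2 / (pi * (Y z)\<^sup>2)) \<longlongrightarrow> 0) (at_right 0)"
  proof (rule Lim_transform_eventually)
    have "((\<lambda>z. 2 * (z / 2) powr (2 * \<nu>) / (pi * ((z / 2) powr \<nu> * Y z)\<^sup>2)) \<longlongrightarrow> 2 * 0 / (pi * (- Gamma \<nu> / pi)\<^sup>2)) (at_right 0)"
      by (intro tendsto_intros p bessel_Y_props \<nu>_pos gg)
    then show "((\<lambda>z. 2 * (z / 2) powr (2 * \<nu>) / (pi * ((z / 2) powr \<nu> * Y z)\<^sup>2)) \<longlongrightarrow> 0) (at_right 0)" by simp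
    show "\<forall>\<^sub>F z in at_right 0. 2 * (z / 2) powr (2 * \<nu>) / (pi * ((z / 2) powr \<nu> * Y z)\<^sup>2) = 2 / (pi * (Y z)\<^sup>2)"
      using eventually_at_right_less[of "0::real"]
      by eventually_elim (simp add: pp power_mult_distrib power2_eq_square)
  qed
qed

lemma filterlim_scaled:
  assumes "(s \<longlongrightarrow> s0) (at_right 0)" "s0 > (0::real)"
  shows "filterlim (\<lambda>\<epsilon>. \<epsilon> * s \<epsilon>) (at_right 0) (at_right 0)"
proof -
  have "((\<lambda>\<epsilon>. \<epsilon> * s \<epsilon>) \<longlongrightarrow> 0 * s0) (at_right 0)"
    by (intro tendsto_intros assms)
  moreover have "\<forall>\<^sub>F \<epsilon> in at_right 0. \<epsilon> * s \<epsilon> > 0"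
    using order_tendstoD(1)[OF assms] eventually_at_right_less[of "0::real"]
    by eventually_elim simp
  ultimately show ?thesis
    unfolding filterlim_at by (auto elim: eventually_mono)
qed

definition cross :: "real \<Rightarrow> real \<Rightarrow> real" where
  "cross \<epsilon> \<mu> = J (sqrt \<mu>) * Y (\<epsilon> * sqrt \<mu>) - Y (sqrt \<mu>) * J (\<epsilon> * sqrt \<mu>)"

lemma cross_eq_0_iff:
  assumes "Y (\<epsilon> * sqrt \<mu>) \<noteq> 0"
  shows "cross \<epsilon> \<mu> = 0 \<longleftrightarrow> J (sqrt \<mu>) - Y (sqrt \<mu>) * quot (\<epsilon> * sqrt \<mu>) = 0"
  using assms by (simp add: cross_def quot_def field_simps)

end

section \<open>Perturbation of a zero and positivity of the radial profile\<close>

context bessel_order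
begin

text \<open>A quantitative implicit function argument. On a fixed interval \<open>I\<close> around
  the simple root both \<open>quot (\<epsilon> * sqrt \<mu>)\<close> and its derivative in
  \<open>\<mu>\<close> are uniformly small. The perturbed function \<open>\<Phi> \<epsilon>\<close>
  is therefore strictly monotone on \<open>I\<close> and changes sign there: it has exactly one
  zero.\<close>

lemma root_perturbation:
  assumes lam0: "lam0 > 0" "J (sqrt lam0) = 0"
  shows "\<exists>\<epsilon>0>0. \<exists>r>0. \<exists>lam A. A > 0 \<and>
     (\<forall>\<epsilon>\<in>{0<..<\<epsilon>0}. \<forall>\<mu>. (0 < \<mu> \<and> \<bar>\<mu> - lam0\<bar> < r \<and> cross \<epsilon> \<mu> = 0) \<longleftrightarrow> \<mu> = lam \<epsilon>) \<and>
     (lam \<longlongrightarrow> lam0) (at_right 0) \<and>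
     ((\<lambda>\<epsilon>. (lam \<epsilon> - lam0) / \<epsilon> powr (2 * \<nu>)) \<longlongrightarrow> A) (at_right 0)"
proof -
  define f where "f \<mu> = J (sqrt \<mu>)" for \<mu>
  define f' where "f' \<mu> = J' (sqrt \<mu>) / (2 * \<mu>)" for \<mu>
  define g where "g \<mu> = Y (sqrt \<mu>)" for \<mu>
  define g' where "g' \<mu> = Y' (sqrt \<mu>) / (2 * \<mu>)" for \<mu>
  define k where "k z = 2 / (pi * (Y z)\<^sup>2)" for z
  have sq: "(sqrt has_real_derivative inverse (sqrt \<mu>) / 2) (at \<mu>)" if "\<mu> > 0" for \<mu>
    using DERIV_real_sqrt[OF that] .
  have comp: "((\<lambda>\<mu>. F (sqrt \<mu>)) has_real_derivative F' (sqrt \<mu>) / (2 * \<mu>)) (at \<mu>)"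
    if "\<mu> > 0" "\<And>z. z > 0 \<Longrightarrow> (F has_real_derivative F' z / z) (at z)" for F F' :: "real \<Rightarrow> real" and \<mu>
    by (rule DERIV_cong[OF DERIV_chain2[OF that(2) sq]])
       (use that(1) in \<open>simp_all add: field_simps\<close>)
  have df: "(f has_real_derivative f' \<mu>) (at \<mu>)" and dg: "(g has_real_derivative g' \<mu>) (at \<mu>)" if "\<mu> > 0" for \<mu>
    unfolding f_def[abs_def] f'_def g_def[abs_def] g'_def using comp[OF that] derivs by blast+
  have W0: "f' lam0 * g lam0 < 0"
  proof -
    have "J' (sqrt lam0) * Y (sqrt lam0) = - 2 / pi"
      using wronskian[of "sqrt lam0"] lam0 by simp
    then have "f' lam0 * g lam0 = (- 2 / pi) / (2 * lam0)"
      unfolding f'_def g_def by simp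
    then show ?thesis using lam0 by (simp add: divide_neg_pos)
  qed
  \<comment> \<open>\<open>\<sigma>\<close> turns the function into an increasing one, so that both
    signs of the slope are handled at once; \<open>m\<close> is half the modulus of the
    slope.\<close>
  define \<sigma> where "\<sigma> = sgn (f' lam0)"
  define m where "m = \<bar>f' lam0\<bar> / 2"
  have m: "m > 0" "\<sigma> * f' lam0 = 2 * m" "\<bar>\<sigma>\<bar> = 1"
    using W0 unfolding m_def \<sigma>_def by (auto simp: sgn_if)
  have f'c: "continuous_on {0<..} f'"
    unfolding f'_def[abs_def]
    by (intro continuous_intros continuous_on_compose2[OF continuous(2)[OF order_refl]]) auto
  have "isCont (\<lambda>\<mu>. \<sigma> * f' \<mu>) lam0"
    using f'c lam0 by (intro continuous_intros) (simp add: continuous_on_eq_continuous_at)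
  then have "\<forall>\<^sub>F \<mu> in at lam0. \<sigma> * f' \<mu> > m"
    using m by (intro order_tendstoD(1)[OF isContD]) auto
  then obtain r0 where r0: "r0 > 0" "\<And>\<mu>. \<mu> \<noteq> lam0 \<Longrightarrow> dist \<mu> lam0 < r0 \<Longrightarrow> \<sigma> * f' \<mu> > m"
    unfolding eventually_at by auto
  \<comment> \<open>\<open>r \<le> lam0 / 2\<close> gives \<open>2 * \<mu> \<ge> lam0\<close> on
    \<open>I\<close>, and \<open>r < r0\<close> keeps the slope bound valid at the end points of the
    closed interval.\<close>
  define r where "r = min (r0 / 2) (lam0 / 2)"
  have r: "r > 0" "r \<le> lam0 / 2" "r < r0" using r0 lam0 unfolding r_def by auto
  define I where "I = {lam0 - r..lam0 + r}"
  have Ipos: "\<mu> > 0" "\<mu> \<ge> lam0 / 2" if "\<mu> \<in> I" for \<mu>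
    using that r lam0 unfolding I_def by auto
  have mI: "\<sigma> * f' \<mu> \<ge> m" if "\<mu> \<in> I" for \<mu>
  proof (cases "\<mu> = lam0")
    case False
    have "\<bar>\<mu> - lam0\<bar> \<le> r" using that by (auto simp: I_def abs_real_def)
    then have "dist \<mu> lam0 < r0" using r by (simp add: dist_real_def)
    then show ?thesis using r0(2)[OF False] by simp
  qed (use m in simp)
  have g'c: "continuous_on I g'"
    unfolding g'_def[abs_def]
    by (intro continuous_intros continuous_on_compose2[OF continuous(4)[OF order_refl]]) (auto dest: Ipos)
  have gc: "continuous_on I g"
    using dg Ipos by (intro continuous_at_imp_continuous_on) (blast intro: DERIV_isCont)
  have "bounded (g ` I)" "bounded (g' ` I)"
    using gc g'c unfolding I_def by (auto intro!: compact_imp_bounded compact_continuous_image)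
  then obtain G0 G1 where G01: "\<forall>y\<in>g ` I. norm y \<le> G0" "\<forall>y\<in>g' ` I. norm y \<le> G1"
    unfolding bounded_iff by blast
  define G where "G = max 1 (max G0 G1)"
  have G: "G > 0" "\<And>\<mu>. \<mu> \<in> I \<Longrightarrow> \<bar>g \<mu>\<bar> \<le> G" "\<And>\<mu>. \<mu> \<in> I \<Longrightarrow> \<bar>g' \<mu>\<bar> \<le> G"
    using G01 unfolding G_def by (auto simp: le_max_iff_disj)
  \<comment> \<open>The first bound keeps the derivative of the perturbation below
    \<open>m / 2\<close>, so monotonicity survives; the second keeps its values below
    \<open>m * r\<close>, so the signs at both ends of \<open>I\<close> survive.\<close>
  define \<eta> where "\<eta> = min (m / (2 * (G + G / lam0))) (m * r / (2 * G))"
  have GG: "G + G / lam0 > 0" using G lam0 by (simp add: add_pos_pos)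
  have \<eta>: "\<eta> > 0" "\<eta> * (G + G / lam0) \<le> m / 2" "\<eta> * G < m * r"
  proof -
    show "\<eta> > 0" unfolding \<eta>_def using m r G GG by simp
    have "\<eta> * (G + G / lam0) \<le> m / (2 * (G + G / lam0)) * (G + G / lam0)"
      unfolding \<eta>_def using GG by (intro mult_right_mono) auto
    moreover have "m / (2 * X) * X = m / 2" if "X > 0" for X :: real
      using that by simp
    ultimately show "\<eta> * (G + G / lam0) \<le> m / 2" using GG by metis
    have "\<eta> * G \<le> m * r / (2 * G) * G"
      unfolding \<eta>_def using G by (intro mult_right_mono) auto
    also have "\<dots> < m * r" using G m r by simp
    finally show "\<eta> * G < m * r" .
  qed
  obtain z0 where z0: "z0 > 0" "\<And>z. 0 < z \<Longrightarrow> z \<le> z0 \<Longrightarrow> J z > 0 \<and> Y z < 0"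
    using signs_near_0 by blast
  have "\<forall>\<^sub>F z in at_right 0. \<bar>quot z\<bar> < \<eta> \<and> \<bar>k z\<bar> < \<eta>"
    using tendstoD[OF quot_tendsto(2) \<eta>(1)] tendstoD[OF quot_tendsto(3) \<eta>(1)]
    unfolding k_def by eventually_elim auto
  then obtain z1 where z1: "z1 > 0" "\<And>z. 0 < z \<Longrightarrow> z < z1 \<Longrightarrow> \<bar>quot z\<bar> < \<eta> \<and> \<bar>k z\<bar> < \<eta>"
    unfolding eventually_at_right_field by auto
  \<comment> \<open>Chosen so that \<open>\<epsilon> * sqrt \<mu>\<close> stays below
    \<open>z0\<close> and \<open>z1\<close> for all \<open>\<mu>\<close> up to
    \<open>lam0 + r\<close>.\<close>
  define \<epsilon>0 where "\<epsilon>0 = min z0 z1 / sqrt (lam0 + r)"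
  have sr: "sqrt (lam0 + r) > 0" using lam0 r by simp
  have \<epsilon>0: "\<epsilon>0 > 0" unfolding \<epsilon>0_def using z0 z1 sr by simp
  have small: "0 < \<epsilon> * sqrt \<mu>" "\<epsilon> * sqrt \<mu> < z0" "\<epsilon> * sqrt \<mu> < z1" if "\<epsilon> \<in> {0<..<\<epsilon>0}" "\<mu> \<in> I" for \<epsilon> \<mu>
  proof -
    show "0 < \<epsilon> * sqrt \<mu>" using that Ipos by simp
    have "\<epsilon> * sqrt \<mu> \<le> \<epsilon> * sqrt (lam0 + r)"
      using that unfolding I_def by (intro mult_left_mono) auto
    also have "\<dots> < \<epsilon>0 * sqrt (lam0 + r)"
      using that sr by (intro mult_strict_right_mono) auto
    also have "\<dots> = min z0 z1" unfolding \<epsilon>0_def using sr by simp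
    finally show "\<epsilon> * sqrt \<mu> < z0" "\<epsilon> * sqrt \<mu> < z1" by auto
  qed
  have sm: "Y (\<epsilon> * sqrt \<mu>) < 0" "\<bar>quot (\<epsilon> * sqrt \<mu>)\<bar> < \<eta>" "\<bar>k (\<epsilon> * sqrt \<mu>)\<bar> < \<eta>"
    if "\<epsilon> \<in> {0<..<\<epsilon>0}" "\<mu> \<in> I" for \<epsilon> \<mu>
    using small[OF that] z0(2)[of "\<epsilon> * sqrt \<mu>"] z1(2)[of "\<epsilon> * sqrt \<mu>"] by auto
  define \<Phi> where "\<Phi> \<epsilon> \<mu> = f \<mu> - g \<mu> * quot (\<epsilon> * sqrt \<mu>)" for \<epsilon> \<mu>
  have cross: "cross \<epsilon> \<mu> = 0 \<longleftrightarrow> \<Phi> \<epsilon> \<mu> = 0" if "\<epsilon> \<in> {0<..<\<epsilon>0}" "\<mu> \<in> I" for \<epsilon> \<mu>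
    using cross_eq_0_iff[of \<epsilon> \<mu>] sm(1)[OF that] unfolding \<Phi>_def f_def g_def by simp
  define \<Phi>' where "\<Phi>' \<epsilon> \<mu> = f' \<mu> - (g' \<mu> * quot (\<epsilon> * sqrt \<mu>) - g \<mu> * (k (\<epsilon> * sqrt \<mu>) / (2 * \<mu>)))" for \<epsilon> \<mu>
  have d\<Phi>: "(\<Phi> \<epsilon> has_real_derivative \<Phi>' \<epsilon> \<mu>) (at \<mu>)" if "\<epsilon> \<in> {0<..<\<epsilon>0}" "\<mu> \<in> I" for \<epsilon> \<mu>
  proof -
    note mu = Ipos(1)[OF that(2)]
    let ?z = "\<epsilon> * sqrt \<mu>"
    have 1: "((\<lambda>\<mu>. quot (\<epsilon> * sqrt \<mu>)) has_real_derivative (- 2 / (pi * (Y ?z)\<^sup>2) / ?z) * (\<epsilon> * (inverse (sqrt \<mu>) / 2))) (at \<mu>)"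
      by (rule DERIV_chain2[OF DERIV_quot DERIV_cmult[OF sq[OF mu]]])
         (use small[OF that] sm[OF that] in auto)
    have e: "(- 2 / (pi * (Y ?z)\<^sup>2) / ?z) * (\<epsilon> * (inverse (sqrt \<mu>) / 2)) = - (k ?z / (2 * \<mu>))"
      unfolding k_def using mu that(1) by (simp add: field_simps)
    show ?thesis
      unfolding \<Phi>_def[abs_def] \<Phi>'_def
      by (rule DERIV_cong[OF DERIV_diff[OF df[OF mu] DERIV_mult[OF dg[OF mu] 1[unfolded e]]]])
         (simp add: algebra_simps)
  qed
  have \<Phi>'m: "\<sigma> * \<Phi>' \<epsilon> \<mu> \<ge> m / 2" if "\<epsilon> \<in> {0<..<\<epsilon>0}" "\<mu> \<in> I" for \<epsilon> \<mu>
  proof -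
    let ?z = "\<epsilon> * sqrt \<mu>"
    have "\<bar>g' \<mu> * quot ?z\<bar> \<le> G * \<eta>"
      unfolding abs_mult using G(1,3) sm[OF that] that(2) by (intro mult_mono) auto
    moreover have "\<bar>g \<mu> * (k ?z / (2 * \<mu>))\<bar> \<le> G * (\<eta> / lam0)"
    proof -
      have "\<bar>k ?z / (2 * \<mu>)\<bar> \<le> \<eta> / lam0"
        unfolding abs_divide using sm(3)[OF that] Ipos[OF that(2)] lam0 by (intro frac_le) auto
      then show ?thesis
        unfolding abs_mult using G(1,2) that(2) by (intro mult_mono) auto
    qed
    moreover have "G * \<eta> + G * (\<eta> / lam0) \<le> m / 2"
      using \<eta>(2) by (simp add: algebra_simps)
    ultimately have b: "\<bar>g' \<mu> * quot ?z - g \<mu> * (k ?z / (2 * \<mu>))\<bar> \<le> m / 2"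
      by linarith
    have "\<sigma> * (g' \<mu> * quot ?z - g \<mu> * (k ?z / (2 * \<mu>))) \<le> m / 2"
      using b m(3) by (metis abs_le_D1 abs_mult mult_1)
    then show ?thesis
      using mI[OF that(2)] unfolding \<Phi>'_def right_diff_distrib[of \<sigma> "f' \<mu>"] by linarith
  qed
  have mvt: "m / 2 * (y - x) \<le> \<sigma> * (\<Phi> \<epsilon> y - \<Phi> \<epsilon> x)"
    if "\<epsilon> \<in> {0<..<\<epsilon>0}" "x \<in> I" "y \<in> I" "x \<le> y" for \<epsilon> x y
  proof (cases "x = y")
    case False
    have "\<exists>z>x. z < y \<and> \<Phi> \<epsilon> y - \<Phi> \<epsilon> x = (y - x) * \<Phi>' \<epsilon> z"
      using that False by (intro MVT2 d\<Phi>) (auto simp: I_def)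
    then obtain z where z: "x < z" "z < y" "\<Phi> \<epsilon> y - \<Phi> \<epsilon> x = (y - x) * \<Phi>' \<epsilon> z" by blast
    then have "z \<in> I" using that by (auto simp: I_def)
    then have "(y - x) * (m / 2) \<le> (y - x) * (\<sigma> * \<Phi>' \<epsilon> z)"
      using \<Phi>'m that by (intro mult_left_mono) auto
    then show ?thesis using z by (simp add: mult_ac)
  qed simp
  have fmvt: "m * (y - x) \<le> \<sigma> * (f y - f x)" if "x \<in> I" "y \<in> I" "x < y" for x y
  proof -
    have "\<exists>z>x. z < y \<and> f y - f x = (y - x) * f' z"
      using that by (intro MVT2 df) (auto simp: I_def dest: Ipos intro: Ipos)
    then obtain z where z: "x < z" "z < y" "f y - f x = (y - x) * f' z" by blast
    then have "z \<in> I" using that by (auto simp: I_def)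
    then have "(y - x) * m \<le> (y - x) * (\<sigma> * f' z)"
      using mI that by (intro mult_left_mono) auto
    then show ?thesis using z by (simp add: mult_ac)
  qed
  have f0: "f lam0 = 0" using lam0 by (simp add: f_def)
  have I3: "lam0 - r \<in> I" "lam0 \<in> I" "lam0 + r \<in> I" using r by (auto simp: I_def)
  have gq: "\<bar>\<sigma> * (g \<mu> * quot (\<epsilon> * sqrt \<mu>))\<bar> < m * r" if "\<epsilon> \<in> {0<..<\<epsilon>0}" "\<mu> \<in> I" for \<epsilon> \<mu>
  proof -
    have "\<bar>g \<mu> * quot (\<epsilon> * sqrt \<mu>)\<bar> \<le> G * \<eta>"
      unfolding abs_mult using G(1,2) sm[OF that] that(2) by (intro mult_mono) auto
    then show ?thesis using \<eta>(3) m(3) by (simp add: abs_mult mult.commute)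
  qed
  have ex: "\<exists>!\<mu>. \<mu> \<in> I \<and> \<bar>\<mu> - lam0\<bar> < r \<and> \<Phi> \<epsilon> \<mu> = 0" if e: "\<epsilon> \<in> {0<..<\<epsilon>0}" for \<epsilon>
  proof -
    have lo: "\<sigma> * \<Phi> \<epsilon> (lam0 - r) < 0"
    proof -
      have "\<sigma> * f (lam0 - r) \<le> - (m * r)"
        using fmvt[OF I3(1,2)] r f0 by simp
      then show ?thesis using gq[OF e I3(1)] unfolding \<Phi>_def right_diff_distrib by linarith
    qed
    have hi: "\<sigma> * \<Phi> \<epsilon> (lam0 + r) > 0"
    proof -
      have "\<sigma> * f (lam0 + r) \<ge> m * r"
        using fmvt[OF I3(2,3)] r f0 by simp
      then show ?thesis using gq[OF e I3(3)] unfolding \<Phi>_def right_diff_distrib by linarith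
    qed
    have c: "continuous_on {lam0 - r..lam0 + r} (\<lambda>\<mu>. \<sigma> * \<Phi> \<epsilon> \<mu>)"
      using d\<Phi>[OF e] unfolding I_def
      by (intro continuous_intros continuous_at_imp_continuous_on) (blast intro: DERIV_isCont)
    have "\<exists>\<mu>. lam0 - r \<le> \<mu> \<and> \<mu> \<le> lam0 + r \<and> \<sigma> * \<Phi> \<epsilon> \<mu> = 0"
      using lo hi r by (intro IVT' c) auto
    then obtain \<mu> where mu: "lam0 - r \<le> \<mu>" "\<mu> \<le> lam0 + r" "\<sigma> * \<Phi> \<epsilon> \<mu> = 0" by blast
    then have z: "\<Phi> \<epsilon> \<mu> = 0" using m(3) by auto
    have "\<mu> \<noteq> lam0 - r" "\<mu> \<noteq> lam0 + r" using lo hi z by auto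
    then have 1: "\<mu> \<in> I" "\<bar>\<mu> - lam0\<bar> < r" using mu by (auto simp: I_def)
    have "\<mu>1 = \<mu>2" if "\<mu>1 \<in> I" "\<mu>2 \<in> I" "\<Phi> \<epsilon> \<mu>1 = 0" "\<Phi> \<epsilon> \<mu>2 = 0" for \<mu>1 \<mu>2
    proof (rule ccontr)
      assume "\<mu>1 \<noteq> \<mu>2"
      then have "0 < m / 2 * \<bar>\<mu>2 - \<mu>1\<bar>" using m by simp
      moreover have "m / 2 * \<bar>\<mu>2 - \<mu>1\<bar> \<le> 0"
        using mvt[OF e that(1,2)] mvt[OF e that(2,1)] that(3,4) by (cases "\<mu>1 \<le> \<mu>2") auto
      ultimately show False by linarith
    qed
    then show ?thesis using 1 z by blast
  qed
  define lam where "lam \<epsilon> = (THE \<mu>. \<mu> \<in> I \<and> \<bar>\<mu> - lam0\<bar> < r \<and> \<Phi> \<epsilon> \<mu> = 0)" for \<epsilon>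
  have lam: "lam \<epsilon> \<in> I" "\<bar>lam \<epsilon> - lam0\<bar> < r" "\<Phi> \<epsilon> (lam \<epsilon>) = 0" if "\<epsilon> \<in> {0<..<\<epsilon>0}" for \<epsilon>
    using theI'[OF ex[OF that]] unfolding lam_def by auto
  have iff: "(0 < \<mu> \<and> \<bar>\<mu> - lam0\<bar> < r \<and> cross \<epsilon> \<mu> = 0) \<longleftrightarrow> \<mu> = lam \<epsilon>" if e: "\<epsilon> \<in> {0<..<\<epsilon>0}" for \<epsilon> \<mu>
  proof
    assume a: "0 < \<mu> \<and> \<bar>\<mu> - lam0\<bar> < r \<and> cross \<epsilon> \<mu> = 0"
    then have "\<mu> \<in> I" by (auto simp: I_def)
    then show "\<mu> = lam \<epsilon>" using a ex[OF e] lam[OF e] cross[OF e] by blast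
  next
    assume "\<mu> = lam \<epsilon>"
    then show "0 < \<mu> \<and> \<bar>\<mu> - lam0\<bar> < r \<and> cross \<epsilon> \<mu> = 0"
      using lam[OF e] Ipos cross[OF e] by blast
  qed
  have ev: "\<forall>\<^sub>F \<epsilon> in at_right 0. \<epsilon> \<in> {0<..<\<epsilon>0}"
    using eventually_at_right_real[OF \<epsilon>0] .
  have lamlim: "(lam \<longlongrightarrow> lam0) (at_right 0)"
  proof (rule LIM_zero_cancel, rule Lim_null_comparison)
    have "filterlim (\<lambda>\<epsilon>. \<epsilon> * sqrt lam0) (at_right 0) (at_right 0)"
      by (rule filterlim_scaled[OF tendsto_const]) (use lam0 in simp)
    then have "((\<lambda>\<epsilon>. quot (\<epsilon> * sqrt lam0)) \<longlongrightarrow> 0) (at_right 0)"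
      by (rule filterlim_compose[OF quot_tendsto(2)])
    then have "((\<lambda>\<epsilon>. 2 / m * (G * \<bar>quot (\<epsilon> * sqrt lam0)\<bar>)) \<longlongrightarrow> 2 / m * (G * \<bar>0\<bar>)) (at_right 0)"
      by (intro tendsto_intros)
    then show "((\<lambda>\<epsilon>. 2 / m * (G * \<bar>quot (\<epsilon> * sqrt lam0)\<bar>)) \<longlongrightarrow> 0) (at_right 0)" by simp
    show "\<forall>\<^sub>F \<epsilon> in at_right 0. norm (lam \<epsilon> - lam0) \<le> 2 / m * (G * \<bar>quot (\<epsilon> * sqrt lam0)\<bar>)"
      using ev
    proof eventually_elim
      case (elim \<epsilon>)
      have "m / 2 * \<bar>lam \<epsilon> - lam0\<bar> \<le> \<bar>\<sigma> * \<Phi> \<epsilon> lam0\<bar>"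
        using mvt[OF elim I3(2) lam(1)[OF elim]] mvt[OF elim lam(1)[OF elim] I3(2)] lam(3)[OF elim]
        by (cases "lam0 \<le> lam \<epsilon>") auto
      also have "\<dots> = \<bar>g lam0\<bar> * \<bar>quot (\<epsilon> * sqrt lam0)\<bar>"
        using m(3) f0 by (simp add: abs_mult \<Phi>_def)
      also have "\<dots> \<le> G * \<bar>quot (\<epsilon> * sqrt lam0)\<bar>"
        using G(2)[OF I3(2)] by (intro mult_right_mono) auto
      finally show ?case using m(1) by (simp add: field_simps)
    qed
  qed
  \<comment> \<open>Caratheodory's form of the derivative: dividing the exact equation
    \<open>f (lam \<epsilon>) = g (lam \<epsilon>) * quot (...)\<close> by the continuous slope
    \<open>q\<close> gives the expansion without remainder terms.\<close>
  obtain q where q: "\<And>\<mu>. f \<mu> - f lam0 = q \<mu> * (\<mu> - lam0)" "isCont q lam0" "q lam0 = f' lam0"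
    using df[OF lam0(1)] unfolding CARAT_DERIV by blast
  \<comment> \<open>The limit of \<open>g * quot / q\<close> divided by
    \<open>\<epsilon> powr (2 * \<nu>)\<close>. It is positive because \<open>g / f'\<close> at
    \<open>lam0\<close> and \<open>quot_lim\<close> are both negative.\<close>
  define A where "A = g lam0 * quot_lim * (sqrt lam0 / 2) powr (2 * \<nu>) / f' lam0"
  have f'0: "f' lam0 \<noteq> 0" using W0 by auto
  have "A > 0"
  proof -
    have "g lam0 / f' lam0 < 0"
      using W0 by (auto simp: mult_less_0_iff divide_less_0_iff)
    then have "0 < (g lam0 / f' lam0) * quot_lim"
      using quot_lim_neg by (rule mult_neg_neg)
    moreover have "(sqrt lam0 / 2) powr (2 * \<nu>) > 0"
      using lam0 by simp
    ultimately have "0 < (g lam0 / f' lam0) * quot_lim * (sqrt lam0 / 2) powr (2 * \<nu>)"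
      by (rule mult_pos_pos)
    then show ?thesis
      by (simp add: A_def mult_ac)
  qed
  have s: "((\<lambda>\<epsilon>. sqrt (lam \<epsilon>)) \<longlongrightarrow> sqrt lam0) (at_right 0)"
    by (intro tendsto_intros lamlim)
  have fl: "filterlim (\<lambda>\<epsilon>. \<epsilon> * sqrt (lam \<epsilon>)) (at_right 0) (at_right 0)"
    by (rule filterlim_scaled[OF s]) (use lam0 in simp)
  have glim: "((\<lambda>\<epsilon>. g (lam \<epsilon>)) \<longlongrightarrow> g lam0) (at_right 0)"
    by (rule isCont_tendsto_compose[OF DERIV_isCont[OF dg[OF lam0(1)]] lamlim])
  have qlim: "((\<lambda>\<epsilon>. q (lam \<epsilon>)) \<longlongrightarrow> f' lam0) (at_right 0)"
    using isCont_tendsto_compose[OF q(2) lamlim] q(3) by simp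
  have plim: "((\<lambda>\<epsilon>. (sqrt (lam \<epsilon>) / 2) powr (2 * \<nu>)) \<longlongrightarrow> (sqrt lam0 / 2) powr (2 * \<nu>)) (at_right 0)"
    by (intro tendsto_intros s) (use lam0 in auto)
  have "((\<lambda>\<epsilon>. g (lam \<epsilon>) * (quot (\<epsilon> * sqrt (lam \<epsilon>)) / (\<epsilon> * sqrt (lam \<epsilon>) / 2) powr (2 * \<nu>))
      * (sqrt (lam \<epsilon>) / 2) powr (2 * \<nu>) / q (lam \<epsilon>)) \<longlongrightarrow> A) (at_right 0)"
    unfolding A_def
    by (intro tendsto_intros glim qlim plim f'0 filterlim_compose[OF quot_tendsto(1) fl])
  moreover have "\<forall>\<^sub>F \<epsilon> in at_right 0. g (lam \<epsilon>) * (quot (\<epsilon> * sqrt (lam \<epsilon>)) / (\<epsilon> * sqrt (lam \<epsilon>) / 2) powr (2 * \<nu>))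
      * (sqrt (lam \<epsilon>) / 2) powr (2 * \<nu>) / q (lam \<epsilon>) = (lam \<epsilon> - lam0) / \<epsilon> powr (2 * \<nu>)"
    using ev tendsto_imp_eventually_ne[OF qlim f'0]
  proof eventually_elim
    case (elim \<epsilon>)
    have e: "\<epsilon> > 0" "lam \<epsilon> > 0" using elim lam(1)[OF elim(1)] Ipos by auto
    have p: "(\<epsilon> * sqrt (lam \<epsilon>) / 2) powr (2 * \<nu>) = \<epsilon> powr (2 * \<nu>) * (sqrt (lam \<epsilon>) / 2) powr (2 * \<nu>)"
      using e by (subst powr_mult[symmetric]) auto
    have pn: "(sqrt (lam \<epsilon>) / 2) powr (2 * \<nu>) \<noteq> 0" "\<epsilon> powr (2 * \<nu>) \<noteq> 0" using e by auto
    have "q (lam \<epsilon>) * (lam \<epsilon> - lam0) = g (lam \<epsilon>) * quot (\<epsilon> * sqrt (lam \<epsilon>))"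
      using q(1)[of "lam \<epsilon>"] f0 lam(3)[OF elim(1)] by (simp add: \<Phi>_def)
    then have "lam \<epsilon> - lam0 = g (lam \<epsilon>) * quot (\<epsilon> * sqrt (lam \<epsilon>)) / q (lam \<epsilon>)"
      using elim(2) by (simp add: field_simps)
    then show ?case
      unfolding p using pn by (simp add: divide_simps)
  qed
  ultimately have "((\<lambda>\<epsilon>. (lam \<epsilon> - lam0) / \<epsilon> powr (2 * \<nu>)) \<longlongrightarrow> A) (at_right 0)"
    by (rule Lim_transform_eventually)
  then show ?thesis
    using \<epsilon>0 r(1) \<open>A > 0\<close> iff lamlim by blast
qed

text \<open>The profile \<open>J - \<kappa> * Y\<close> is examined on three ranges. Up to
  \<open>z0\<close> it is positive by monotonicity of \<open>quot\<close>; between \<open>z0\<close>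
  and \<open>j - \<delta>\<close> the function \<open>J\<close> is bounded below and outweighs the
  small second term; near \<open>j\<close> the profile decreases towards its zero at
  \<open>sqrt (lam \<epsilon>)\<close>.\<close>

lemma radial_positive:
  assumes j: "j > 0" "J j = 0" "\<And>z. 0 < z \<Longrightarrow> z < j \<Longrightarrow> J z > 0"
    and lam: "(lam \<longlongrightarrow> j\<^sup>2) (at_right 0)" "\<forall>\<^sub>F \<epsilon> in at_right 0. cross \<epsilon> (lam \<epsilon>) = 0"
  shows "\<forall>\<^sub>F \<epsilon> in at_right 0. lam \<epsilon> > 0 \<and> Y (\<epsilon> * sqrt (lam \<epsilon>)) \<noteq> 0 \<and>
      J (sqrt (lam \<epsilon>)) - quot (\<epsilon> * sqrt (lam \<epsilon>)) * Y (sqrt (lam \<epsilon>)) = 0 \<and>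
      (\<forall>r\<in>{\<epsilon><..<1}. 0 < J (sqrt (lam \<epsilon>) * r) - quot (\<epsilon> * sqrt (lam \<epsilon>)) * Y (sqrt (lam \<epsilon>) * r))"
proof -
  obtain z0 where z0: "z0 > 0" "\<And>z. 0 < z \<Longrightarrow> z \<le> z0 \<Longrightarrow> J z > 0 \<and> Y z < 0"
    using signs_near_0 by blast
  have z0j: "z0 < j" using z0 j by force
  \<comment> \<open>\<open>J\<close> is positive to the left of \<open>j\<close>, so its slope at
    \<open>j\<close> cannot be positive; by the Wronskian it is not 0.\<close>
  have J'j: "J' j < 0"
  proof -
    have "((\<lambda>z. J z) has_real_derivative J' j / j) (at j)" using derivs(1)[OF j(1)] .
    moreover have "J' j \<noteq> 0" using wronskian[OF j(1)] j(2) by auto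
    moreover have "\<not> J' j / j > 0"
    proof
      assume "J' j / j > 0"
      from DERIV_pos_inc_left[OF derivs(1)[OF j(1)] this] obtain d where
        d: "d > 0" "\<And>h. h > 0 \<Longrightarrow> h < d \<Longrightarrow> J (j - h) < J j" by blast
      define h where "h = min (d / 2) (j / 2)"
      have "h > 0" "h < d" "0 < j - h" "j - h < j" using d(1) j(1) by (auto simp: h_def)
      then show False using d(2)[of h] j(2) j(3)[of "j - h"] by simp
    qed
    ultimately show ?thesis using j(1) by (simp add: zero_less_divide_iff)
  qed
  have "isCont J' j" using derivs(2)[OF j(1)] by (rule DERIV_isCont)
  then have "\<forall>\<^sub>F z in at j. J' z < J' j / 2"
    using J'j by (intro order_tendstoD(2)[OF isContD]) auto
  then obtain d0 where d0: "d0 > 0" "\<And>z. z \<noteq> j \<Longrightarrow> dist z j < d0 \<Longrightarrow> J' z < J' j / 2"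
    unfolding eventually_at by auto
  define m where "m = - J' j / 2"
  define \<delta> where "\<delta> = min (d0 / 2) ((j - z0) / 2)"
  have m: "m > 0" using J'j by (simp add: m_def)
  have \<delta>_le: "\<delta> \<le> d0 / 2" "\<delta> \<le> (j - z0) / 2"
    unfolding \<delta>_def by (rule min.cobounded1, rule min.cobounded2)
  have \<delta>: "\<delta> > 0" "\<delta> < d0" "z0 < j - \<delta>"
  proof -
    show "\<delta> > 0" using d0(1) z0j by (simp add: \<delta>_def)
    show "\<delta> < d0" using \<delta>_le(1) d0(1) by linarith
    show "z0 < j - \<delta>" using \<delta>_le(2) z0j by (simp add: field_simps)
  qed
  have J'm: "J' z \<le> - m" if "z \<in> {j - \<delta>..j + \<delta>}" for z
  proof (cases "z = j")
    case False
    have "\<bar>z - j\<bar> \<le> \<delta>" using that by (auto simp: abs_real_def)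
    then have "dist z j < d0" using \<delta> by (simp add: dist_real_def)
    then show ?thesis using d0(2)[OF False] by (simp add: m_def)
  qed (use J'j in \<open>simp add: m_def\<close>)
  have sub: "{z0..j - \<delta>} \<subseteq> {0<..}" "{z0..j + \<delta>} \<subseteq> {0<..}" using z0 by auto
  obtain x1 where x1: "x1 \<in> {z0..j - \<delta>}" "\<And>z. z \<in> {z0..j - \<delta>} \<Longrightarrow> J x1 \<le> J z"
    using continuous_attains_inf[OF _ _ continuous(1)[OF sub(1)]] \<delta> by auto
  define m1 where "m1 = J x1"
  have m1: "m1 > 0" using x1(1) z0 \<delta> unfolding m1_def by (intro j(3)) auto
  have "bounded (Y ` {z0..j + \<delta>})" "bounded (Y' ` {z0..j + \<delta>})"
    by (intro compact_imp_bounded compact_continuous_image continuous sub; simp)+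
  then obtain G0 G1 where G01: "\<forall>y\<in>Y ` {z0..j + \<delta>}. norm y \<le> G0" "\<forall>y\<in>Y' ` {z0..j + \<delta>}. norm y \<le> G1"
    unfolding bounded_iff by blast
  define G where "G = max 1 (max G0 G1)"
  have G: "G > 0" "\<And>z. z \<in> {z0..j + \<delta>} \<Longrightarrow> \<bar>Y z\<bar> \<le> G" "\<And>z. z \<in> {z0..j + \<delta>} \<Longrightarrow> \<bar>Y' z\<bar> \<le> G"
    using G01 unfolding G_def by (auto simp: le_max_iff_disj)
  \<comment> \<open>The quotient \<open>m / G\<close> keeps the slope of the profile negative near
    \<open>j\<close>, and \<open>m1 / G\<close> keeps the second term below the minimum of
    \<open>J\<close> on the middle range.\<close>
  define \<eta> where "\<eta> = min (m / G) (m1 / G)"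
  have \<eta>: "\<eta> > 0" "\<eta> * G \<le> m" "\<eta> * G \<le> m1"
    using m m1 G(1) by (auto simp: \<eta>_def min_def field_simps)
  have "((\<lambda>\<epsilon>. sqrt (lam \<epsilon>)) \<longlongrightarrow> sqrt (j\<^sup>2)) (at_right 0)"
    by (intro tendsto_intros lam)
  then have s: "((\<lambda>\<epsilon>. sqrt (lam \<epsilon>)) \<longlongrightarrow> j) (at_right 0)" using j(1) by simp
  have fl: "filterlim (\<lambda>\<epsilon>. \<epsilon> * sqrt (lam \<epsilon>)) (at_right 0) (at_right 0)"
    by (rule filterlim_scaled[OF s j(1)])
  have e1: "\<forall>\<^sub>F \<epsilon> in at_right 0. \<bar>quot (\<epsilon> * sqrt (lam \<epsilon>))\<bar> < \<eta>"
    using tendstoD[OF filterlim_compose[OF quot_tendsto(2) fl] \<eta>(1)] by simp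
  have "((\<lambda>\<epsilon>. \<epsilon> * sqrt (lam \<epsilon>)) \<longlongrightarrow> 0) (at_right 0)"
    using fl by (simp add: filterlim_at)
  then have e2: "\<forall>\<^sub>F \<epsilon> in at_right 0. \<epsilon> * sqrt (lam \<epsilon>) < z0"
    using z0(1) by (rule order_tendstoD(2))
  have e3: "\<forall>\<^sub>F \<epsilon> in at_right 0. \<bar>sqrt (lam \<epsilon>) - j\<bar> < \<delta>"
    using tendstoD[OF s \<delta>(1)] by (simp add: dist_real_def)
  show ?thesis
    using e1 e2 e3 lam(2) eventually_at_right_less[of "0::real"]
  proof eventually_elim
    case (elim \<epsilon>)
    define s where "s = sqrt (lam \<epsilon>)"
    have s: "s \<in> {j - \<delta><..<j + \<delta>}" using elim(3) unfolding s_def by auto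
    then have s0: "s > 0" using \<delta> z0 by auto
    then have l: "lam \<epsilon> > 0" unfolding s_def by simp
    define \<kappa> where "\<kappa> = quot (\<epsilon> * s)"
    have \<kappa>: "\<bar>\<kappa>\<bar> < \<eta>" using elim(1) by (simp add: \<kappa>_def s_def)
    have es: "0 < \<epsilon> * s" "\<epsilon> * s < z0" using elim(2,5) s0 by (auto simp: s_def)
    have Yne: "Y (\<epsilon> * s) \<noteq> 0" using z0(2)[of "\<epsilon> * s"] es by auto
    have eq: "J s - \<kappa> * Y s = 0"
      using cross_eq_0_iff[of \<epsilon> "lam \<epsilon>"] elim(4) Yne by (simp add: s_def \<kappa>_def mult.commute)
    have "0 < J (s * r) - \<kappa> * Y (s * r)" if r: "r \<in> {\<epsilon><..<1}" for r
    proof -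
      define z where "z = s * r"
      have z: "\<epsilon> * s < z" "z < s" using r s0 by (auto simp: z_def mult.commute)
      consider "z \<le> z0" | "z0 \<le> z" "z \<le> j - \<delta>" | "j - \<delta> \<le> z" by linarith
      then have "0 < J z - \<kappa> * Y z"
      proof cases
        \<comment> \<open>At the inner end \<open>\<kappa> * Y\<close> equals \<open>J\<close>, so
          no size estimate can decide the sign. Instead \<open>quot z < \<kappa>\<close> is
          multiplied by the negative number \<open>Y z\<close>.\<close>
        case 1
        have zn: "Y y < 0" if "\<epsilon> * s \<le> y" "y \<le> z" for y
          using z0(2)[of y] that es 1 by auto
        have "quot z < quot (\<epsilon> * s)"
        proof (rule DERIV_neg_imp_decreasing[OF z(1)])
          fix y assume y: "\<epsilon> * s \<le> y" "y \<le> z"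
          have y0: "y > 0" "Y y < 0" using y es zn by auto
          then have "- 2 / (pi * (Y y)\<^sup>2) / y < 0" by (simp add: divide_neg_pos)
          then show "\<exists>d. (quot has_real_derivative d) (at y) \<and> d < 0"
            using DERIV_quot[of y] y0 by auto
        qed
        moreover have "Y z < 0" using zn z by simp
        ultimately have "Y z * quot z > Y z * \<kappa>"
          unfolding \<kappa>_def by (simp add: mult_strict_left_mono_neg)
        then show ?thesis using \<open>Y z < 0\<close> by (simp add: quot_def mult.commute)
      next
        case 2
        then have "m1 \<le> J z" using x1(2) by (simp add: m1_def)
        moreover have "\<kappa> * Y z < m1"
        proof -
          have "\<bar>\<kappa> * Y z\<bar> \<le> \<bar>\<kappa>\<bar> * G"
            unfolding abs_mult using G(2)[of z] 2 \<delta> by (intro mult_left_mono) auto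
          also have "\<dots> < \<eta> * G" using \<kappa> G(1) by (intro mult_strict_right_mono)
          finally show ?thesis using \<eta>(3) by linarith
        qed
        ultimately show ?thesis by linarith
      next
        case 3
        have "J s - \<kappa> * Y s < J z - \<kappa> * Y z"
        proof (rule DERIV_neg_imp_decreasing[OF z(2), where f = "\<lambda>z. J z - \<kappa> * Y z"])
          fix y assume y: "z \<le> y" "y \<le> s"
          then have yI: "y \<in> {j - \<delta>..j + \<delta>}" "y \<in> {z0..j + \<delta>}" using 3 s \<delta> by auto
          have y0: "y > 0" using yI z0 by auto
          have "\<bar>\<kappa> * Y' y\<bar> \<le> \<bar>\<kappa>\<bar> * G"
            unfolding abs_mult using G(3)[OF yI(2)] by (intro mult_left_mono) auto
          also have "\<dots> < \<eta> * G" using \<kappa> G(1) by (intro mult_strict_right_mono)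
          finally have "J' y - \<kappa> * Y' y < 0" using \<eta>(2) J'm[OF yI(1)] by linarith
          then have "J' y / y - \<kappa> * (Y' y / y) < 0"
            using y0 by (simp add: field_simps)
          then show "\<exists>d. ((\<lambda>z. J z - \<kappa> * Y z) has_real_derivative d) (at y) \<and> d < 0"
            using DERIV_diff[OF derivs(1)[OF y0] DERIV_cmult[OF derivs(3)[OF y0], of \<kappa>]] by blast
        qed
        then show ?thesis using eq by simp
      qed
      then show ?thesis by (simp add: z_def)
    qed
    then show ?case using l Yne eq by (simp add: s_def \<kappa>_def)
  qed
qed

end

section \<open>Zonal eigenfunctions\<close>

definition unit_radius :: "(nat \<Rightarrow> real) \<Rightarrow> bool" where
  "unit_radius c \<longleftrightarrow> (\<forall>s. \<bar>s\<bar> < 1 \<longrightarrow> summable (\<lambda>m. c m * s ^ m))"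

definition psum :: "(nat \<Rightarrow> real) \<Rightarrow> real \<Rightarrow> real" where
  "psum c s = (\<Sum>m. c m * s ^ m)"

lemma unit_radius_diffs: "unit_radius c \<Longrightarrow> unit_radius (diffs c)"
  unfolding unit_radius_def using termdiff_converges[of _ 1 c] by auto

lemma DERIV_psum:
  assumes "unit_radius c" "\<bar>s\<bar> < 1"
  shows "(psum c has_real_derivative psum (diffs c) s) (at s)"
proof -
  obtain K where K: "\<bar>s\<bar> < K" "K < 1" using assms(2) dense by blast
  have "summable (\<lambda>m. c m * K ^ m)" using assms(1) K unfolding unit_radius_def by auto
  then show ?thesis
    unfolding psum_def[abs_def] using K by (intro termdiffs_strong) auto
qed

lemma psum_diffs_mult:
  assumes "unit_radius c" "\<bar>s\<bar> < 1"
  shows "s * psum (diffs c) s = psum (\<lambda>m. real m * c m) s" "summable (\<lambda>m. (real m * c m) * s ^ m)"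
proof -
  have s1: "summable (\<lambda>m. diffs c m * s ^ m)"
    using unit_radius_diffs[OF assms(1)] assms(2) unfolding unit_radius_def by blast
  have e: "s * (diffs c m * s ^ m) = (real (Suc m) * c (Suc m)) * s ^ Suc m" for m
    by (simp add: diffs_def)
  have "summable (\<lambda>m. (real (Suc m) * c (Suc m)) * s ^ Suc m)"
    using summable_mult[OF s1, of s] unfolding e .
  then show s2: "summable (\<lambda>m. (real m * c m) * s ^ m)"
    by (subst (asm) summable_Suc_iff)
  have "psum (\<lambda>m. real m * c m) s = (\<Sum>m. (real (Suc m) * c (Suc m)) * s ^ Suc m)"
    unfolding psum_def using suminf_split_head[OF s2] by simp
  also have "\<dots> = (\<Sum>m. s * (diffs c m * s ^ m))"
    unfolding e ..
  also have "\<dots> = s * psum (diffs c) s"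
    unfolding psum_def by (rule suminf_mult[OF s1])
  finally show "s * psum (diffs c) s = psum (\<lambda>m. real m * c m) s" by simp
qed

text \<open>For \<open>\<kappa> = l * (l + n - 2)\<close> these are the coefficients of the
  hypergeometric function with parameters \<open>- l\<close>, \<open>l + n - 2\<close> and
  \<open>(n - 1) / 2\<close>: the Gegenbauer-type solution regular at the pole, in the variable
  \<open>s = (1 - cos \<theta>) / 2\<close>. The parameter \<open>\<kappa>\<close> is kept because
  it enters each factor linearly.\<close>

fun zonal_coeff :: "real \<Rightarrow> real \<Rightarrow> nat \<Rightarrow> real" where
  "zonal_coeff n \<kappa> 0 = 1"
| "zonal_coeff n \<kappa> (Suc m) = zonal_coeff n \<kappa> m * (real m * (real m + n - 2) - \<kappa>) / (real (Suc m) * (real m + (n - 1) / 2))"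

lemma zonal_denominator_pos: "n \<ge> 2 \<Longrightarrow> 0 < real (Suc m) * (real m + (n - 1) / 2)"
  by (intro mult_pos_pos add_nonneg_pos) auto

text \<open>Taking \<open>- \<Lambda>\<close> for \<open>\<kappa>\<close> makes every factor of the
  recursion nonnegative and as large as possible. This majorant serves all \<open>\<kappa>\<close>
  in \<open>{0..\<Lambda>}\<close> at once in the M-test for joint continuity.\<close>

lemma zonal_coeff_bound:
  assumes "n \<ge> 2" "\<bar>\<kappa>\<bar> \<le> \<Lambda>"
  shows "\<bar>zonal_coeff n \<kappa> m\<bar> \<le> zonal_coeff n (- \<Lambda>) m \<and> 0 \<le> zonal_coeff n (- \<Lambda>) m"
proof (induction m)
  case (Suc m)
  have a: "0 \<le> real m * (real m + n - 2)" using assms by simp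
  have d: "0 < real (Suc m) * (real m + (n - 1) / 2)" by (rule zonal_denominator_pos[OF assms(1)])
  have "\<bar>real m * (real m + n - 2) - \<kappa>\<bar> \<le> real m * (real m + n - 2) - (- \<Lambda>)"
    using a assms(2) by linarith
  then have "\<bar>zonal_coeff n \<kappa> m\<bar> * \<bar>real m * (real m + n - 2) - \<kappa>\<bar>
      \<le> zonal_coeff n (- \<Lambda>) m * (real m * (real m + n - 2) - (- \<Lambda>))"
    using Suc by (intro mult_mono) auto
  moreover have "0 \<le> zonal_coeff n (- \<Lambda>) m * (real m * (real m + n - 2) - (- \<Lambda>))"
    using Suc a assms(2) by (intro mult_nonneg_nonneg) auto
  ultimately have "\<bar>zonal_coeff n \<kappa> m\<bar> * \<bar>real m * (real m + n - 2) - \<kappa>\<bar> / (real (Suc m) * (real m + (n - 1) / 2))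
      \<le> zonal_coeff n (- \<Lambda>) (Suc m) \<and> 0 \<le> zonal_coeff n (- \<Lambda>) (Suc m)"
    unfolding zonal_coeff.simps using d by (intro conjI divide_right_mono divide_nonneg_pos) auto
  moreover have "\<bar>zonal_coeff n \<kappa> (Suc m)\<bar> =
      \<bar>zonal_coeff n \<kappa> m\<bar> * \<bar>real m * (real m + n - 2) - \<kappa>\<bar> / (real (Suc m) * (real m + (n - 1) / 2))"
    unfolding zonal_coeff.simps abs_divide abs_mult[of "zonal_coeff n \<kappa> m"] abs_of_pos[OF d] ..
  ultimately show ?case by simp
qed simp

lemma unit_radius_zonal:
  assumes "n \<ge> 2"
  shows "unit_radius (zonal_coeff n \<kappa>)"
  unfolding unit_radius_def
proof (intro allI impI)
  fix s :: real assume s: "\<bar>s\<bar> < 1"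
  let ?q = "\<lambda>m::nat. (real m * (real m + n - 2) - \<kappa>) / (real (Suc m) * (real m + (n - 1) / 2))"
  have "?q \<longlonglongrightarrow> 1" by real_asymp
  then have "(\<lambda>m. \<bar>?q m * s\<bar>) \<longlonglongrightarrow> \<bar>1 * s\<bar>"
    by (intro tendsto_intros)
  then have "\<forall>\<^sub>F m in sequentially. \<bar>?q m * s\<bar> < (\<bar>s\<bar> + 1) / 2"
    using s by (intro order_tendstoD(2)) auto
  then obtain m0 where m0: "\<And>m. m \<ge> m0 \<Longrightarrow> \<bar>?q m * s\<bar> < (\<bar>s\<bar> + 1) / 2"
    unfolding eventually_sequentially by blast
  show "summable (\<lambda>m. zonal_coeff n \<kappa> m * s ^ m)"
  proof (rule summable_ratio_test)
    show "(\<bar>s\<bar> + 1) / 2 < 1" using s by simp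
    fix m assume "m0 \<le> m"
    have "norm (zonal_coeff n \<kappa> (Suc m) * s ^ Suc m) = \<bar>?q m * s\<bar> * norm (zonal_coeff n \<kappa> m * s ^ m)"
      by (simp add: abs_mult mult_ac)
    also have "\<dots> \<le> (\<bar>s\<bar> + 1) / 2 * norm (zonal_coeff n \<kappa> m * s ^ m)"
      using m0[OF \<open>m0 \<le> m\<close>] by (intro mult_right_mono) auto
    finally show "norm (zonal_coeff n \<kappa> (Suc m) * s ^ Suc m) \<le> (\<bar>s\<bar> + 1) / 2 * norm (zonal_coeff n \<kappa> m * s ^ m)" .
  qed
qed

text \<open>Each term of the equation is rewritten as a power series; the coefficient of
  \<open>s ^ m\<close> in the sum vanishes by the recursion for \<open>zonal_coeff\<close>.\<close>

lemma zonal_ode: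
  assumes "n \<ge> 2" "\<bar>s\<bar> < 1"
  shows "s * (1 - s) * psum (diffs (diffs (zonal_coeff n \<kappa>))) s
     + (n - 1) * (1 / 2 - s) * psum (diffs (zonal_coeff n \<kappa>)) s + \<kappa> * psum (zonal_coeff n \<kappa>) s = 0"
proof -
  define c where "c = zonal_coeff n \<kappa>"
  \<comment> \<open>With this \<open>d\<close> one has \<open>diffs d m = m * diffs c m\<close>, so
    multiplying \<open>s * y''\<close> once more by \<open>s\<close> gives the coefficients
    \<open>m * (m - 1) * c m\<close>.\<close>
  define d where "d m = (real m - 1) * c m" for m
  have c: "unit_radius c" unfolding c_def by (rule unit_radius_zonal[OF assms(1)])
  note c1 = unit_radius_diffs[OF c]
  have sm: "summable (\<lambda>m. c m * s ^ m)" "summable (\<lambda>m. diffs c m * s ^ m)"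
    using c c1 assms(2) unfolding unit_radius_def by auto
  have ud: "unit_radius d"
    unfolding unit_radius_def
  proof (intro allI impI)
    fix x :: real assume x: "\<bar>x\<bar> < 1"
    have "summable (\<lambda>m. (real m * c m) * x ^ m - c m * x ^ m)"
      using psum_diffs_mult(2)[OF c x] c x unfolding unit_radius_def by (intro summable_diff) auto
    then show "summable (\<lambda>m. d m * x ^ m)"
      unfolding d_def by (simp add: algebra_simps)
  qed
  have dd: "diffs d = (\<lambda>m. real m * diffs c m)"
    by (simp add: fun_eq_iff diffs_def d_def mult_ac)
  have h2: "s * psum (diffs (diffs c)) s = psum (\<lambda>m. real m * diffs c m) s"
    by (rule psum_diffs_mult(1)[OF c1 assms(2)])
  have h3: "s * psum (\<lambda>m. real m * diffs c m) s = psum (\<lambda>m. real m * d m) s"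
    using psum_diffs_mult(1)[OF ud assms(2)] unfolding dd .
  have h1: "s * psum (diffs c) s = psum (\<lambda>m. real m * c m) s"
    by (rule psum_diffs_mult(1)[OF c assms(2)])
  note sums = psum_diffs_mult(2)[OF c1 assms(2)] psum_diffs_mult(2)[OF ud assms(2)] sm(2) psum_diffs_mult(2)[OF c assms(2)] sm(1)
  have "((\<lambda>m. ((((real m * diffs c m) * s ^ m - (real m * d m) * s ^ m) + (n - 1) / 2 * (diffs c m * s ^ m))
        - (n - 1) * ((real m * c m) * s ^ m)) + \<kappa> * (c m * s ^ m)) sums
      ((((psum (\<lambda>m. real m * diffs c m) s - psum (\<lambda>m. real m * d m) s) + (n - 1) / 2 * psum (diffs c) s)
        - (n - 1) * psum (\<lambda>m. real m * c m) s) + \<kappa> * psum c s))"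
    unfolding psum_def by (intro sums_add sums_diff sums_mult summable_sums sums)
  moreover have "((((real m * diffs c m) * s ^ m - (real m * d m) * s ^ m) + (n - 1) / 2 * (diffs c m * s ^ m))
        - (n - 1) * ((real m * c m) * s ^ m)) + \<kappa> * (c m * s ^ m) = 0" for m
  proof -
    have "real (Suc m) * (real m + (n - 1) / 2) * c (Suc m) = c m * (real m * (real m + n - 2) - \<kappa>)"
    proof -
      have "real (Suc m) * (real m + (n - 1) / 2) \<noteq> 0"
        using zonal_denominator_pos[OF assms(1), of m] by linarith
      then show ?thesis unfolding c_def by simp
    qed
    then have "(real m + (n - 1) / 2) * diffs c m - c m * (real m * (real m + n - 2) - \<kappa>) = 0"
      by (simp add: diffs_def mult_ac)
    then have "((real m + (n - 1) / 2) * diffs c m - c m * (real m * (real m + n - 2) - \<kappa>)) * s ^ m = 0"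
      by simp
    then show ?thesis unfolding d_def by (simp add: algebra_simps)
  qed
  ultimately have "(\<lambda>m. 0) sums ((((psum (\<lambda>m. real m * diffs c m) s - psum (\<lambda>m. real m * d m) s) + (n - 1) / 2 * psum (diffs c) s)
        - (n - 1) * psum (\<lambda>m. real m * c m) s) + \<kappa> * psum c s)"
    by simp
  then have "(((psum (\<lambda>m. real m * diffs c m) s - psum (\<lambda>m. real m * d m) s) + (n - 1) / 2 * psum (diffs c) s)
        - (n - 1) * psum (\<lambda>m. real m * c m) s) + \<kappa> * psum c s = 0"
    using sums_unique2 sums_zero by blast
  then show ?thesis
    unfolding c_def[symmetric] h3[symmetric] h2[symmetric] h1[symmetric] by (simp add: algebra_simps)
qed

lemma zonal_continuous:
  assumes "n \<ge> 2" "\<sigma> < 1" "0 \<le> \<sigma>"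
  shows "continuous_on ({0..\<Lambda>} \<times> {0..\<sigma>}) (\<lambda>p. psum (zonal_coeff n (fst p)) (snd p))"
proof -
  have cc: "continuous_on UNIV (\<lambda>\<kappa>. zonal_coeff n \<kappa> m)" for m
  proof (induction m)
    case (Suc m)
    have "real (Suc m) * (real m + (n - 1) / 2) \<noteq> 0"
      using zonal_denominator_pos[OF assms(1), of m] by linarith
    then show ?case unfolding zonal_coeff.simps by (intro continuous_intros Suc) auto
  qed simp
  let ?f = "\<lambda>N p. \<Sum>i<N. zonal_coeff n (fst p) i * (snd p) ^ i"
  have ul: "uniform_limit ({0..\<Lambda>} \<times> {0..\<sigma>}) ?f (\<lambda>p. psum (zonal_coeff n (fst p)) (snd p)) sequentially"
    unfolding psum_def
  proof (rule Weierstrass_m_test)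
    show "norm (zonal_coeff n (fst p) i * snd p ^ i) \<le> zonal_coeff n (- \<Lambda>) i * \<bar>\<sigma>\<bar> ^ i"
      if "p \<in> {0..\<Lambda>} \<times> {0..\<sigma>}" for i p
    proof -
      have "\<bar>zonal_coeff n (fst p) i\<bar> \<le> zonal_coeff n (- \<Lambda>) i \<and> 0 \<le> zonal_coeff n (- \<Lambda>) i"
        using that by (intro zonal_coeff_bound assms) auto
      then show ?thesis
        using that by (auto simp: abs_mult power_abs intro!: mult_mono power_mono)
    qed
    show "summable (\<lambda>i. zonal_coeff n (- \<Lambda>) i * \<bar>\<sigma>\<bar> ^ i)"
      using unit_radius_zonal[OF assms(1)] assms(2,3) unfolding unit_radius_def by auto
  qed
  have ev: "\<forall>\<^sub>F N in sequentially. continuous_on ({0..\<Lambda>} \<times> {0..\<sigma>}) (?f N)"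
    by (intro always_eventually allI continuous_intros continuous_on_compose2[OF cc]) auto
  show ?thesis
    by (rule uniform_limit_theorem[OF ev ul]) simp
qed

lemma psum_zonal_at_0 [simp]: "psum (zonal_coeff n \<kappa>) 0 = 1"
  unfolding psum_def using powser_zero[of "zonal_coeff n \<kappa>"] by simp

lemma psum_zonal_0: "psum (zonal_coeff n 0) s = 1"
proof -
  have "zonal_coeff n 0 (Suc m) = 0" for m
    by (induction m) auto
  then have "zonal_coeff n 0 m = (if m = 0 then 1 else 0)" for m
    by (cases m) auto
  then have "psum (zonal_coeff n 0) s = (\<Sum>m. if m = 0 then 1 * s ^ m else 0)"
    unfolding psum_def by (intro suminf_cong) auto
  also have "\<dots> = 1"
    using sums_single[of 0 "\<lambda>m. 1 * s ^ m"] by (simp add: sums_iff)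
  finally show ?thesis .
qed

lemma zonal_pos_of_nonzero:
  assumes "n \<ge> 2" "\<sigma> < 1" "\<And>s. s \<in> {0..\<sigma>} \<Longrightarrow> psum (zonal_coeff n \<kappa>) s \<noteq> 0" "s \<in> {0..\<sigma>}"
  shows "psum (zonal_coeff n \<kappa>) s > 0"
proof (rule ccontr)
  assume "\<not> ?thesis"
  then have le: "psum (zonal_coeff n \<kappa>) s \<le> 0" by simp
  have "\<exists>x\<ge>0. x \<le> s \<and> psum (zonal_coeff n \<kappa>) x = 0"
  proof (rule IVT2')
    show "continuous_on {0..s} (psum (zonal_coeff n \<kappa>))"
      using assms(2,4) by (intro continuous_at_imp_continuous_on ballI DERIV_isCont[OF DERIV_psum[OF unit_radius_zonal[OF assms(1)]]]) auto
  qed (use le assms(4) in auto)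
  then show False using assms(3,4) by force
qed

lemma solve_second_order:
  fixes X :: real
  shows "X \<noteq> 0 \<Longrightarrow> X * c + A * b + k * a = 0 \<Longrightarrow> c = - (A / X) * b - k / X * a"
  by (simp add: field_simps)

text \<open>For large \<open>\<kappa>\<close> a solution positive on all of
  \<open>{0..\<sigma>}\<close> would violate the oscillation bound on
  \<open>{\<sigma> / 2..\<sigma>}\<close>, an interval that stays away from the singular points 0
  and 1.\<close>

lemma zonal_has_zero:
  assumes "n \<ge> 2" "0 < \<sigma>" "\<sigma> < 1"
  shows "\<exists>\<kappa>\<ge>0. \<exists>s\<in>{0..\<sigma>}. psum (zonal_coeff n \<kappa>) s = 0"
proof (rule ccontr)
  assume no: "\<not> ?thesis"
  \<comment> \<open>\<open>K\<close> bounds the damping, since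
    \<open>s * (1 - s) \<ge> \<sigma> / 2 * (1 - \<sigma>)\<close> on the interval. \<open>c\<close>
    makes \<open>c\<close> times its length equal to \<open>2 * pi\<close>, and
    \<open>\<kappa>\<close> is the threshold for the potential, which is at least
    \<open>\<kappa>\<close>.\<close>
  define K where "K = (n - 1) / (\<sigma> / 2 * (1 - \<sigma>))"
  define c where "c = 4 * pi / \<sigma>"
  define \<kappa> where "\<kappa> = (c\<^sup>2 + K\<^sup>2) / 2"
  have \<kappa>: "\<kappa> \<ge> 0" unfolding \<kappa>_def by simp
  let ?y = "psum (zonal_coeff n \<kappa>)" and ?y' = "psum (diffs (zonal_coeff n \<kappa>))"
    and ?y'' = "psum (diffs (diffs (zonal_coeff n \<kappa>)))"
  have pos: "?y s > 0" if "s \<in> {0..\<sigma>}" for s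
    using no \<kappa> that by (intro zonal_pos_of_nonzero[OF assms(1,3)]) auto
  note ur = unit_radius_zonal[OF assms(1), of \<kappa>]
  have "c * (\<sigma> - \<sigma> / 2) < 2 * pi"
  proof (rule positive_solution_interval_bound[where y = ?y and y' = ?y' and K = K
        and P = "\<lambda>s. (n - 1) * (1 / 2 - s) / (s * (1 - s))" and Q = "\<lambda>s. \<kappa> / (s * (1 - s))"])
    show "\<sigma> / 2 < \<sigma>" "c > 0" using assms by (auto simp: c_def)
    fix t assume t: "t \<in> {\<sigma> / 2..\<sigma>}"
    have t01: "0 < t" "t < 1" "\<bar>t\<bar> < 1" "t \<in> {0..\<sigma>}" using t assms by auto
    have tt: "0 < t * (1 - t)" using t01 by simp
    show "(?y has_real_derivative ?y' t) (at t)"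
      by (rule DERIV_psum[OF ur t01(3)])
    have "?y'' t = - ((n - 1) * (1 / 2 - t) / (t * (1 - t))) * ?y' t - \<kappa> / (t * (1 - t)) * ?y t"
      by (rule solve_second_order[OF _ zonal_ode[OF assms(1) t01(3), of \<kappa>]]) (use tt in linarith)
    then show "(?y' has_real_derivative - ((n - 1) * (1 / 2 - t) / (t * (1 - t))) * ?y' t - \<kappa> / (t * (1 - t)) * ?y t) (at t)"
      using DERIV_psum[OF unit_radius_diffs[OF ur] t01(3)] by simp
    show "?y t > 0" using pos t01 by blast
    have lb: "\<sigma> / 2 * (1 - \<sigma>) \<le> t * (1 - t)" using t assms by (intro mult_mono) auto
    have "\<bar>(n - 1) * (1 / 2 - t)\<bar> \<le> (n - 1) * 1"
      unfolding abs_mult using assms(1) t01 by (intro mult_mono) auto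
    then show "\<bar>(n - 1) * (1 / 2 - t) / (t * (1 - t))\<bar> \<le> K"
      unfolding K_def abs_divide using lb tt assms by (intro frac_le) auto
    have "t * (1 - t) \<le> 1 * 1" using t01 by (intro mult_mono) auto
    then have "\<kappa> / 1 \<le> \<kappa> / (t * (1 - t))"
      using \<kappa> tt by (intro divide_left_mono) auto
    then show "(c\<^sup>2 + K\<^sup>2) / 2 \<le> \<kappa> / (t * (1 - t))" by (simp add: \<kappa>_def)
  qed
  then show False using assms by (simp add: c_def)
qed

text \<open>\<open>\<kappa>0\<close> is the least first coordinate on the compact set of zeros
  \<open>(\<kappa>, s)\<close>. By continuity from smaller \<open>\<kappa>\<close> the solution for
  \<open>\<kappa>0\<close> is nonnegative. A zero before \<open>\<sigma>\<close> would be a minimum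
  with zero slope, and the self-adjoint form of the equation would make the solution at most 0 all
  the way back to the pole, where its value is 1.\<close>

lemma first_zonal:
  assumes n: "n \<ge> 2" and \<sigma>: "0 < \<sigma>" "\<sigma> < 1"
  obtains \<kappa>0 where "\<kappa>0 > 0" "psum (zonal_coeff n \<kappa>0) \<sigma> = 0"
    "\<And>s. s \<in> {0..<\<sigma>} \<Longrightarrow> psum (zonal_coeff n \<kappa>0) s > 0"
    "\<And>\<kappa> s. 0 \<le> \<kappa> \<Longrightarrow> \<kappa> < \<kappa>0 \<Longrightarrow> s \<in> {0..\<sigma>} \<Longrightarrow> psum (zonal_coeff n \<kappa>) s > 0"
proof -
  let ?H = "\<lambda>\<kappa>. psum (zonal_coeff n \<kappa>)"
  obtain \<Lambda> s\<Lambda> where L: "\<Lambda> \<ge> 0" "s\<Lambda> \<in> {0..\<sigma>}" "?H \<Lambda> s\<Lambda> = 0"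
    using zonal_has_zero[OF n \<sigma>] by blast
  define Z where "Z = {p \<in> {0..\<Lambda>} \<times> {0..\<sigma>}. ?H (fst p) (snd p) = 0}"
  have cont: "continuous_on ({0..\<Lambda>} \<times> {0..\<sigma>}) (\<lambda>p. ?H (fst p) (snd p))"
    using \<sigma> by (intro zonal_continuous n) auto
  have cR: "compact ({0..\<Lambda>} \<times> {0..\<sigma>})" by (intro compact_Times) auto
  have "closed Z"
    unfolding Z_def by (intro continuous_closed_preimage_constant cont compact_imp_closed[OF cR])
  moreover have "Z \<subseteq> {0..\<Lambda>} \<times> {0..\<sigma>}" by (auto simp: Z_def)
  ultimately have cZ: "compact Z"
    using cR by (metis compact_Int_closed inf.absorb_iff2)
  have "(\<Lambda>, s\<Lambda>) \<in> Z" using L by (auto simp: Z_def)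
  then have "\<exists>p\<in>Z. \<forall>q\<in>Z. fst p \<le> fst q"
    by (intro continuous_attains_inf[OF cZ] continuous_intros) auto
  then obtain p where p: "p \<in> Z" "\<And>q. q \<in> Z \<Longrightarrow> fst p \<le> fst q"
    by blast
  define \<kappa>0 where "\<kappa>0 = fst p"
  define s0 where "s0 = snd p"
  have p0: "\<kappa>0 \<in> {0..\<Lambda>}" "s0 \<in> {0..\<sigma>}" "?H \<kappa>0 s0 = 0"
    using p(1) by (auto simp: Z_def \<kappa>0_def s0_def)
  have "\<kappa>0 \<noteq> 0" using p0(3) psum_zonal_0[of n s0] by auto
  then have \<kappa>0: "\<kappa>0 > 0" using p0 by simp
  have "s0 \<noteq> 0" using p0(3) by auto
  then have s0: "s0 > 0" using p0 by simp
  have less: "?H \<kappa> s > 0" if "0 \<le> \<kappa>" "\<kappa> < \<kappa>0" "s \<in> {0..\<sigma>}" for \<kappa> s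
  proof (rule zonal_pos_of_nonzero[OF n \<sigma>(2) _ that(3)])
    fix t assume t: "t \<in> {0..\<sigma>}"
    show "?H \<kappa> t \<noteq> 0"
    proof
      assume "?H \<kappa> t = 0"
      then have "(\<kappa>, t) \<in> Z" using that t p0 by (auto simp: Z_def)
      then show False using p(2)[of "(\<kappa>, t)"] that by (simp add: \<kappa>0_def)
    qed
  qed
  have ge: "?H \<kappa>0 s \<ge> 0" if s: "s \<in> {0..\<sigma>}" for s
  proof -
    have "continuous_on {0..\<kappa>0} (\<lambda>\<kappa>. (\<lambda>p. ?H (fst p) (snd p)) (\<kappa>, s))"
      by (rule continuous_on_compose2[OF cont]) (use p0 s in \<open>auto intro!: continuous_intros\<close>)
    then have "((\<lambda>\<kappa>. ?H \<kappa> s) \<longlongrightarrow> ?H \<kappa>0 s) (at \<kappa>0 within {0..\<kappa>0})"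
      using \<kappa>0 by (simp add: continuous_on_def)
    then have "((\<lambda>\<kappa>. ?H \<kappa> s) \<longlongrightarrow> ?H \<kappa>0 s) (at_left \<kappa>0)"
      using at_within_Icc_at_left[OF \<kappa>0] by simp
    moreover have "\<forall>\<^sub>F \<kappa> in at_left \<kappa>0. 0 \<le> ?H \<kappa> s"
    proof -
      have "\<forall>\<^sub>F \<kappa> in at_left \<kappa>0. \<kappa> \<in> {0<..<\<kappa>0}"
        by (rule eventually_at_left_real[OF \<kappa>0])
      then show ?thesis
        by eventually_elim (use less s in \<open>auto intro: less_imp_le\<close>)
    qed
    ultimately show ?thesis
      by (rule tendsto_lowerbound) simp
  qed
  let ?y = "?H \<kappa>0" and ?y' = "psum (diffs (zonal_coeff n \<kappa>0))" and ?y'' = "psum (diffs (diffs (zonal_coeff n \<kappa>0)))"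
  note ur = unit_radius_zonal[OF n, of \<kappa>0]
  have dy: "(?y has_real_derivative ?y' s) (at s)" "(?y' has_real_derivative ?y'' s) (at s)" if "\<bar>s\<bar> < 1" for s
    using DERIV_psum[OF ur that] DERIV_psum[OF unit_radius_diffs[OF ur] that] by auto
  have nz: "?y s \<noteq> 0" if s: "s \<in> {0..<\<sigma>}" for s
  proof
    assume y0: "?y s = 0"
    then have "s \<noteq> 0" by auto
    then have sp: "0 < s" "s < \<sigma>" using s by auto
    have y'0: "?y' s = 0"
    proof (rule DERIV_local_min)
      show "(?y has_real_derivative ?y' s) (at s)" using dy(1) sp \<sigma> by simp
      show "0 < min s (\<sigma> - s)" using sp by simp
      show "\<forall>t. \<bar>s - t\<bar> < min s (\<sigma> - s) \<longrightarrow> ?y s \<le> ?y t"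
        unfolding y0 by (intro allI impI ge) (auto simp: abs_real_def split: if_splits)
    qed
    \<comment> \<open>The flux of the self-adjoint form: its derivative is
      \<open>- \<kappa>0\<close> times a positive weight times the solution, so \<open>w\<close>
      decreases. As it vanishes at \<open>s\<close>, the slope is nonnegative before
      \<open>s\<close>.\<close>
    define w where "w t = (t * (1 - t)) powr ((n - 1) / 2) * ?y' t" for t
    have wd: "(w has_real_derivative - \<kappa>0 * (t * (1 - t)) powr ((n - 1) / 2) / (t * (1 - t)) * ?y t) (at t)"
      if "0 < t" "t < 1" for t
    proof -
      define P where "P = (t * (1 - t)) powr ((n - 1) / 2)"
      have tt: "t * (1 - t) > 0" using that by simp
      have "((\<lambda>t. t * (1 - t)) has_real_derivative 1 - 2 * t) (at t)"
        by (auto intro!: derivative_eq_intros)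
      from DERIV_fun_powr[OF this tt, of "(n - 1) / 2"]
      have 1: "((\<lambda>t. (t * (1 - t)) powr ((n - 1) / 2)) has_real_derivative
          (n - 1) / 2 * (t * (1 - t)) powr ((n - 1) / 2 - 1) * (1 - 2 * t)) (at t)"
        by simp
      have e: "(t * (1 - t)) powr ((n - 1) / 2 - 1) = P / (t * (1 - t))"
        using tt unfolding P_def by (simp add: powr_diff)
      have t1: "\<bar>t\<bar> < 1" using that by simp
      have "w = (\<lambda>t. (t * (1 - t)) powr ((n - 1) / 2) * ?y' t)" by (simp add: fun_eq_iff w_def)
      moreover have "(n - 1) / 2 * (P / (t * (1 - t))) * (1 - 2 * t) * ?y' t + ?y'' t * P
          = P / (t * (1 - t)) * (t * (1 - t) * ?y'' t + (n - 1) * (1 / 2 - t) * ?y' t)"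
      proof -
        have "(n - 1) / 2 * (P / X) * (1 - 2 * t) * b + c * P = P / X * (X * c + (n - 1) * (1 / 2 - t) * b)"
          if "X > 0" for X b c :: real
          using that by (simp add: field_simps)
        then show ?thesis using tt by blast
      qed
      moreover have "t * (1 - t) * ?y'' t + (n - 1) * (1 / 2 - t) * ?y' t = - \<kappa>0 * ?y t"
        using zonal_ode[OF n t1, of \<kappa>0] by linarith
      ultimately show ?thesis
        using DERIV_mult[OF 1 dy(2)[OF t1]] unfolding e P_def[symmetric] by (simp add: mult_ac)
    qed
    have y'pos: "?y' t \<ge> 0" if t: "0 < t" "t \<le> s" for t
    proof -
      have "w s \<le> w t"
      proof (rule DERIV_nonpos_imp_nonincreasing[OF t(2)])
        fix x assume x: "t \<le> x" "x \<le> s"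
        then have "0 < x" "x < 1" "x \<in> {0..\<sigma>}" using t sp \<sigma> by auto
        moreover have "- \<kappa>0 * (x * (1 - x)) powr ((n - 1) / 2) / (x * (1 - x)) * ?y x \<le> 0"
          using ge[of x] calculation \<kappa>0
          by (simp add: mult_nonneg_nonneg divide_nonneg_pos)
        ultimately show "\<exists>D. (w has_real_derivative D) (at x) \<and> D \<le> 0"
          using wd by blast
      qed
      then have "0 \<le> (t * (1 - t)) powr ((n - 1) / 2) * ?y' t"
        unfolding w_def y'0 by simp
      moreover have "(t * (1 - t)) powr ((n - 1) / 2) > 0"
        using t sp \<sigma> by simp
      ultimately show ?thesis by (simp add: zero_le_mult_iff)
    qed
    have y_le: "?y t \<le> 0" if t: "0 < t" "t \<le> s" for t
    proof -
      have "?y t \<le> ?y s"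
      proof (rule DERIV_nonneg_imp_nondecreasing[OF t(2)])
        fix x assume x: "t \<le> x" "x \<le> s"
        then show "\<exists>D. (?y has_real_derivative D) (at x) \<and> D \<ge> 0"
          using dy(1)[of x] y'pos[of x] t sp \<sigma> by (intro exI[of _ "?y' x"]) auto
      qed
      then show ?thesis using y0 by simp
    qed
    have "(?y \<longlongrightarrow> ?y 0) (at_right 0)"
      using DERIV_isCont[OF dy(1)[of 0]] by (simp add: isCont_def filterlim_at_split)
    then have "\<forall>\<^sub>F t in at_right 0. ?y t > 0"
      by (rule order_tendstoD(1)) simp
    moreover have "\<forall>\<^sub>F t in at_right 0. t \<in> {0<..<s}"
      by (rule eventually_at_right_real[OF sp(1)])
    ultimately have "\<forall>\<^sub>F t in at_right (0::real). False"
      by eventually_elim (use y_le in force)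
    then show False by simp
  qed
  have "s0 = \<sigma>"
  proof (rule ccontr)
    assume "s0 \<noteq> \<sigma>"
    then show False using nz[of s0] p0 by auto
  qed
  then have "?H \<kappa>0 \<sigma> = 0" using p0 by simp
  moreover have "?y s > 0" if "s \<in> {0..<\<sigma>}" for s
    using nz[OF that] ge[of s] that by force
  ultimately show ?thesis
    using that[of \<kappa>0] \<kappa>0 less by blast
qed

section \<open>Functions of radius and polar angle\<close>

text \<open>The gradient of \<open>\<phi> (norm x) * \<psi> (x $ k / norm x)\<close>, when the
  primed functions are the derivatives, sorted by the directions \<open>x\<close> and
  \<open>axis k 1\<close>.\<close>

definition sep_grad ::
  "'n::finite \<Rightarrow> (real \<Rightarrow> real) \<Rightarrow> (real \<Rightarrow> real) \<Rightarrow> (real \<Rightarrow> real) \<Rightarrow> (real \<Rightarrow> real) \<Rightarrow> real ^ 'n \<Rightarrow> real ^ 'n"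
  where "sep_grad k \<phi> \<phi>' \<psi> \<psi>' x = (let r = norm x; t = x $ k / norm x in
      (\<phi>' r * \<psi> t / r - \<phi> r * \<psi>' t * t / r\<^sup>2) *\<^sub>R x + (\<phi> r * \<psi>' t / r) *\<^sub>R axis k 1)"

lemma GDERIV_nth: "GDERIV (\<lambda>x::real ^ 'n::finite. x $ k) x :> axis k 1"
proof -
  have "((\<lambda>x::real ^ 'n. x $ k) has_derivative (\<lambda>x. x $ k)) (at x)"
    by (rule bounded_linear_imp_has_derivative[OF bounded_linear_vec_nth])
  then show ?thesis by (simp add: gderiv_def inner_axis)
qed

lemma GDERIV_sep:
  fixes x :: "real ^ 'n::finite"
  assumes "x \<noteq> 0" "(\<phi> has_real_derivative \<phi>' (norm x)) (at (norm x))"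
    "(\<psi> has_real_derivative \<psi>' (x $ k / norm x)) (at (x $ k / norm x))"
  shows "GDERIV (\<lambda>x. \<phi> (norm x) * \<psi> (x $ k / norm x)) x :> sep_grad k \<phi> \<phi>' \<psi> \<psi>' x"
proof -
  let ?r = "norm x" and ?t = "x $ k / norm x"
  have r: "?r > 0" using assms(1) by simp
  have "GDERIV (\<lambda>x. x $ k * inverse (norm x)) x :>
      x $ k *\<^sub>R (- (inverse ?r)\<^sup>2 *\<^sub>R sgn x) + inverse ?r *\<^sub>R axis k 1"
    by (intro GDERIV_mult GDERIV_nth GDERIV_inverse GDERIV_norm) (use assms(1) in auto)
  then have 1: "GDERIV (\<lambda>x. x $ k / norm x) x :>
      x $ k *\<^sub>R (- (inverse ?r)\<^sup>2 *\<^sub>R sgn x) + inverse ?r *\<^sub>R axis k 1"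
    by (simp add: divide_inverse)
  show ?thesis
    by (rule GDERIV_subst[OF GDERIV_mult[OF GDERIV_DERIV_compose[OF GDERIV_norm[OF assms(1)] assms(2)]
          GDERIV_DERIV_compose[OF 1 assms(3)]]])
       (use r in \<open>simp add: vec_eq_iff sep_grad_def Let_def sgn_div_norm field_simps power2_eq_square\<close>)
qed

text \<open>The angular factor is constant along rays, so only the radial derivative contributes in
  the direction \<open>x\<close>.\<close>

lemma inner_sep_grad:
  assumes "x \<noteq> 0"
  shows "x \<bullet> sep_grad k \<phi> \<phi>' \<psi> \<psi>' x = \<phi>' (norm x) * \<psi> (x $ k / norm x) * norm x"
proof -
  have "norm x > 0" using assms by simp
  moreover have e: "x \<bullet> (a *\<^sub>R x + b *\<^sub>R axis k 1) = a * (norm x)\<^sup>2 + b * x $ k" for a b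
    by (simp add: inner_add_right inner_axis power2_norm_eq_inner)
  ultimately show ?thesis
    unfolding sep_grad_def Let_def e by (simp add: field_simps power2_eq_square)
qed

lemma sep_grad_nth:
  assumes "x \<noteq> 0"
  shows "sep_grad k \<phi> \<phi>' \<psi> \<psi>' x $ k = \<phi>' (norm x) * \<psi> (x $ k / norm x) * (x $ k / norm x)
      + \<phi> (norm x) * \<psi>' (x $ k / norm x) * (1 - (x $ k / norm x)\<^sup>2) / norm x"
proof -
  have "norm x > 0" using assms by simp
  then show ?thesis
    by (simp add: sep_grad_def Let_def axis_def field_simps power2_eq_square)
qed

text \<open>The gradient is \<open>A x + B e\<close> with \<open>e = axis k 1\<close>, where
  \<open>A\<close> is a difference of two separated products and \<open>B\<close> is such a product.
  The same gradient formula therefore differentiates it again, and the Laplacian is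
  \<open>x \<bullet> DA + N * A\<close> plus the component of \<open>DB\<close> along
  \<open>e\<close>.\<close>

lemma separated_laplacian:
  fixes k :: "'n::finite"
  assumes S: "\<And>x::real ^ 'n. x \<in> S \<Longrightarrow> x \<noteq> 0 \<and> norm x \<in> I \<and> x $ k / norm x \<in> T"
    and R: "\<And>r. r \<in> I \<Longrightarrow> (R has_real_derivative R1 r) (at r)" "\<And>r. r \<in> I \<Longrightarrow> (R1 has_real_derivative R2 r) (at r)"
      "continuous_on I R2"
    and g: "\<And>t. t \<in> T \<Longrightarrow> (g has_real_derivative g1 t) (at t)" "\<And>t. t \<in> T \<Longrightarrow> (g1 has_real_derivative g2 t) (at t)"
      "continuous_on T g2"
  obtains G K where "\<And>x. x \<in> S \<Longrightarrow> GDERIV (\<lambda>x. R (norm x) * g (x $ k / norm x)) x :> G x"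
    "\<And>x i. x \<in> S \<Longrightarrow> GDERIV (\<lambda>y. G y $ i) x :> K i x"
    "\<And>i. continuous_on S (K i)"
    "\<And>x. x \<in> S \<Longrightarrow> (\<Sum>i\<in>UNIV. K i x $ i) =
        (R2 (norm x) + (real CARD('n) - 1) / norm x * R1 (norm x)) * g (x $ k / norm x)
        + R (norm x) / (norm x)\<^sup>2 * ((1 - (x $ k / norm x)\<^sup>2) * g2 (x $ k / norm x)
            - (real CARD('n) - 1) * (x $ k / norm x) * g1 (x $ k / norm x))"
proof -
  let ?t = "\<lambda>x. x $ k / norm x"
  define G where "G = sep_grad k R R1 g g1"
  define A where "A x = (R1 (norm x) / norm x) * g (?t x) - (R (norm x) / (norm x)\<^sup>2) * (?t x * g1 (?t x))" for x
  define B where "B x = (R (norm x) / norm x) * g1 (?t x)" for x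
  define DA where "DA x = sep_grad k (\<lambda>r. R1 r / r) (\<lambda>r. R2 r / r - R1 r / r\<^sup>2) g g1 x
      - sep_grad k (\<lambda>r. R r / r\<^sup>2) (\<lambda>r. R1 r / r\<^sup>2 - 2 * R r / r ^ 3) (\<lambda>t. t * g1 t) (\<lambda>t. g1 t + t * g2 t) x" for x
  define DB where "DB = sep_grad k (\<lambda>r. R r / r) (\<lambda>r. R1 r / r - R r / r\<^sup>2) g1 g2"
  define K where "K i x = (x $ i *\<^sub>R DA x + A x *\<^sub>R axis i 1) + (if i = k then DB x else 0)" for i x
  have Gi: "G x $ i = A x * x $ i + (if i = k then B x else 0)" for x i
    by (simp add: G_def sep_grad_def Let_def A_def B_def axis_def algebra_simps)
  have d: "(R has_real_derivative R1 (norm x)) (at (norm x))" "(R1 has_real_derivative R2 (norm x)) (at (norm x))"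
    "(g has_real_derivative g1 (?t x)) (at (?t x))" "(g1 has_real_derivative g2 (?t x)) (at (?t x))" "norm x > 0"
    if "x \<in> S" for x
    using S[OF that] R g by auto
  have gA: "GDERIV A x :> DA x" if "x \<in> S" for x
    unfolding A_def[abs_def] DA_def
  proof (intro GDERIV_diff GDERIV_sep)
    show "((\<lambda>r. R1 r / r) has_real_derivative R2 (norm x) / norm x - R1 (norm x) / (norm x)\<^sup>2) (at (norm x))"
      by (rule DERIV_cong[OF DERIV_divide[OF d(2)[OF that] DERIV_ident]])
         (use d(5)[OF that] in \<open>simp_all add: field_simps power2_eq_square\<close>)
    have p: "((\<lambda>r. r\<^sup>2) has_real_derivative 2 * norm x) (at (norm x))"
      by (auto intro!: derivative_eq_intros)
    show "((\<lambda>r. R r / r\<^sup>2) has_real_derivative R1 (norm x) / (norm x)\<^sup>2 - 2 * R (norm x) / norm x ^ 3) (at (norm x))"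
      by (rule DERIV_cong[OF DERIV_divide[OF d(1)[OF that] p]])
         (use d(5)[OF that] in \<open>simp_all add: field_simps power2_eq_square power3_eq_cube\<close>)
    show "((\<lambda>t. t * g1 t) has_real_derivative g1 (?t x) + ?t x * g2 (?t x)) (at (?t x))"
      by (rule DERIV_cong[OF DERIV_mult[OF DERIV_ident d(4)[OF that]]]) simp
  qed (use d that S in auto)
  have gB: "GDERIV B x :> DB x" if "x \<in> S" for x
    unfolding B_def[abs_def] DB_def
  proof (rule GDERIV_sep)
    show "((\<lambda>r. R r / r) has_real_derivative R1 (norm x) / norm x - R (norm x) / (norm x)\<^sup>2) (at (norm x))"
      by (rule DERIV_cong[OF DERIV_divide[OF d(1)[OF that] DERIV_ident]])
         (use d(5)[OF that] in \<open>simp_all add: field_simps power2_eq_square\<close>)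
  qed (use d that S in auto)
  show ?thesis
  proof (rule that[of G K])
    fix x assume x: "x \<in> S"
    show "GDERIV (\<lambda>x. R (norm x) * g (?t x)) x :> G x"
      unfolding G_def using d[OF x] S[OF x] by (intro GDERIV_sep) auto
    show "GDERIV (\<lambda>y. G y $ i) x :> K i x" for i
    proof (cases "i = k")
      case True
      have "GDERIV (\<lambda>y. A y * y $ i + B y) x :> (A x *\<^sub>R axis i 1 + x $ i *\<^sub>R DA x) + DB x"
        by (intro GDERIV_add GDERIV_mult GDERIV_nth gA gB x)
      then show ?thesis using True by (simp add: Gi K_def add.commute)
    next
      case False
      have "GDERIV (\<lambda>y. A y * y $ i) x :> (A x *\<^sub>R axis i 1 + x $ i *\<^sub>R DA x)"
        by (intro GDERIV_mult GDERIV_nth gA x)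
      then show ?thesis using False by (simp add: Gi K_def add.commute)
    qed
    have x0: "x \<noteq> 0" and r: "norm x > 0" using S[OF x] by auto
    have "(\<Sum>i\<in>UNIV. K i x $ i) = x \<bullet> DA x + real CARD('n) * A x + DB x $ k"
    proof -
      have "K i x $ i = x $ i * DA x $ i + A x + (if i = k then DB x $ k else 0)" for i
        by (simp add: K_def axis_def)
      then show ?thesis by (simp add: sum.distrib inner_vec_def)
    qed
    also have "\<dots> = (R2 (norm x) + (real CARD('n) - 1) / norm x * R1 (norm x)) * g (?t x)
        + R (norm x) / (norm x)\<^sup>2 * ((1 - (?t x)\<^sup>2) * g2 (?t x) - (real CARD('n) - 1) * ?t x * g1 (?t x))"
    proof -
      define r where "r = norm x"
      define t where "t = ?t x"
      define a where "a = R r" define a1 where "a1 = R1 r" define a2 where "a2 = R2 r"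
      define b where "b = g t" define b1 where "b1 = g1 t" define b2 where "b2 = g2 t"
      define N where "N = real CARD('n)"
      have r: "r > 0" using x0 by (simp add: r_def)
      have e1: "x \<bullet> DA x = (a2 / r - a1 / r\<^sup>2) * b * r - (a1 / r\<^sup>2 - 2 * a / r ^ 3) * (t * b1) * r"
        unfolding DA_def inner_diff_right inner_sep_grad[OF x0] r_def t_def a_def a1_def a2_def b_def b1_def by simp
      have e2: "A x = (a1 / r) * b - (a / r\<^sup>2) * (t * b1)"
        unfolding A_def r_def t_def a_def a1_def b_def b1_def by simp
      have e3: "DB x $ k = (a1 / r - a / r\<^sup>2) * b1 * t + (a / r) * b2 * (1 - t\<^sup>2) / r"
        unfolding DB_def sep_grad_nth[OF x0] r_def t_def a_def a1_def b1_def b2_def by simp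
      have "x \<bullet> DA x + N * A x + DB x $ k = (a2 + (N - 1) / r * a1) * b + a / r\<^sup>2 * ((1 - t\<^sup>2) * b2 - (N - 1) * t * b1)"
        unfolding e1 e2 e3 using r by (simp add: field_simps power2_eq_square power3_eq_cube)
      then show ?thesis
        unfolding r_def t_def a_def a1_def a2_def b_def b1_def b2_def N_def .
    qed
    finally show "(\<Sum>i\<in>UNIV. K i x $ i) = (R2 (norm x) + (real CARD('n) - 1) / norm x * R1 (norm x)) * g (?t x)
        + R (norm x) / (norm x)\<^sup>2 * ((1 - (?t x)\<^sup>2) * g2 (?t x) - (real CARD('n) - 1) * ?t x * g1 (?t x))" .
  next
    fix i
    have cn: "continuous_on S norm" by (intro continuous_intros)
    have ct: "continuous_on S ?t" using S by (intro continuous_intros) auto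
    have c: "continuous_on S (\<lambda>x. f (norm x))" if "continuous_on I f" for f :: "real \<Rightarrow> real"
      using S by (intro continuous_on_compose2[OF that cn]) auto
    have c': "continuous_on S (\<lambda>x. f (?t x))" if "continuous_on T f" for f :: "real \<Rightarrow> real"
      using S by (intro continuous_on_compose2[OF that ct]) auto
    have cR: "continuous_on I R" "continuous_on I R1" "continuous_on T g" "continuous_on T g1"
      using R g by (auto intro!: continuous_at_imp_continuous_on DERIV_isCont)
    note cc = c[OF cR(1)] c[OF cR(2)] c[OF R(3)] c'[OF cR(3)] c'[OF cR(4)] c'[OF g(3)] ct cn
    have cA: "continuous_on S A"
      unfolding A_def[abs_def] using S by (intro continuous_intros cc) auto
    have cDA: "continuous_on S DA"
      unfolding DA_def[abs_def] sep_grad_def Let_def using S by (intro continuous_intros cc) auto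
    have cDB: "continuous_on S DB"
      unfolding DB_def sep_grad_def[abs_def] Let_def using S by (intro continuous_intros cc) auto
    show "continuous_on S (K i)"
      unfolding K_def[abs_def] by (cases "i = k") (auto intro!: continuous_intros cA cDA cDB)
  qed
qed

section \<open>The Laplace--Beltrami operator of a radially constant extension\<close>

lemma radial_ext_scale: "c > 0 \<Longrightarrow> radial_ext \<Theta> (c *\<^sub>R x) = radial_ext \<Theta> x"
proof -
  assume "c > 0"
  then have "inverse (norm (c *\<^sub>R x)) * c = inverse (norm x)"
    by (simp add: field_simps)
  then show ?thesis
    by (simp only: radial_ext_def scaleR_scaleR)
qed

text \<open>The chain rule for a dilation: constancy along rays makes the gradient homogeneous of
  degree -1.\<close>

lemma GDERIV_radial_ext_scale:
  assumes "GDERIV (radial_ext \<Theta>) x :> G" "GDERIV (radial_ext \<Theta>) (c *\<^sub>R x) :> G'" "c > 0"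
  shows "c *\<^sub>R G' = G"
proof -
  have "((\<lambda>y. c *\<^sub>R y) has_derivative (\<lambda>h. c *\<^sub>R h)) (at x)"
    by (auto intro!: derivative_eq_intros)
  from has_derivative_compose[OF this assms(2)[unfolded gderiv_def]]
  have "GDERIV (radial_ext \<Theta>) x :> c *\<^sub>R G'"
    using assms(3) by (simp add: gderiv_def radial_ext_scale)
  then show ?thesis using assms(1) GDERIV_imp_grad by metis
qed

lemma GDERIV_radial_ext_inner:
  assumes "GDERIV (radial_ext \<Theta>) x :> G"
  shows "x \<bullet> G = 0"
proof -
  have 1: "((\<lambda>t. radial_ext \<Theta> (x + t *\<^sub>R x)) has_real_derivative (x \<bullet> G)) (at 0)"
    using assms by (intro GDERIV_line) simp
  have "((\<lambda>t. radial_ext \<Theta> (x + t *\<^sub>R x)) has_real_derivative 0) (at 0)"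
  proof (rule has_field_derivative_transform_within_open[OF DERIV_const[of "radial_ext \<Theta> x"], of "{-1<..}"])
    fix t :: real assume "t \<in> {-1<..}"
    then have "radial_ext \<Theta> ((1 + t) *\<^sub>R x) = radial_ext \<Theta> x" by (intro radial_ext_scale) simp
    then show "radial_ext \<Theta> x = radial_ext \<Theta> (x + t *\<^sub>R x)" by (simp add: scaleR_add_left)
  qed auto
  then show ?thesis using 1 DERIV_unique by blast
qed

text \<open>\<open>laplace_beltrami\<close> extends the tangential gradient constantly along rays
  before differentiating it. Since \<open>G\<close> is homogeneous of degree -1, that extension is
  \<open>norm y * G y\<close>; differentiating the factor \<open>norm y\<close> adds only
  \<open>x \<bullet> G x\<close>, which is 0.\<close>

lemma laplace_beltrami_eq_laplacian:
  fixes \<Theta> :: "real ^ 'n::finite \<Rightarrow> real"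
  assumes W: "open W" "\<And>y. y \<in> W \<Longrightarrow> y \<noteq> 0 \<and> y /\<^sub>R norm y \<in> W"
    and G: "\<And>y. y \<in> W \<Longrightarrow> GDERIV (radial_ext \<Theta>) y :> G y"
    and K: "\<And>i. GDERIV (\<lambda>y. G y $ i) x :> K i"
    and x: "x \<in> W" "norm x = 1"
  shows "laplace_beltrami \<Theta> x = (\<Sum>i\<in>UNIV. K i $ i)"
proof -
  have e: "radial_ext (\<lambda>y. sphere_grad \<Theta> y $ i) y = norm y * G y $ i" if "y \<in> W" for y i
  proof -
    have y0: "norm y > 0" using W(2)[OF that] by simp
    have "inverse (norm y) *\<^sub>R G (y /\<^sub>R norm y) = G y"
      using GDERIV_radial_ext_scale[OF G[OF that] G[of "inverse (norm y) *\<^sub>R y"], of] W(2)[OF that] y0 by simp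
    then have "G (y /\<^sub>R norm y) = norm y *\<^sub>R G y"
      using y0 by (metis right_inverse scaleR_one scaleR_scaleR less_irrefl)
    moreover have "sphere_grad \<Theta> (y /\<^sub>R norm y) = G (y /\<^sub>R norm y)"
      unfolding sphere_grad_def using G[of "y /\<^sub>R norm y"] W(2)[OF that] GDERIV_imp_grad by blast
    ultimately show ?thesis by (simp add: radial_ext_def)
  qed
  have x0: "x \<noteq> 0" using x by auto
  have g: "grad (radial_ext (\<lambda>y. sphere_grad \<Theta> y $ i)) x = K i + G x $ i *\<^sub>R x" for i
  proof (rule GDERIV_imp_grad)
    have "GDERIV (\<lambda>y. norm y * G y $ i) x :> norm x *\<^sub>R K i + G x $ i *\<^sub>R sgn x"
      by (intro GDERIV_mult GDERIV_norm K x0)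
    then have "GDERIV (\<lambda>y. norm y * G y $ i) x :> K i + G x $ i *\<^sub>R x"
      using x by (simp add: sgn_div_norm)
    then show "GDERIV (radial_ext (\<lambda>y. sphere_grad \<Theta> y $ i)) x :> K i + G x $ i *\<^sub>R x"
      by (rule GDERIV_cong_open[OF _ W(1) x(1)]) (simp add: e)
  qed
  have "laplace_beltrami \<Theta> x = (\<Sum>i\<in>UNIV. K i $ i + x $ i * G x $ i)"
    unfolding laplace_beltrami_def sphere_div_def sphere_grad_def[of "\<lambda>y. sphere_grad \<Theta> y $ _"] g
    by (simp add: mult.commute)
  also have "\<dots> = (\<Sum>i\<in>UNIV. K i $ i) + x \<bullet> G x"
    by (simp add: sum.distrib inner_vec_def)
  also have "x \<bullet> G x = 0"
    by (rule GDERIV_radial_ext_inner[OF G[OF x(1)]])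
  finally show ?thesis by simp
qed

text \<open>A positive diagonal entry would make the \<open>i\<close>-th component of the gradient
  positive just beyond its zero at \<open>x\<close>, so \<open>D\<close> would grow along that axis.
  The Laplacian is the sum of these entries.\<close>

lemma second_derivative_at_max:
  fixes D :: "real ^ 'n::finite \<Rightarrow> real"
  assumes W: "open W" "x \<in> W"
    and G: "\<And>y. y \<in> W \<Longrightarrow> GDERIV D y :> G y" and K: "GDERIV (\<lambda>y. G y $ i) x :> K"
    and max: "\<And>y. y \<in> W \<Longrightarrow> D y \<le> D x"
  shows "K $ i \<le> 0"
proof (rule ccontr)
  assume "\<not> K $ i \<le> 0"
  then have Kpos: "K $ i > 0" by simp
  let ?e = "axis i (1::real) :: real ^ 'n"
  obtain d where d: "d > 0" "ball x d \<subseteq> W" using W open_contains_ball by blast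
  have inW: "x + t *\<^sub>R ?e \<in> W" if "\<bar>t\<bar> < d" for t
    using that d by (auto simp: dist_norm subset_iff)
  define p where "p t = D (x + t *\<^sub>R ?e)" for t
  have p: "(p has_real_derivative G (x + t *\<^sub>R ?e) $ i) (at t)" if "\<bar>t\<bar> < d" for t
    unfolding p_def using GDERIV_line[OF G[OF inW[OF that]]] by (simp add: inner_axis')
  have G0: "G x $ i = 0"
  proof -
    have "(p has_real_derivative G x $ i) (at 0)" using p[of 0] d by simp
    then show ?thesis
      by (rule DERIV_local_max[of _ _ _ d]) (use d max[OF inW] in \<open>auto simp: p_def\<close>)
  qed
  have q: "((\<lambda>t. G (x + t *\<^sub>R ?e) $ i) has_real_derivative K $ i) (at 0)"
    using GDERIV_line[of "\<lambda>y. G y $ i" x 0 ?e K] K by (simp add: inner_axis')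
  from DERIV_pos_inc_right[OF q Kpos] obtain d' where
    d': "d' > 0" "\<And>h. 0 < h \<Longrightarrow> h < d' \<Longrightarrow> G (x + h *\<^sub>R ?e) $ i > 0"
    using G0 by auto
  define h where "h = min d d' / 2"
  have h: "0 < h" "h < d" "h < d'" using d d' by (auto simp: h_def min_def)
  have "p 0 < p h"
  proof -
    have "\<exists>z>0. z < h \<and> p h - p 0 = (h - 0) * G (x + z *\<^sub>R ?e) $ i"
      using h by (intro MVT2 p) auto
    then obtain z where "0 < z" "z < h" "p h - p 0 = h * G (x + z *\<^sub>R ?e) $ i" by auto
    then show ?thesis using d'(2)[of z] h by (smt (verit) mult_pos_pos)
  qed
  moreover have "p h \<le> p 0" using max[OF inW, of h] h by (simp add: p_def)
  ultimately show False by simp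
qed

section \<open>The least characteristic exponent\<close>

text \<open>\<open>t\<close> is the cosine of the polar angle. The centre \<open>s = 0\<close> of
  the series is the pole \<open>t = 1\<close>, and the disc of convergence becomes
  \<open>-1 < t < 3\<close>, so the function is smooth across the pole.\<close>

definition zonal :: "real \<Rightarrow> real \<Rightarrow> real \<Rightarrow> real" where
  "zonal n \<kappa> t = psum (zonal_coeff n \<kappa>) ((1 - t) / 2)"

definition zonal1 :: "real \<Rightarrow> real \<Rightarrow> real \<Rightarrow> real" where
  "zonal1 n \<kappa> t = - psum (diffs (zonal_coeff n \<kappa>)) ((1 - t) / 2) / 2"

definition zonal2 :: "real \<Rightarrow> real \<Rightarrow> real \<Rightarrow> real" where
  "zonal2 n \<kappa> t = psum (diffs (diffs (zonal_coeff n \<kappa>))) ((1 - t) / 2) / 4"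

lemma DERIV_psum_half:
  assumes "unit_radius c" "t \<in> {-1<..<3}"
  shows "((\<lambda>t. psum c ((1 - t) / 2)) has_real_derivative - psum (diffs c) ((1 - t) / 2) / 2) (at t)"
proof -
  have "\<bar>(1 - t) / 2\<bar> < 1" using assms(2) by (auto simp: abs_real_def)
  then have "((\<lambda>t. psum c ((1 - t) / 2)) has_real_derivative psum (diffs c) ((1 - t) / 2) * (- 1 / 2)) (at t)"
    by (intro DERIV_chain2[OF DERIV_psum[OF assms(1)]]) (auto intro!: derivative_eq_intros)
  then show ?thesis by simp
qed

lemma DERIV_zonal:
  assumes "n \<ge> 2" "t \<in> {-1<..<3}"
  shows "(zonal n \<kappa> has_real_derivative zonal1 n \<kappa> t) (at t)"
    "(zonal1 n \<kappa> has_real_derivative zonal2 n \<kappa> t) (at t)"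
    "isCont (zonal2 n \<kappa>) t"
proof -
  note u = unit_radius_zonal[OF assms(1), of \<kappa>]
  note u1 = unit_radius_diffs[OF u]
  note u2 = unit_radius_diffs[OF u1]
  show "(zonal n \<kappa> has_real_derivative zonal1 n \<kappa> t) (at t)"
    unfolding zonal_def[abs_def] zonal1_def by (rule DERIV_psum_half[OF u assms(2)])
  show "(zonal1 n \<kappa> has_real_derivative zonal2 n \<kappa> t) (at t)"
    unfolding zonal1_def[abs_def] zonal2_def
    by (rule DERIV_cong[OF DERIV_cdivide[OF DERIV_minus[OF DERIV_psum_half[OF u1 assms(2)]]]]) simp
  show "isCont (zonal2 n \<kappa>) t"
    unfolding zonal2_def[abs_def]
    by (rule DERIV_isCont[OF DERIV_cdivide[OF DERIV_psum_half[OF u2 assms(2)]]])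
qed

lemma zonal_continuous_on: "n \<ge> 2 \<Longrightarrow> T \<subseteq> {-1<..<3} \<Longrightarrow> continuous_on T (zonal n \<kappa>)"
  using DERIV_zonal(1) by (intro continuous_at_imp_continuous_on) (blast intro: DERIV_isCont)

lemma zonal_equation:
  assumes "n \<ge> 2" "t \<in> {-1<..<3}"
  shows "(1 - t\<^sup>2) * zonal2 n \<kappa> t - (n - 1) * t * zonal1 n \<kappa> t = - \<kappa> * zonal n \<kappa> t"
proof -
  have s: "\<bar>(1 - t) / 2\<bar> < 1" using assms(2) by (auto simp: abs_real_def)
  have "(1 - t\<^sup>2) * (y2 / 4) - (n - 1) * t * (- y1 / 2) = - \<kappa> * y"
    if "(1 - t) / 2 * (1 - (1 - t) / 2) * y2 + (n - 1) * (1 / 2 - (1 - t) / 2) * y1 + \<kappa> * y = 0" for y y1 y2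
    using that by (simp add: field_simps power2_eq_square)
  from this[OF zonal_ode[OF assms(1) s]] show ?thesis
    unfolding zonal_def zonal1_def zonal2_def .
qed

lemma zonal_1 [simp]: "zonal n \<kappa> 1 = 1"
  by (simp add: zonal_def)

locale spherical_cone =
  fixes k :: "'n::finite" and \<beta> :: real
  assumes dim: "2 \<le> CARD('n)" and \<beta>: "0 < \<beta>" "\<beta> < pi"
begin

lemma N2: "real CARD('n) \<ge> 2" using dim by simp

lemma cos_bounds: "-1 < cos \<beta>" "cos \<beta> < 1"
  using cos_monotone_0_pi[of \<beta> pi] cos_monotone_0_pi[of 0 \<beta>] \<beta> by auto

definition sphere_eigval :: "real \<Rightarrow> real" where "sphere_eigval l = l * (l + real CARD('n) - 2)"

lemma sphere_eigval_strict_mono: "0 < l \<Longrightarrow> l < l' \<Longrightarrow> sphere_eigval l < sphere_eigval l'"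
  unfolding sphere_eigval_def using N2 by (intro mult_strict_mono) auto

lemma norm_nth_le: "\<bar>x $ k\<bar> \<le> norm (x :: real ^ 'n)"
  by (rule component_le_norm_cart)

lemma angle_bounds: "x \<noteq> 0 \<Longrightarrow> \<bar>x $ k / norm (x :: real ^ 'n)\<bar> \<le> 1"
  using norm_nth_le[of x] by (simp add: abs_divide divide_le_eq)

section \<open>The cap as a subset of the sphere, and zonal solutions on it\<close>

abbreviation "S \<equiv> top_of_set (sphere (0 :: real ^ 'n) 1)"

text \<open>Together with \<open>open_cap_subset\<close> this squeezes the cap between the strict
  and the weak inequality, so the closure in its definition never has to be computed.\<close>

lemma cap_subset: "cap k \<beta> \<subseteq> {x. norm x = 1 \<and> cos \<beta> \<le> x $ k}"
proof -
  have "closure (sph_cone k \<beta>) \<subseteq> {x. norm x * cos \<beta> \<le> x $ k}"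
  proof (rule closure_minimal)
    show "closed {x::real^'n. norm x * cos \<beta> \<le> x $ k}"
      by (intro closed_Collect_le continuous_intros)
  qed (auto simp: sph_cone_def)
  then show ?thesis unfolding cap_def by auto
qed

lemma open_cap_subset: "{x. norm x = 1 \<and> cos \<beta> < x $ k} \<subseteq> cap k \<beta>"
proof safe
  fix x :: "real ^ 'n" assume x: "norm x = 1" "cos \<beta> < x $ k"
  have "x \<in> closure (sph_cone k \<beta>)"
  proof (rule closure_sequential[THEN iffD2], intro exI conjI allI)
    show "(1 - inverse (real (Suc (Suc n)))) *\<^sub>R x \<in> sph_cone k \<beta>" for n
    proof -
      have "inverse (real (Suc (Suc n))) > 0" "inverse (real (Suc (Suc n))) < 1"
        by (auto simp: inverse_less_1_iff)
      moreover have "x \<noteq> 0" using x by auto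
      ultimately show ?thesis using x by (simp add: sph_cone_def)
    qed
    have "(\<lambda>n. (1 - inverse (real (Suc (Suc n)))) *\<^sub>R x) \<longlonglongrightarrow> (1 - 0) *\<^sub>R x"
      by (intro tendsto_intros LIMSEQ_Suc[OF LIMSEQ_inverse_real_of_nat])
    then show "(\<lambda>n. (1 - inverse (real (Suc (Suc n)))) *\<^sub>R x) \<longlonglongrightarrow> x" by simp
  qed
  then show "x \<in> cap k \<beta>" using x by (simp add: cap_def)
qed

lemma cap_compact: "compact (cap k \<beta>)"
  unfolding cap_def by (intro closed_Int_compact) auto

lemma interior_cap:
  "{x. norm x = 1 \<and> cos \<beta> < x $ k} \<subseteq> S interior_of cap k \<beta>"
  "S interior_of cap k \<beta> \<subseteq> cap k \<beta>"
  "openin S (S interior_of cap k \<beta>)"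
proof -
  have "openin S ({x. cos \<beta> < x $ k} \<inter> sphere 0 1)"
    unfolding openin_open
    by (intro exI[of _ "{x. cos \<beta> < x $ k}"] conjI open_Collect_less continuous_intros) auto
  moreover have "{x. cos \<beta> < x $ k} \<inter> sphere 0 1 = {x. norm x = 1 \<and> cos \<beta> < x $ k}" by auto
  ultimately show "{x. norm x = 1 \<and> cos \<beta> < x $ k} \<subseteq> S interior_of cap k \<beta>"
    using open_cap_subset interior_of_maximal by metis
qed (auto simp: interior_of_subset openin_interior_of)

lemma frontier_cap:
  assumes "x \<in> S frontier_of cap k \<beta>"
  shows "x \<in> cap k \<beta>" "x $ k = cos \<beta>"
proof -
  have "closedin S (cap k \<beta>)"
    unfolding closedin_closed
    by (intro exI[of _ "cap k \<beta>"]) (use cap_subset compact_imp_closed[OF cap_compact] in auto)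
  then have "S frontier_of cap k \<beta> \<subseteq> cap k \<beta>" by (rule frontier_of_subset_closedin)
  then show x: "x \<in> cap k \<beta>" using assms by blast
  have "x \<notin> S interior_of cap k \<beta>" using assms by (simp add: frontier_of_def)
  then show "x $ k = cos \<beta>" using interior_cap(1) cap_subset x by force
qed

lemma cap_interior_or_frontier:
  assumes "x \<in> cap k \<beta>" "x \<notin> S interior_of cap k \<beta>"
  shows "x \<in> S frontier_of cap k \<beta>"
proof -
  have "cap k \<beta> \<subseteq> topspace S" using cap_subset by auto
  then have "cap k \<beta> \<subseteq> S closure_of cap k \<beta>" by (rule closure_of_subset)
  then show ?thesis using assms by (auto simp: frontier_of_def)
qed

definition rays :: "(real ^ 'n) set" where
  "rays = {y. y \<noteq> 0 \<and> y /\<^sub>R norm y \<in> S interior_of cap k \<beta>}"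

lemma rays: "open rays" "\<And>y. y \<in> rays \<Longrightarrow> y \<noteq> 0 \<and> y /\<^sub>R norm y \<in> rays"
  "\<And>y. y \<in> rays \<Longrightarrow> y $ k / norm y \<in> {-1<..<3}"
  "\<And>x. x \<in> S interior_of cap k \<beta> \<Longrightarrow> x \<in> rays \<and> norm x = 1"
proof -
  obtain U where U: "open U" "S interior_of cap k \<beta> = sphere 0 1 \<inter> U"
    using interior_cap(3) unfolding openin_open by auto
  have "open (- {0} \<inter> (\<lambda>y::real^'n. y /\<^sub>R norm y) -` U)"
    by (intro continuous_open_preimage continuous_intros U) auto
  moreover have "rays = - {0} \<inter> (\<lambda>y. y /\<^sub>R norm y) -` U"
    unfolding rays_def U by auto
  ultimately show "open rays" by simp
  show "y \<noteq> 0 \<and> y /\<^sub>R norm y \<in> rays" if "y \<in> rays" for y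
    using that unfolding rays_def by auto
  show "y $ k / norm y \<in> {-1<..<3}" if "y \<in> rays" for y
  proof -
    have "y /\<^sub>R norm y \<in> cap k \<beta>" "y \<noteq> 0" using that interior_cap(2) unfolding rays_def by auto
    then have "cos \<beta> \<le> y $ k / norm y" "y $ k / norm y \<le> 1"
      using cap_subset abs_le_D1[OF angle_bounds[of y]] by (auto simp: divide_inverse mult.commute)
    then show ?thesis using cos_bounds by auto
  qed
  show "x \<in> rays \<and> norm x = 1" if "x \<in> S interior_of cap k \<beta>" for x
  proof -
    have "norm x = 1" using that interior_cap(2) cap_subset by blast
    then show ?thesis using that unfolding rays_def by auto
  qed
qed

definition zonal_fun :: "real \<Rightarrow> real ^ 'n \<Rightarrow> real" where
  "zonal_fun \<kappa> x = zonal (real CARD('n)) \<kappa> (x $ k)"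

text \<open>With radial factor 1, \<open>separated_laplacian\<close> leaves only the angular
  operator, and on the unit sphere that is the left-hand side of
  \<open>zonal_equation\<close>.\<close>

lemma zonal_fun_calculus:
  obtains G K where "\<And>y. y \<in> rays \<Longrightarrow> GDERIV (radial_ext (zonal_fun \<kappa>)) y :> G y"
    "\<And>y i. y \<in> rays \<Longrightarrow> GDERIV (\<lambda>y. G y $ i) y :> K i y"
    "\<And>i. continuous_on rays (K i)"
    "\<And>x. x \<in> S interior_of cap k \<beta> \<Longrightarrow> (\<Sum>i\<in>UNIV. K i x $ i) = - \<kappa> * zonal_fun \<kappa> x"
proof -
  have e: "radial_ext (zonal_fun \<kappa>) = (\<lambda>x. (\<lambda>r. 1) (norm x) * zonal (real CARD('n)) \<kappa> (x $ k / norm x))"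
    by (simp add: fun_eq_iff radial_ext_def zonal_fun_def divide_inverse mult.commute)
  obtain G K where GK: "\<And>y. y \<in> rays \<Longrightarrow> GDERIV (\<lambda>x. (\<lambda>r. 1) (norm x) * zonal (real CARD('n)) \<kappa> (x $ k / norm x)) y :> G y"
    "\<And>y i. y \<in> rays \<Longrightarrow> GDERIV (\<lambda>y. G y $ i) y :> K i y"
    "\<And>i. continuous_on rays (K i)"
    "\<And>x. x \<in> rays \<Longrightarrow> (\<Sum>i\<in>UNIV. K i x $ i) = ((\<lambda>r. 0) (norm x) + (real CARD('n) - 1) / norm x * (\<lambda>r. 0) (norm x)) * zonal (real CARD('n)) \<kappa> (x $ k / norm x)
        + (\<lambda>r. 1) (norm x) / (norm x)\<^sup>2 * ((1 - (x $ k / norm x)\<^sup>2) * zonal2 (real CARD('n)) \<kappa> (x $ k / norm x)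
            - (real CARD('n) - 1) * (x $ k / norm x) * zonal1 (real CARD('n)) \<kappa> (x $ k / norm x))"
  proof (rule separated_laplacian[where S = rays and I = "{0<..}" and T = "{-1<..<3}" and k = k
        and R = "\<lambda>r. 1" and ?R1.0 = "\<lambda>r. 0" and ?R2.0 = "\<lambda>r. 0"
        and g = "zonal (real CARD('n)) \<kappa>" and ?g1.0 = "zonal1 (real CARD('n)) \<kappa>" and ?g2.0 = "zonal2 (real CARD('n)) \<kappa>"])
    show "x \<noteq> 0 \<and> norm x \<in> {0<..} \<and> x $ k / norm x \<in> {- 1<..<3}" if "x \<in> rays" for x
      using rays(2,3)[OF that] by auto
    show "continuous_on {- 1<..<3} (zonal2 (real CARD('n)) \<kappa>)"
      using DERIV_zonal(3)[OF N2] by (intro continuous_at_imp_continuous_on) blast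
  qed (auto intro: DERIV_zonal[OF N2])
  show ?thesis
  proof (rule that[of G K])
    show "GDERIV (radial_ext (zonal_fun \<kappa>)) y :> G y" if "y \<in> rays" for y
      using GK(1)[OF that] unfolding e .
    show "(\<Sum>i\<in>UNIV. K i x $ i) = - \<kappa> * zonal_fun \<kappa> x" if "x \<in> S interior_of cap k \<beta>" for x
    proof -
      have x: "x \<in> rays" "norm x = 1" using rays(4)[OF that] by auto
      show ?thesis
        using GK(4)[OF x(1)] zonal_equation[OF N2 rays(3)[OF x(1)], of \<kappa>] x(2) by (simp add: zonal_fun_def)
    qed
  qed (use GK in auto)
qed

lemma cap_solution_zonal:
  assumes "zonal (real CARD('n)) (sphere_eigval l) (cos \<beta>) = 0"
  shows "cap_solution k \<beta> l (zonal_fun (sphere_eigval l))"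
proof -
  let ?\<kappa> = "sphere_eigval l"
  obtain G K where GK: "\<And>y. y \<in> rays \<Longrightarrow> GDERIV (radial_ext (zonal_fun ?\<kappa>)) y :> G y"
    "\<And>y i. y \<in> rays \<Longrightarrow> GDERIV (\<lambda>y. G y $ i) y :> K i y"
    "\<And>i. continuous_on rays (K i)"
    "\<And>x. x \<in> S interior_of cap k \<beta> \<Longrightarrow> (\<Sum>i\<in>UNIV. K i x $ i) = - ?\<kappa> * zonal_fun ?\<kappa> x"
    using zonal_fun_calculus by blast
  have grad: "grad (radial_ext (zonal_fun ?\<kappa>)) y = G y" if "y \<in> rays" for y
    using GK(1)[OF that] GDERIV_imp_grad by blast
  have grad2: "GDERIV (\<lambda>y. grad (radial_ext (zonal_fun ?\<kappa>)) y $ i) y :> K i y" if "y \<in> rays" for y i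
    by (rule GDERIV_cong_open[OF GK(2)[OF that] rays(1) that]) (simp add: grad)
  have C2: "C2_on rays (radial_ext (zonal_fun ?\<kappa>))"
    unfolding C2_on_def
  proof (intro conjI ballI allI)
    show "radial_ext (zonal_fun ?\<kappa>) differentiable at x" if "x \<in> rays" for x
      using GK(1)[OF that] by (rule GDERIV_imp_differentiable)
    show "(\<lambda>y. grad (radial_ext (zonal_fun ?\<kappa>)) y $ i) differentiable at x" if "x \<in> rays" for x i
      using grad2[OF that] by (rule GDERIV_imp_differentiable)
    show "continuous_on rays (grad (\<lambda>y. grad (radial_ext (zonal_fun ?\<kappa>)) y $ i))" for i
      by (rule continuous_on_cong[THEN iffD2, OF refl _ GK(3)[of i]])
         (use grad2 GDERIV_imp_grad in blast)
  qed
  have "continuous_on (cap k \<beta>) (zonal_fun ?\<kappa>)"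
    unfolding zonal_fun_def[abs_def]
  proof (rule continuous_on_compose2[OF zonal_continuous_on[OF N2 order_refl]])
    show "continuous_on (cap k \<beta>) (\<lambda>x. x $ k)" by (intro continuous_intros)
    show "(\<lambda>x. x $ k) ` cap k \<beta> \<subseteq> {- 1<..<3}"
    proof safe
      fix x assume "x \<in> cap k \<beta>"
      then have "norm x = 1" "cos \<beta> \<le> x $ k" using cap_subset by auto
      then show "x $ k \<in> {- 1<..<3}" using cos_bounds norm_nth_le[of x] by auto
    qed
  qed
  moreover have "- laplace_beltrami (zonal_fun ?\<kappa>) x = l * (l + real CARD('n) - 2) * zonal_fun ?\<kappa> x"
    if "x \<in> S interior_of cap k \<beta>" for x
  proof -
    have x: "x \<in> rays" "norm x = 1" using rays(4)[OF that] by auto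
    have "laplace_beltrami (zonal_fun ?\<kappa>) x = (\<Sum>i\<in>UNIV. K i x $ i)"
      by (rule laplace_beltrami_eq_laplacian[OF rays(1,2) GK(1) GK(2)[OF x(1)] x])
    then show ?thesis using GK(4)[OF that] by (simp add: sphere_eigval_def)
  qed
  moreover have "zonal_fun ?\<kappa> x = 0" if "x \<in> S frontier_of cap k \<beta>" for x
    using frontier_cap(2)[OF that] assms by (simp add: zonal_fun_def)
  ultimately show ?thesis
    unfolding cap_solution_def Let_def sphere_C2_on_def using C2 unfolding rays_def by auto
qed

text \<open>Comparison with a strictly positive solution \<open>\<psi>\<close> for a larger eigenvalue \<open>\<kappa>\<close>: at a positive
  maximum of \<open>\<sigma> \<Theta> / \<psi>\<close> the Laplacian of \<open>\<sigma> \<Theta> - M \<psi>\<close> would be positive.\<close>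

lemma cap_solution_sign:
  assumes sol: "cap_solution k \<beta> l \<Theta>" and \<kappa>: "sphere_eigval l < \<kappa>"
    and pos: "\<And>t. t \<in> {cos \<beta>..1} \<Longrightarrow> zonal (real CARD('n)) \<kappa> t > 0"
    and x0: "x0 \<in> cap k \<beta>"
  shows "\<sigma> * \<Theta> x0 \<le> 0"
proof (rule ccontr)
  assume neg: "\<not> \<sigma> * \<Theta> x0 \<le> 0"
  let ?\<psi> = "zonal_fun \<kappa>"
  have cont: "continuous_on (cap k \<beta>) \<Theta>" and C2: "C2_on rays (radial_ext \<Theta>)"
    and eq: "\<And>x. x \<in> S interior_of cap k \<beta> \<Longrightarrow> - laplace_beltrami \<Theta> x = sphere_eigval l * \<Theta> x"
    and bd: "\<And>x. x \<in> S frontier_of cap k \<beta> \<Longrightarrow> \<Theta> x = 0"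
    using sol unfolding cap_solution_def Let_def sphere_C2_on_def rays_def sphere_eigval_def by auto
  have capk: "x $ k \<in> {cos \<beta>..1}" if "x \<in> cap k \<beta>" for x
  proof -
    have "norm x = 1" "cos \<beta> \<le> x $ k" using that cap_subset by auto
    then show ?thesis using norm_nth_le[of x] by auto
  qed
  have \<psi>pos: "?\<psi> x > 0" if "x \<in> cap k \<beta>" for x
    using pos capk[OF that] by (simp add: zonal_fun_def)
  have c\<psi>: "continuous_on (cap k \<beta>) ?\<psi>"
    unfolding zonal_fun_def[abs_def]
  proof (rule continuous_on_compose2[OF zonal_continuous_on[OF N2 order_refl]])
    show "continuous_on (cap k \<beta>) (\<lambda>x. x $ k)" by (intro continuous_intros)
    show "(\<lambda>x. x $ k) ` cap k \<beta> \<subseteq> {- 1<..<3}" using capk cos_bounds by force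
  qed
  have "continuous_on (cap k \<beta>) (\<lambda>x. \<sigma> * \<Theta> x / ?\<psi> x)"
    by (intro continuous_intros cont c\<psi>) (use \<psi>pos in force)
  then obtain x where x: "x \<in> cap k \<beta>" "\<And>y. y \<in> cap k \<beta> \<Longrightarrow> \<sigma> * \<Theta> y / ?\<psi> y \<le> \<sigma> * \<Theta> x / ?\<psi> x"
    using continuous_attains_sup[OF cap_compact] x0 by blast
  define M where "M = \<sigma> * \<Theta> x / ?\<psi> x"
  have "M > 0"
  proof -
    have "0 < \<sigma> * \<Theta> x0 / ?\<psi> x0" using neg \<psi>pos[OF x0] by simp
    then show ?thesis using x(2)[OF x0] by (simp add: M_def)
  qed
  have Mx: "\<sigma> * \<Theta> x = M * ?\<psi> x" using \<psi>pos[OF x(1)] by (simp add: M_def)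
  have le: "\<sigma> * \<Theta> y \<le> M * ?\<psi> y" if "y \<in> cap k \<beta>" for y
    using x(2)[OF that] \<psi>pos[OF that] unfolding M_def[symmetric] by (simp add: divide_le_eq)
  have int: "x \<in> S interior_of cap k \<beta>"
  proof (rule ccontr)
    assume "x \<notin> S interior_of cap k \<beta>"
    then have "\<Theta> x = 0" using bd cap_interior_or_frontier x(1) by blast
    then show False using Mx \<open>M > 0\<close> \<psi>pos[OF x(1)] by simp
  qed
  have xr: "x \<in> rays" "norm x = 1" using rays(4)[OF int] by auto
  let ?F = "radial_ext \<Theta>"
  define G1 where "G1 = grad ?F"
  define K1 where "K1 i = grad (\<lambda>y. G1 y $ i)" for i
  have G1: "GDERIV ?F y :> G1 y" "GDERIV (\<lambda>y. G1 y $ i) y :> K1 i y" if "y \<in> rays" for y i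
    using C2 that unfolding C2_on_def G1_def K1_def by (auto intro: differentiable_imp_GDERIV)
  obtain G2 K2 where G2: "\<And>y. y \<in> rays \<Longrightarrow> GDERIV (radial_ext ?\<psi>) y :> G2 y"
    "\<And>y i. y \<in> rays \<Longrightarrow> GDERIV (\<lambda>y. G2 y $ i) y :> K2 i y"
    "\<And>i. continuous_on rays (K2 i)"
    "\<And>x. x \<in> S interior_of cap k \<beta> \<Longrightarrow> (\<Sum>i\<in>UNIV. K2 i x $ i) = - \<kappa> * ?\<psi> x"
    using zonal_fun_calculus by blast
  \<comment> \<open>Both functions are extended constantly along rays, so touching at
    \<open>x\<close> becomes a maximum over the open set \<open>rays\<close> of the full
    space.\<close>
  define D where "D y = \<sigma> * ?F y - M * radial_ext ?\<psi> y" for y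
  define GD where "GD y = \<sigma> *\<^sub>R G1 y - M *\<^sub>R G2 y" for y
  have cm: "GDERIV (\<lambda>y. c * f y) y :> c *\<^sub>R g" if "GDERIV f y :> g" for c f g and y :: "real ^ 'n"
    using GDERIV_mult[OF GDERIV_const that, of c] by simp
  have gD: "GDERIV D y :> GD y" if "y \<in> rays" for y
    unfolding D_def[abs_def] GD_def by (intro GDERIV_diff cm G1 G2 that)
  have gD2: "GDERIV (\<lambda>y. GD y $ i) x :> \<sigma> *\<^sub>R K1 i x - M *\<^sub>R K2 i x" for i
    unfolding GD_def by (simp, intro GDERIV_diff cm G1 G2 xr)
  have Dmax: "D y \<le> D x" if "y \<in> rays" for y
  proof -
    have "y /\<^sub>R norm y \<in> cap k \<beta>" using that interior_cap(2) unfolding rays_def by auto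
    from le[OF this] have "D y \<le> 0" by (simp add: D_def radial_ext_def)
    moreover have "D x = 0" using Mx xr(2) by (simp add: D_def radial_ext_def)
    ultimately show ?thesis by simp
  qed
  have "(\<sigma> *\<^sub>R K1 i x - M *\<^sub>R K2 i x) $ i \<le> 0" for i
    by (rule second_derivative_at_max[OF rays(1) xr(1) gD gD2 Dmax])
  then have "(\<Sum>i\<in>UNIV. (\<sigma> *\<^sub>R K1 i x - M *\<^sub>R K2 i x) $ i) \<le> 0"
    by (intro sum_nonpos) auto
  then have "\<sigma> * (\<Sum>i\<in>UNIV. K1 i x $ i) - M * (\<Sum>i\<in>UNIV. K2 i x $ i) \<le> 0"
    by (simp add: sum_subtractf sum_distrib_left)
  moreover have "(\<Sum>i\<in>UNIV. K1 i x $ i) = - sphere_eigval l * \<Theta> x"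
    using laplace_beltrami_eq_laplacian[OF rays(1,2) G1(1) G1(2)[OF xr(1)] xr] eq[OF int] by simp
  ultimately have "M * (\<kappa> * ?\<psi> x) \<le> sphere_eigval l * (\<sigma> * \<Theta> x)"
    using G2(4)[OF int] by (simp add: mult_ac)
  then have "(M * ?\<psi> x) * \<kappa> \<le> (M * ?\<psi> x) * sphere_eigval l"
    unfolding Mx by (simp add: mult_ac)
  then show False using \<kappa> \<open>M > 0\<close> \<psi>pos[OF x(1)] by simp
qed

lemma least_exponent:
  obtains l where "l > 0" "l \<in> cone_exponents k \<beta>" "least_exponent k \<beta> = l"
    "zonal (real CARD('n)) (sphere_eigval l) (cos \<beta>) = 0" "\<And>t. cos \<beta> < t \<Longrightarrow> t \<le> 1 \<Longrightarrow> zonal (real CARD('n)) (sphere_eigval l) t > 0"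
proof -
  define \<sigma> where "\<sigma> = (1 - cos \<beta>) / 2"
  have \<sigma>: "0 < \<sigma>" "\<sigma> < 1" using cos_bounds by (auto simp: \<sigma>_def)
  obtain \<kappa>0 where \<kappa>0: "\<kappa>0 > 0" "psum (zonal_coeff (real CARD('n)) \<kappa>0) \<sigma> = 0"
    "\<And>s. s \<in> {0..<\<sigma>} \<Longrightarrow> psum (zonal_coeff (real CARD('n)) \<kappa>0) s > 0"
    "\<And>\<kappa> s. 0 \<le> \<kappa> \<Longrightarrow> \<kappa> < \<kappa>0 \<Longrightarrow> s \<in> {0..\<sigma>} \<Longrightarrow> psum (zonal_coeff (real CARD('n)) \<kappa>) s > 0"
    using first_zonal[OF N2 \<sigma>] by blast
  \<comment> \<open>The discriminant of \<open>l * (l + N - 2) = \<kappa>0\<close>; \<open>l\<close>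
    is the positive root.\<close>
  define D where "D = (real CARD('n) - 2)\<^sup>2 + 4 * \<kappa>0"
  define l where "l = (sqrt D - (real CARD('n) - 2)) / 2"
  have D: "D > (real CARD('n) - 2)\<^sup>2" using \<kappa>0 by (simp add: D_def)
  then have "sqrt D > real CARD('n) - 2" using N2 by (metis real_less_rsqrt)
  then have l: "l > 0" by (simp add: l_def)
  have eig: "sphere_eigval l = \<kappa>0"
  proof -
    have "l * (l + real CARD('n) - 2) = ((sqrt D)\<^sup>2 - (real CARD('n) - 2)\<^sup>2) / 4"
      unfolding l_def by (simp add: field_simps power2_eq_square)
    also have "(sqrt D)\<^sup>2 = D" using D by (intro real_sqrt_pow2) (smt (verit) zero_le_power2)
    finally show ?thesis by (simp add: sphere_eigval_def D_def)
  qed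
  have z0: "zonal (real CARD('n)) (sphere_eigval l) (cos \<beta>) = 0"
    using \<kappa>0(2) unfolding eig zonal_def \<sigma>_def .
  have zp: "zonal (real CARD('n)) (sphere_eigval l) t > 0" if "cos \<beta> < t" "t \<le> 1" for t
    unfolding eig zonal_def using that by (intro \<kappa>0(3)) (auto simp: \<sigma>_def)
  have "axis k 1 \<in> cap k \<beta>"
    using open_cap_subset cos_bounds by (auto simp: norm_axis_1)
  moreover have "zonal_fun (sphere_eigval l) (axis k 1) \<noteq> 0"
    by (simp add: zonal_fun_def axis_def)
  ultimately have mem: "l \<in> cone_exponents k \<beta>"
    unfolding cone_exponents_def using l cap_solution_zonal[OF z0] by blast
  have least: "l \<le> l'" if l': "l' \<in> cone_exponents k \<beta>" for l'
  proof (rule ccontr)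
    assume "\<not> l \<le> l'"
    then have lt: "l' < l" by simp
    obtain \<Theta> x where \<Theta>: "l' > 0" "cap_solution k \<beta> l' \<Theta>" "x \<in> cap k \<beta>" "\<Theta> x \<noteq> 0"
      using l' unfolding cone_exponents_def by blast
    have "sphere_eigval l' < \<kappa>0" using sphere_eigval_strict_mono[OF \<Theta>(1) lt] eig by simp
    \<comment> \<open>The comparison function has to be positive up to the boundary of the cap,
      where the one for \<open>\<kappa>0\<close> vanishes; hence a value strictly between.\<close>
    then obtain \<kappa> where \<kappa>: "sphere_eigval l' < \<kappa>" "\<kappa> < \<kappa>0" using dense by blast
    have "0 \<le> sphere_eigval l'" unfolding sphere_eigval_def using \<Theta>(1) N2 by simp
    then have "\<kappa> \<ge> 0" using \<kappa> by linarith
    have pos: "zonal (real CARD('n)) \<kappa> t > 0" if "t \<in> {cos \<beta>..1}" for t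
      unfolding zonal_def using that \<open>\<kappa> \<ge> 0\<close> \<kappa> by (intro \<kappa>0(4)) (auto simp: \<sigma>_def)
    note sign = cap_solution_sign[OF \<Theta>(2) \<kappa>(1) pos \<Theta>(3)]
    show False using sign[of 1] sign[of "- 1"] \<Theta>(4) by simp
  qed
  have "least_exponent k \<beta> = l"
    unfolding least_exponent_def by (rule Least_equality) (use mem least in auto)
  then show ?thesis using that[of l] l mem z0 zp by blast
qed

end

section \<open>Eigenfunctions on the cone and on the truncated cone\<close>

text \<open>The power \<open>r powr (- p)\<close> turns Bessel's equation into the radial part of
  \<open>- \<Delta> u = s^2 u\<close>: in dimension \<open>N\<close> one takes
  \<open>p = (N - 2) / 2\<close>, so that \<open>2 * p + 1 = N - 1\<close>, and \<open>q\<close> is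
  the eigenvalue of the angular factor.\<close>

lemma (in bessel_order) powr_times_bessel_radial:
  assumes sol: "bessel_sol \<nu> w w'" and s: "s > 0" and r: "r > 0" and p: "\<nu>\<^sup>2 = p\<^sup>2 + q"
  defines "R \<equiv> \<lambda>r. r powr (- p) * w (s * r)"
    and "R1 \<equiv> \<lambda>r. r powr (- p - 1) * (w' (s * r) - p * w (s * r))"
    and "R2 \<equiv> \<lambda>r. r powr (- p - 2) * (((\<nu>\<^sup>2 - (s * r)\<^sup>2) + p * (p + 1)) * w (s * r) - (2 * p + 1) * w' (s * r))"
  shows "(R has_real_derivative R1 r) (at r)" "(R1 has_real_derivative R2 r) (at r)"
    "R2 r + (2 * p + 1) / r * R1 r + (s\<^sup>2 - q / r\<^sup>2) * R r = 0"
proof -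
  have z: "s * r > 0" using s r by simp
  have w: "(w has_real_derivative w' (s * r) / (s * r)) (at (s * r))"
    "(w' has_real_derivative (\<nu>\<^sup>2 - (s * r)\<^sup>2) * w (s * r) / (s * r)) (at (s * r))"
    using sol z unfolding bessel_sol_def by auto
  have sr: "((\<lambda>r. s * r) has_real_derivative s) (at r)"
    by (auto intro!: derivative_eq_intros)
  have d1: "((\<lambda>r. w (s * r)) has_real_derivative w' (s * r) / r) (at r)"
    by (rule DERIV_cong[OF DERIV_chain2[OF w(1) sr]]) (use s in simp)
  have d2: "((\<lambda>r. w' (s * r)) has_real_derivative (\<nu>\<^sup>2 - (s * r)\<^sup>2) * w (s * r) / r) (at r)"
    by (rule DERIV_cong[OF DERIV_chain2[OF w(2) sr]]) (use s in simp)
  have pw: "((\<lambda>r. r powr a) has_real_derivative a * r powr (a - 1)) (at r)" for a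
    using has_real_derivative_powr[OF r] by simp
  have e: "r powr (a - 1) = r powr a / r" "r powr (a - 2) = r powr a / r\<^sup>2" for a
    using r by (simp_all add: powr_diff powr_numeral)
  show "(R has_real_derivative R1 r) (at r)"
    unfolding R_def R1_def
    by (rule DERIV_cong[OF DERIV_mult[OF pw d1]]) (use r in \<open>simp add: e field_simps\<close>)
  have e2: "r powr (- p - 1 - 1) = r powr (- p) / r\<^sup>2" "r powr (- p - 2) = r powr (- p) / r\<^sup>2" "r powr (- p - 1) = r powr (- p) / r"
    using e(2)[of "- p"] e(1)[of "- p"] by (simp_all add: algebra_simps)
  show "(R1 has_real_derivative R2 r) (at r)"
    unfolding R1_def R2_def
    by (rule DERIV_cong[OF DERIV_mult[OF pw DERIV_diff[OF d2 DERIV_cmult[OF d1]]]])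
       (use r in \<open>simp add: e2 field_simps power2_eq_square\<close>)
  show "R2 r + (2 * p + 1) / r * R1 r + (s\<^sup>2 - q / r\<^sup>2) * R r = 0"
    unfolding R2_def R1_def R_def e2 p using r by (simp add: field_simps power2_eq_square)
qed

context spherical_cone
begin

definition bessel_index :: "real \<Rightarrow> real" where "bessel_index l = (real CARD('n) + 2 * l - 2) / 2"

lemma bessel_index_pos: "l > 0 \<Longrightarrow> bessel_index l > 0"
  unfolding bessel_index_def using N2 by simp

text \<open>The cone (\<open>\<rho> = 0\<close>) and the truncated cone
  (\<open>\<rho> = \<epsilon>\<close>) are treated together. The limit at \<open>\<rho>\<close> is
  the Dirichlet condition on the inner sphere or, for \<open>\<rho> = 0\<close>, the vanishing of
  the radial factor at the vertex. The product with the zonal function is then a positive Dirichlet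
  solution.\<close>

lemma cone_separated_eigenvalue:
  fixes \<rho> :: real
  assumes l: "l > 0" and zon: "zonal (real CARD('n)) (sphere_eigval l) (cos \<beta>) = 0"
      "\<And>t. cos \<beta> < t \<Longrightarrow> t \<le> 1 \<Longrightarrow> zonal (real CARD('n)) (sphere_eigval l) t > 0"
    and \<rho>: "0 \<le> \<rho>" "\<rho> < 1"
    and w: "bessel_sol (bessel_index l) w w'" "\<And>r. \<rho> < r \<Longrightarrow> r < 1 \<Longrightarrow> w (s * r) > 0" "w s = 0" and s: "s > 0"
    and lim: "((\<lambda>r. r powr (- ((real CARD('n) - 2) / 2)) * w (s * r)) \<longlongrightarrow> 0) (at_right \<rho>)"
  shows "dirichlet_lambda1 {x \<in> sph_cone k \<beta>. \<rho> < norm x} = s\<^sup>2"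
proof -
  define p where "p = (real CARD('n) - 2) / 2"
  define \<kappa> where "\<kappa> = sphere_eigval l"
  have pq: "(bessel_index l)\<^sup>2 = p\<^sup>2 + \<kappa>"
    unfolding bessel_index_def p_def \<kappa>_def sphere_eigval_def by (simp add: field_simps power2_eq_square)
  interpret bessel_order "bessel_index l" by unfold_locales (rule bessel_index_pos[OF l])
  \<comment> \<open>Setting \<open>R\<close> to 0 up to \<open>\<rho>\<close> makes it continuous at
    \<open>\<rho>\<close>, where the formula is known only through its limit.\<close>
  define R where "R r = (if r \<le> \<rho> then 0 else r powr (- p) * w (s * r))" for r
  define R1 where "R1 r = r powr (- p - 1) * (w' (s * r) - p * w (s * r))" for r
  define R2 where "R2 r = r powr (- p - 2) * ((((bessel_index l)\<^sup>2 - (s * r)\<^sup>2) + p * (p + 1)) * w (s * r) - (2 * p + 1) * w' (s * r))" for r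
  have ode: "(R has_real_derivative R1 r) (at r)" "(R1 has_real_derivative R2 r) (at r)"
    "R2 r + (real CARD('n) - 1) / r * R1 r = - (s\<^sup>2 - \<kappa> / r\<^sup>2) * R r" if r: "r > \<rho>" for r
  proof -
    have r0: "r > 0" using r \<rho> by simp
    note f = powr_times_bessel_radial[OF w(1) s r0 pq, folded R1_def R2_def]
    show "(R has_real_derivative R1 r) (at r)"
      by (rule has_field_derivative_transform_within_open[OF f(1), where S = "{\<rho><..}"])
         (use r in \<open>auto simp: R_def\<close>)
    show "(R1 has_real_derivative R2 r) (at r)"
      using f(2) unfolding R1_def[abs_def] R2_def .
    have p1: "2 * p + 1 = real CARD('n) - 1" by (simp add: p_def field_simps)
    have "R2 r + (2 * p + 1) / r * R1 r + (s\<^sup>2 - \<kappa> / r\<^sup>2) * R r = 0"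
      using f(3) r by (simp add: R_def R1_def R2_def)
    then show "R2 r + (real CARD('n) - 1) / r * R1 r = - (s\<^sup>2 - \<kappa> / r\<^sup>2) * R r"
      unfolding p1 by (simp only: mult_minus_left eq_neg_iff_add_eq_0)
  qed
  have R2c: "continuous_on {\<rho><..} R2"
  proof -
    have dw: "(w has_real_derivative w' z / z) (at z)" "(w' has_real_derivative ((bessel_index l)\<^sup>2 - z\<^sup>2) * w z / z) (at z)" if "z > 0" for z
      using w(1) that unfolding bessel_sol_def by auto
    have cw: "continuous_on {0<..} w" "continuous_on {0<..} w'"
      using dw by (auto intro!: continuous_at_imp_continuous_on DERIV_isCont)
    show ?thesis
      unfolding R2_def[abs_def]
      by (intro continuous_intros continuous_on_compose2[OF cw(1)] continuous_on_compose2[OF cw(2)])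
         (use \<rho> s in auto)
  qed
  define \<Omega> where "\<Omega> = {x \<in> sph_cone k \<beta>. \<rho> < norm x}"
  \<comment> \<open>The strict inequalities of \<open>\<Omega>\<close> made weak; for
    \<open>\<rho> = 0\<close> this set contains the vertex.\<close>
  define KK where "KK = {x::real^'n. \<rho> \<le> norm x \<and> norm x \<le> 1 \<and> norm x * cos \<beta> \<le> x $ k}"
  define u where "u x = R (norm x) * zonal (real CARD('n)) \<kappa> (x $ k / norm x)" for x :: "real ^ 'n"
  have \<Omega>: "x \<noteq> 0 \<and> norm x \<in> {\<rho><..} \<and> x $ k / norm x \<in> {-1<..<3}" "\<rho> < norm x" "norm x < 1" "norm x > 0"
    "cos \<beta> < x $ k / norm x" "x $ k / norm x \<le> 1"
    if "x \<in> \<Omega>" for x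
  proof -
    have n: "norm x > 0" "\<rho> < norm x" "norm x < 1" "norm x * cos \<beta> < x $ k" using that by (auto simp: \<Omega>_def sph_cone_def)
    then show c: "cos \<beta> < x $ k / norm x" by (simp add: pos_less_divide_eq mult.commute)
    show a: "x $ k / norm x \<le> 1" using abs_le_D1[OF angle_bounds[of x]] n by auto
    show "x \<noteq> 0 \<and> norm x \<in> {\<rho><..} \<and> x $ k / norm x \<in> {-1<..<3}"
    proof -
      have "x $ k / norm x < 3" "-1 < x $ k / norm x" using a c cos_bounds by linarith+
      then show ?thesis using n by auto
    qed
  qed (use that in \<open>auto simp: \<Omega>_def sph_cone_def\<close>)
  obtain G K where GK: "\<And>x. x \<in> \<Omega> \<Longrightarrow> GDERIV (\<lambda>x. R (norm x) * zonal (real CARD('n)) \<kappa> (x $ k / norm x)) x :> G x"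
    "\<And>x i. x \<in> \<Omega> \<Longrightarrow> GDERIV (\<lambda>y. G y $ i) x :> K i x"
    "\<And>i. continuous_on \<Omega> (K i)"
    "\<And>x. x \<in> \<Omega> \<Longrightarrow> (\<Sum>i\<in>UNIV. K i x $ i) = (R2 (norm x) + (real CARD('n) - 1) / norm x * R1 (norm x)) * zonal (real CARD('n)) \<kappa> (x $ k / norm x)
        + R (norm x) / (norm x)\<^sup>2 * ((1 - (x $ k / norm x)\<^sup>2) * zonal2 (real CARD('n)) \<kappa> (x $ k / norm x)
            - (real CARD('n) - 1) * (x $ k / norm x) * zonal1 (real CARD('n)) \<kappa> (x $ k / norm x))"
  proof (rule separated_laplacian[where S = \<Omega> and I = "{\<rho><..}" and T = "{-1<..<3}" and k = k
        and R = R and ?R1.0 = R1 and ?R2.0 = R2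
        and g = "zonal (real CARD('n)) \<kappa>" and ?g1.0 = "zonal1 (real CARD('n)) \<kappa>" and ?g2.0 = "zonal2 (real CARD('n)) \<kappa>"])
    show "x \<noteq> 0 \<and> norm x \<in> {\<rho><..} \<and> x $ k / norm x \<in> {- 1<..<3}" if "x \<in> \<Omega>" for x
      using \<Omega>(1)[OF that] .
    show "continuous_on {- 1<..<3} (zonal2 (real CARD('n)) \<kappa>)"
      using DERIV_zonal(3)[OF N2] by (intro continuous_at_imp_continuous_on) blast
  qed (auto intro: DERIV_zonal[OF N2] ode R2c)
  have Rc: "continuous_on {\<rho>..1} R"
    unfolding continuous_on_eq_continuous_within
  proof
    fix r assume r: "r \<in> {\<rho>..1}"
    show "continuous (at r within {\<rho>..1}) R"
    proof (cases "r = \<rho>")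
      case False
      then have "isCont R r" using ode(1)[of r] r by (auto intro: DERIV_isCont)
      then show ?thesis by (rule continuous_at_imp_continuous_at_within)
    next
      case True
      have "(R \<longlongrightarrow> 0) (at_right \<rho>)"
      proof (rule Lim_transform_eventually[OF lim[folded p_def]])
        show "\<forall>\<^sub>F x in at_right \<rho>. x powr (- p) * w (s * x) = R x"
          using eventually_at_right_less[of \<rho>] by eventually_elim (simp add: R_def)
      qed
      then have "(R \<longlongrightarrow> R \<rho>) (at \<rho> within {\<rho>..1})"
        using \<rho> by (simp add: at_within_Icc_at_right R_def)
      then show ?thesis using True by (simp add: continuous_within)
    qed
  qed
  have R1z: "R 1 = 0" using w(3) \<rho> by (simp add: R_def)
  have Rpos: "R r > 0" if "\<rho> < r" "r < 1" for r
    using w(2)[OF that] that \<rho> by (simp add: R_def)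
  have KKt: "-1 < x $ k / norm x \<and> x $ k / norm x < 3 \<and> cos \<beta> \<le> x $ k / norm x \<and> x $ k / norm x \<le> 1"
    if "x \<in> KK" "x \<noteq> 0" for x
  proof -
    have n: "norm x > 0" "norm x * cos \<beta> \<le> x $ k" using that by (auto simp: KK_def)
    then have c: "cos \<beta> \<le> x $ k / norm x" by (simp add: pos_le_divide_eq mult.commute)
    have a: "x $ k / norm x \<le> 1" using abs_le_D1[OF angle_bounds[OF that(2)]] .
    have "x $ k / norm x < 3" "-1 < x $ k / norm x" using a c cos_bounds by linarith+
    then show ?thesis using a c by blast
  qed
  have uc: "continuous_on KK u"
    unfolding continuous_on_eq_continuous_within
  proof
    fix x assume x: "x \<in> KK"
    show "continuous (at x within KK) u"
    proof (cases "x = 0")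
      case False
      have "continuous_on (KK - {0}) u"
        unfolding u_def[abs_def]
      proof (intro continuous_on_mult)
        show "continuous_on (KK - {0}) (\<lambda>x. R (norm x))"
          by (rule continuous_on_compose2[OF Rc]) (auto intro!: continuous_intros simp: KK_def)
        show "continuous_on (KK - {0}) (\<lambda>x. zonal (real CARD('n)) \<kappa> (x $ k / norm x))"
        proof (rule continuous_on_compose2[OF zonal_continuous_on[OF N2 order_refl]])
          show "continuous_on (KK - {0}) (\<lambda>x. x $ k / norm x)"
            by (intro continuous_intros) auto
          show "(\<lambda>x. x $ k / norm x) ` (KK - {0}) \<subseteq> {- 1<..<3}"
            unfolding image_subset_iff greaterThanLessThan_iff using KKt by blast
        qed
      qed
      then have "continuous (at x within KK - {0}) u"
        using x False by (auto simp: continuous_on_eq_continuous_within)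
      moreover have "at x within KK - {0} = at x within KK"
        by (rule at_within_nhd[of _ "- {0}"]) (use False in auto)
      ultimately show ?thesis by (simp add: continuous_within)
    next
      \<comment> \<open>The polar angle has no limit at the vertex, but the zonal factor is bounded
        there and the radial factor tends to 0.\<close>
      case True
      then have \<rho>0: "\<rho> = 0" using x \<rho> by (auto simp: KK_def)
      have "bounded (zonal (real CARD('n)) \<kappa> ` {cos \<beta>..1})"
        using cos_bounds by (intro compact_imp_bounded compact_continuous_image zonal_continuous_on N2) auto
      then obtain B where "\<forall>y\<in>zonal (real CARD('n)) \<kappa> ` {cos \<beta>..1}. norm y \<le> B"
        unfolding bounded_iff by blast
      then have B: "\<bar>zonal (real CARD('n)) \<kappa> t\<bar> \<le> B" if "t \<in> {cos \<beta>..1}" for t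
        using that by auto
      have "(u \<longlongrightarrow> 0) (at 0 within KK)"
      proof (rule Lim_null_comparison)
        have "((\<lambda>r. R r) \<longlongrightarrow> 0) (at 0 within {0..1})"
          using Rc \<rho>0 by (auto simp: continuous_on_def R_def dest: bspec[of _ _ 0])
        then have "((\<lambda>x. R (norm x)) \<longlongrightarrow> 0) (at 0 within KK)"
        proof (rule filterlim_compose)
          show "filterlim norm (at 0 within {0..1}) (at 0 within KK)"
            unfolding filterlim_at
          proof
            show "\<forall>\<^sub>F x in at 0 within KK. norm x \<in> {0..1} \<and> norm x \<noteq> 0"
              by (auto simp: eventually_at_filter KK_def)
            show "(norm \<longlongrightarrow> 0) (at 0 within KK)"
              by (rule tendsto_norm_zero) (rule tendsto_ident_at)
          qed
        qed
        then have "((\<lambda>x. \<bar>R (norm x)\<bar> * B) \<longlongrightarrow> \<bar>0\<bar> * B) (at 0 within KK)"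
          by (intro tendsto_intros)
        then show "((\<lambda>x. \<bar>R (norm x)\<bar> * B) \<longlongrightarrow> 0) (at 0 within KK)" by simp
        show "\<forall>\<^sub>F x in at 0 within KK. norm (u x) \<le> \<bar>R (norm x)\<bar> * B"
          unfolding eventually_at_filter
        proof (rule always_eventually, intro allI impI)
          fix x assume "x \<noteq> 0" "x \<in> KK"
          then show "norm (u x) \<le> \<bar>R (norm x)\<bar> * B"
            unfolding u_def real_norm_def abs_mult using KKt[of x] by (intro mult_left_mono B) auto
        qed
      qed
      then show ?thesis using True \<rho>0 by (simp add: continuous_within u_def R_def)
    qed
  qed
  have "positive_dirichlet_solution \<Omega> KK u G K (s\<^sup>2)"
  proof
    show "open \<Omega>"
    proof -
      have "\<Omega> = {x. 0 < norm x \<and> norm x < 1 \<and> norm x * cos \<beta> < x $ k \<and> \<rho> < norm x}"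
        by (auto simp: \<Omega>_def sph_cone_def)
      moreover have "open {x::real^'n. 0 < norm x \<and> norm x < 1 \<and> norm x * cos \<beta> < x $ k \<and> \<rho> < norm x}"
        by (intro open_Collect_conj open_Collect_less continuous_intros)
      ultimately show ?thesis by simp
    qed
    have "((1 + \<rho>) / 2) *\<^sub>R axis k 1 \<in> \<Omega>"
    proof -
      define c where "c = (1 + \<rho>) / 2"
      have c: "c > 0" "\<rho> < c" "c < 1" using \<rho> by (auto simp: c_def)
      then have "c * cos \<beta> < c * 1" using cos_bounds by (intro mult_strict_left_mono) auto
      then show ?thesis using c unfolding c_def[symmetric] by (simp add: \<Omega>_def sph_cone_def norm_axis_1)
    qed
    then show "\<Omega> \<noteq> {}" by blast
    have "closed KK"
      unfolding KK_def by (intro closed_Collect_conj closed_Collect_le continuous_intros)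
    moreover have "bounded KK"
      unfolding bounded_iff KK_def by auto
    ultimately show "compact KK" by (simp add: compact_eq_bounded_closed)
    show "\<Omega> \<subseteq> KK" by (auto simp: \<Omega>_def KK_def sph_cone_def)
    show "continuous_on KK u" by (rule uc)
    show "u x = 0" if "x \<in> KK - \<Omega>" for x
    proof -
      have "norm x = \<rho> \<or> norm x = 1 \<or> (x \<noteq> 0 \<and> norm x * cos \<beta> = x $ k)"
        using that \<rho> by (auto simp: KK_def \<Omega>_def sph_cone_def not_less order.order_iff_strict)
      then consider "norm x = \<rho>" | "norm x = 1" | "x \<noteq> 0" "norm x * cos \<beta> = x $ k" by blast
      then show ?thesis
      proof cases
        case 1
        then show ?thesis by (simp add: u_def R_def)
      next
        case 2
        then show ?thesis using R1z by (simp add: u_def)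
      next
        case 3
        then have "x $ k / norm x = cos \<beta>" by (metis nonzero_mult_div_cancel_left norm_eq_zero)
        then show ?thesis using zon(1) by (simp add: u_def \<kappa>_def)
      qed
    qed
    show "0 < u x" if "x \<in> \<Omega>" for x
      unfolding u_def \<kappa>_def using \<Omega>[OF that] by (intro mult_pos_pos Rpos zon) auto
    show "GDERIV u x :> G x" if "x \<in> \<Omega>" for x
      using GK(1)[OF that] unfolding u_def[abs_def] .
    show "GDERIV (\<lambda>y. G y $ i) x :> K i x" if "x \<in> \<Omega>" for x i
      using GK(2)[OF that] .
    show "continuous_on \<Omega> (K i)" for i by (rule GK(3))
    show "(\<Sum>i\<in>UNIV. K i x $ i) = - s\<^sup>2 * u x" if "x \<in> \<Omega>" for x
    proof -
      note o = \<Omega>[OF that]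
      have t: "x $ k / norm x \<in> {-1<..<3}" using o(1) by blast
      show ?thesis
        unfolding GK(4)[OF that] ode(3)[OF o(2)] zonal_equation[OF N2 t] u_def
        using o(4) by (simp add: field_simps)
    qed
  qed
  then interpret positive_dirichlet_solution \<Omega> KK u G K "s\<^sup>2" .
  show ?thesis using dirichlet_lambda1_eq unfolding \<Omega>_def .
qed

end

section \<open>The asymptotic expansions\<close>

lemma smallo_of_tendsto_quotient:
  fixes F :: "real \<Rightarrow> real"
  assumes lim: "((\<lambda>\<epsilon>. F \<epsilon> / \<epsilon> powr q) \<longlongrightarrow> A) (at_right 0)"
    and W: "\<forall>\<^sub>F \<epsilon> in at_right 0. W \<epsilon> = D * \<epsilon> powr q" and D: "D > 0"
  shows "(\<lambda>\<epsilon>. F \<epsilon> - A / D * W \<epsilon>) \<in> o[at_right 0](W)"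
proof (rule smalloI_tendsto)
  have pos: "\<forall>\<^sub>F \<epsilon> in at_right 0. (\<epsilon>::real) > 0" by (rule eventually_at_right_less)
  show "\<forall>\<^sub>F \<epsilon> in at_right 0. W \<epsilon> \<noteq> 0"
    using W pos by eventually_elim (use D in auto)
  have "((\<lambda>\<epsilon>. (F \<epsilon> / \<epsilon> powr q - A) / D) \<longlongrightarrow> (A - A) / D) (at_right 0)"
    using D by (intro tendsto_intros lim) auto
  then have "((\<lambda>\<epsilon>. (F \<epsilon> / \<epsilon> powr q - A) / D) \<longlongrightarrow> 0) (at_right 0)" by simp
  then show "((\<lambda>\<epsilon>. (F \<epsilon> - A / D * W \<epsilon>) / W \<epsilon>) \<longlongrightarrow> 0) (at_right 0)"
  proof (rule Lim_transform_eventually)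
    show "\<forall>\<^sub>F \<epsilon> in at_right 0. (F \<epsilon> / \<epsilon> powr q - A) / D = (F \<epsilon> - A / D * W \<epsilon>) / W \<epsilon>"
      using W pos
    proof eventually_elim
      case (elim \<epsilon>)
      have "\<epsilon> powr q > 0" using elim by simp
      then show ?case unfolding elim(1) using D by (simp add: field_simps)
    qed
  qed
qed

context spherical_cone
begin

text \<open>The sphere \<open>norm x = 1\<close> is included because the removed part,
  \<open>norm x \<le> \<epsilon>\<close>, includes its outer sphere.\<close>

definition unit_sector_measure :: real where
  "unit_sector_measure = measure lebesgue {x :: real ^ 'n. 0 < norm x \<and> norm x \<le> 1 \<and> norm x * cos \<beta> < x $ k}"

lemma unit_sector_measure_pos: "unit_sector_measure > 0"
proof -
  let ?T = "{x :: real ^ 'n. 0 < norm x \<and> norm x \<le> 1 \<and> norm x * cos \<beta> < x $ k}"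
  have T: "?T \<in> lmeasurable"
  proof (rule bounded_set_imp_lmeasurable)
    show "bounded ?T" unfolding bounded_iff by auto
    have "?T = {x. 0 < norm x \<and> norm x * cos \<beta> < x $ k} \<inter> cball 0 1" by auto
    moreover have "open {x :: real ^ 'n. 0 < norm x \<and> norm x * cos \<beta> < x $ k}"
      by (intro open_Collect_conj open_Collect_less continuous_intros)
    ultimately show "?T \<in> sets lebesgue"
      by (simp add: sets.Int lborelD)
  qed
  have sub: "{x :: real ^ 'n. 0 < norm x \<and> norm x < 1 \<and> norm x * cos \<beta> < x $ k} \<subseteq> ?T" by auto
  have op: "open {x :: real ^ 'n. 0 < norm x \<and> norm x < 1 \<and> norm x * cos \<beta> < x $ k}"
    by (intro open_Collect_conj open_Collect_less continuous_intros)
  have "(1 / 2) *\<^sub>R axis k 1 \<in> {x :: real ^ 'n. 0 < norm x \<and> norm x < 1 \<and> norm x * cos \<beta> < x $ k}"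
    using cos_bounds by (simp add: norm_axis_1)
  then have "\<not> negligible {x :: real ^ 'n. 0 < norm x \<and> norm x < 1 \<and> norm x * cos \<beta> < x $ k}"
    using open_not_negligible[OF op] by blast
  then have "\<not> negligible ?T" using sub negligible_subset by blast
  then have "measure lebesgue ?T \<noteq> 0"
    using T negligible_iff_measure0 by blast
  then show ?thesis
    unfolding unit_sector_measure_def using measure_nonneg[of lebesgue ?T] by linarith
qed

lemma removed_volume:
  assumes "0 < \<epsilon>" "\<epsilon> < 1"
  shows "measure lebesgue (sph_cone k \<beta> - trunc_cone k \<beta> \<epsilon>) = unit_sector_measure * \<epsilon> powr real CARD('n)"
proof -
  let ?T = "{x :: real ^ 'n. 0 < norm x \<and> norm x \<le> 1 \<and> norm x * cos \<beta> < x $ k}"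
  have "sph_cone k \<beta> - trunc_cone k \<beta> \<epsilon> = {x. 0 < norm x \<and> norm x \<le> \<epsilon> \<and> norm x * cos \<beta> < x $ k}"
    using assms by (auto simp: sph_cone_def trunc_cone_def)
  also have "\<dots> = (\<lambda>x. \<epsilon> *\<^sub>R x + 0) ` ?T"
  proof (intro equalityI subsetI)
    fix x :: "real ^ 'n" assume x: "x \<in> {x. 0 < norm x \<and> norm x \<le> \<epsilon> \<and> norm x * cos \<beta> < x $ k}"
    have "inverse \<epsilon> * (norm x * cos \<beta>) < inverse \<epsilon> * x $ k"
      using x assms by (intro mult_strict_left_mono) auto
    then have "inverse \<epsilon> *\<^sub>R x \<in> ?T"
      using x assms by (auto simp: field_simps)
    moreover have "x = \<epsilon> *\<^sub>R (inverse \<epsilon> *\<^sub>R x) + 0" using assms by simp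
    ultimately show "x \<in> (\<lambda>x. \<epsilon> *\<^sub>R x + 0) ` ?T" by (rule rev_image_eqI)
  next
    fix y assume "y \<in> (\<lambda>x. \<epsilon> *\<^sub>R x + 0) ` ?T"
    then obtain x where x: "y = \<epsilon> *\<^sub>R x" "0 < norm x" "norm x \<le> 1" "norm x * cos \<beta> < x $ k" by auto
    have "\<epsilon> * (norm x * cos \<beta>) < \<epsilon> * x $ k"
      using x assms by (intro mult_strict_left_mono) auto
    moreover have "\<epsilon> * norm x \<le> \<epsilon> * 1" using x assms by (intro mult_left_mono) auto
    ultimately show "y \<in> {x. 0 < norm x \<and> norm x \<le> \<epsilon> \<and> norm x * cos \<beta> < x $ k}"
      using x assms by (simp add: mult.assoc)
  qed
  finally have "measure lebesgue (sph_cone k \<beta> - trunc_cone k \<beta> \<epsilon>) = \<bar>\<epsilon>\<bar> ^ DIM(real ^ 'n) * measure lebesgue ?T"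
    using measure_lebesgue_affine[of \<epsilon> 0 ?T] by (simp add: add.commute)
  then show ?thesis
    using assms by (simp add: unit_sector_measure_def powr_realpow)
qed

text \<open>The volume scales like the power \<open>N\<close> of \<open>\<epsilon>\<close>, so the
  exponent \<open>(N + 2 * l - 2) / N\<close> reproduces the rate
  \<open>\<epsilon> powr (2 * \<nu>)\<close> of \<open>root_perturbation\<close>.\<close>

lemma removed_volume_powr:
  "\<forall>\<^sub>F \<epsilon> in at_right 0. measure lebesgue (sph_cone k \<beta> - trunc_cone k \<beta> \<epsilon>) powr ((real CARD('n) + 2 * l - 2) / real CARD('n))
     = unit_sector_measure powr ((real CARD('n) + 2 * l - 2) / real CARD('n)) * \<epsilon> powr (2 * bessel_index l)"
proof -
  have "\<forall>\<^sub>F \<epsilon> in at_right (0::real). \<epsilon> \<in> {0<..<1}" by (rule eventually_at_right_real) simp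
  then show ?thesis
  proof eventually_elim
    case (elim \<epsilon>)
    have "real CARD('n) * ((real CARD('n) + 2 * l - 2) / real CARD('n)) = 2 * bessel_index l"
      using N2 by (simp add: bessel_index_def)
    then show ?case
      using elim unit_sector_measure_pos by (simp add: removed_volume powr_mult powr_powr)
  qed
qed

text \<open>Let \<open>j\<close> be the first zero of \<open>J\<close>. The profile of the full cone
  is \<open>J (j * r)\<close>, with eigenvalue \<open>j^2\<close>; that of the truncated cone
  belongs to the branch \<open>lam\<close> issuing from \<open>j^2\<close>, whose profile is
  positive by \<open>radial_positive\<close>.\<close>

lemma lambda1_cone_asymptotics:
  assumes l: "l > 0" and zon: "zonal (real CARD('n)) (sphere_eigval l) (cos \<beta>) = 0"
      "\<And>t. cos \<beta> < t \<Longrightarrow> t \<le> 1 \<Longrightarrow> zonal (real CARD('n)) (sphere_eigval l) t > 0"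
  obtains A where "A > 0"
    "((\<lambda>\<epsilon>. (dirichlet_lambda1 (trunc_cone k \<beta> \<epsilon>) - dirichlet_lambda1 (sph_cone k \<beta>)) / \<epsilon> powr (2 * bessel_index l)) \<longlongrightarrow> A) (at_right 0)"
proof -
  interpret bessel_order "bessel_index l" by unfold_locales (rule bessel_index_pos[OF l])
  define p where "p = (real CARD('n) - 2) / 2"
  obtain j where j: "j > 0" "J j = 0" "\<And>z. 0 < z \<Longrightarrow> z < j \<Longrightarrow> J z > 0"
    using first_zero by blast
  have j2: "j\<^sup>2 > 0" "J (sqrt (j\<^sup>2)) = 0" using j by auto
  obtain \<epsilon>0 r lam A where P: "\<epsilon>0 > 0" "A > 0"
    "\<And>\<epsilon> \<mu>. \<epsilon> \<in> {0<..<\<epsilon>0} \<Longrightarrow> (0 < \<mu> \<and> \<bar>\<mu> - j\<^sup>2\<bar> < r \<and> cross \<epsilon> \<mu> = 0) \<longleftrightarrow> \<mu> = lam \<epsilon>"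
    "(lam \<longlongrightarrow> j\<^sup>2) (at_right 0)"
    "((\<lambda>\<epsilon>. (lam \<epsilon> - j\<^sup>2) / \<epsilon> powr (2 * bessel_index l)) \<longlongrightarrow> A) (at_right 0)"
    using root_perturbation[OF j2] by blast
  have "\<forall>\<^sub>F \<epsilon> in at_right 0. \<epsilon> \<in> {0<..<\<epsilon>0}" by (rule eventually_at_right_real[OF P(1)])
  then have cr: "\<forall>\<^sub>F \<epsilon> in at_right 0. cross \<epsilon> (lam \<epsilon>) = 0"
    by eventually_elim (use P(3) in blast)
  have full: "dirichlet_lambda1 (sph_cone k \<beta>) = j\<^sup>2"
  proof -
    have "dirichlet_lambda1 {x \<in> sph_cone k \<beta>. 0 < norm x} = j\<^sup>2"
    proof (rule cone_separated_eigenvalue[OF l zon])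
      show "bessel_sol (bessel_index l) J J'" by (rule bessel_sol_J)
      show "J (j * r) > 0" if "0 < r" "r < 1" for r
        using that j(1) by (intro j(3)) (auto simp: mult_less_cancel_left1)
      show "((\<lambda>r. r powr - ((real CARD('n) - 2) / 2) * J (j * r)) \<longlongrightarrow> 0) (at_right 0)"
      proof (rule Lim_transform_eventually)
        \<comment> \<open>Near 0 the profile behaves like a multiple of \<open>r powr l\<close>,
          since the order exceeds \<open>(N - 2) / 2\<close> by exactly \<open>l\<close>.\<close>
        have "((\<lambda>r::real. r powr l) \<longlongrightarrow> 0) (at_right 0)" using l by real_asymp
        moreover have "((\<lambda>r. (r * j / 2) powr (- bessel_index l) * J (r * j)) \<longlongrightarrow> rGamma (bessel_index l + 1)) (at_right 0)"
          by (rule filterlim_compose[OF bessel_J_tendsto(1) filterlim_scaled[OF tendsto_const j(1)]])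
        ultimately have "((\<lambda>r. (j / 2) powr (bessel_index l) * r powr l * ((r * j / 2) powr (- bessel_index l) * J (r * j)))
            \<longlongrightarrow> (j / 2) powr (bessel_index l) * 0 * rGamma (bessel_index l + 1)) (at_right 0)"
          by (intro tendsto_intros)
        then show "((\<lambda>r. (j / 2) powr (bessel_index l) * r powr l * ((r * j / 2) powr (- bessel_index l) * J (r * j))) \<longlongrightarrow> 0) (at_right 0)"
          by simp
        show "\<forall>\<^sub>F r in at_right 0. (j / 2) powr (bessel_index l) * r powr l * ((r * j / 2) powr (- bessel_index l) * J (r * j))
            = r powr - ((real CARD('n) - 2) / 2) * J (j * r)"
          using eventually_at_right_less[of "0::real"]
        proof eventually_elim
          case (elim r)
          have e1: "(r * j / 2) powr (- bessel_index l) = r powr (- bessel_index l) * (j / 2) powr (- bessel_index l)"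
            using elim j(1) by (subst powr_mult[symmetric]) auto
          have e2: "(j / 2) powr (bessel_index l) * (j / 2) powr (- bessel_index l) = 1"
            using j(1) by (simp add: powr_minus)
          have e3: "r powr l * r powr (- bessel_index l) = r powr (- ((real CARD('n) - 2) / 2))"
          proof -
            have "l + - bessel_index l = - ((real CARD('n) - 2) / 2)"
              by (simp add: bessel_index_def field_simps)
            then show ?thesis by (simp only: powr_add[symmetric])
          qed
          have "(j / 2) powr (bessel_index l) * r powr l * ((r * j / 2) powr (- bessel_index l) * J (r * j))
             = ((j / 2) powr (bessel_index l) * (j / 2) powr (- bessel_index l)) * (r powr l * r powr (- bessel_index l)) * J (j * r)"
            unfolding e1 by (simp add: mult_ac)
          then show ?case unfolding e2 e3 by simp
        qed
      qed
    qed (use j in auto)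
    moreover have "{x \<in> sph_cone k \<beta>. 0 < norm x} = sph_cone k \<beta>" by (auto simp: sph_cone_def)
    ultimately show ?thesis by simp
  qed
  have trunc: "\<forall>\<^sub>F \<epsilon> in at_right 0. dirichlet_lambda1 (trunc_cone k \<beta> \<epsilon>) = lam \<epsilon>"
  proof -
    have "\<forall>\<^sub>F \<epsilon> in at_right (0::real). \<epsilon> \<in> {0<..<1}" by (rule eventually_at_right_real) simp
    moreover have "\<forall>\<^sub>F \<epsilon> in at_right 0. lam \<epsilon> > 0 \<and> Y (\<epsilon> * sqrt (lam \<epsilon>)) \<noteq> 0 \<and>
      J (sqrt (lam \<epsilon>)) - quot (\<epsilon> * sqrt (lam \<epsilon>)) * Y (sqrt (lam \<epsilon>)) = 0 \<and>
      (\<forall>r\<in>{\<epsilon><..<1}. 0 < J (sqrt (lam \<epsilon>) * r) - quot (\<epsilon> * sqrt (lam \<epsilon>)) * Y (sqrt (lam \<epsilon>) * r))"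
      by (rule radial_positive) (use j P(4) cr in auto)
    ultimately show ?thesis
    proof eventually_elim
      case (elim \<epsilon>)
      define s where "s = sqrt (lam \<epsilon>)"
      define \<kappa> where "\<kappa> = quot (\<epsilon> * s)"
      \<comment> \<open>This combination vanishes at \<open>\<epsilon> * s\<close> by the choice of
        \<open>\<kappa>\<close>, and at \<open>s\<close> by the cross product equation.\<close>
      define w where "w z = 1 * J z + (- \<kappa>) * Y z" for z
      define w' where "w' z = 1 * J' z + (- \<kappa>) * Y' z" for z
      have s: "s > 0" using elim by (simp add: s_def)
      have sol: "bessel_sol (bessel_index l) w w'"
        unfolding w_def[abs_def] w'_def[abs_def]
        by (intro bessel_sol_linear bessel_sol_J bessel_Y_props \<nu>_pos)
      have we: "w (s * \<epsilon>) = 0"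
        using elim(2) by (simp add: w_def \<kappa>_def quot_def s_def mult.commute)
      have "dirichlet_lambda1 {x \<in> sph_cone k \<beta>. \<epsilon> < norm x} = s\<^sup>2"
      proof (rule cone_separated_eigenvalue[OF l zon _ _ sol])
        show "w (s * r) > 0" if "\<epsilon> < r" "r < 1" for r
          using elim(2) that by (simp add: w_def \<kappa>_def s_def)
        show "w s = 0" using elim(2) by (simp add: w_def \<kappa>_def s_def)
        have se: "s * \<epsilon> > 0" using s elim by simp
        have "isCont w (s * \<epsilon>)"
          using sol se unfolding bessel_sol_def by (blast intro: DERIV_isCont)
        then have "((\<lambda>r. w (s * r)) \<longlongrightarrow> w (s * \<epsilon>)) (at_right \<epsilon>)"
          by (rule isCont_tendsto_compose) (intro tendsto_intros)
        then have "((\<lambda>r. r powr - ((real CARD('n) - 2) / 2) * w (s * r)) \<longlongrightarrow>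
            \<epsilon> powr - ((real CARD('n) - 2) / 2) * w (s * \<epsilon>)) (at_right \<epsilon>)"
          using elim(1) by (intro tendsto_intros) auto
        then show "((\<lambda>r. r powr - ((real CARD('n) - 2) / 2) * w (s * r)) \<longlongrightarrow> 0) (at_right \<epsilon>)"
          by (simp add: we)
      qed (use elim s in auto)
      then show ?case using elim(2) by (simp add: trunc_cone_def s_def)
    qed
  qed
  have "((\<lambda>\<epsilon>. (dirichlet_lambda1 (trunc_cone k \<beta> \<epsilon>) - dirichlet_lambda1 (sph_cone k \<beta>)) / \<epsilon> powr (2 * bessel_index l)) \<longlongrightarrow> A) (at_right 0)"
    by (rule Lim_transform_eventually[OF P(5)], use trunc in eventually_elim) (simp add: full)
  then show ?thesis using that P(2) by blast
qed

end

theorem theorem2p17: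
  fixes k :: "'n::finite" and \<beta> :: real
  defines "N \<equiv> real CARD('n)"
    and "V \<equiv> \<lambda>\<epsilon>::real. measure lebesgue (sph_cone k \<beta> - trunc_cone k \<beta> \<epsilon>)"
  assumes "2 \<le> CARD('n)" and "0 < \<beta>" and "\<beta> < pi"
  shows
    "(\<forall>l \<in> cone_exponents k \<beta>. \<forall>\<nu> lam0. \<nu> = (N + 2 * l - 2) / 2 \<longrightarrow>
        0 \<le> lam0 \<longrightarrow> lam0 \<noteq> 0 \<longrightarrow> bessel_J \<nu> (sqrt lam0) = 0 \<longrightarrow>
        (\<exists>\<epsilon>0>0. \<exists>r>0. \<exists>lam :: real \<Rightarrow> real.
           (\<forall>\<epsilon> \<in> {0<..<\<epsilon>0}. \<forall>\<mu>.
              (0 < \<mu> \<and> \<bar>\<mu> - lam0\<bar> < r \<and>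
               bessel_J \<nu> (sqrt \<mu>) * bessel_Y \<nu> (\<epsilon> * sqrt \<mu>)
               - bessel_Y \<nu> (sqrt \<mu>) * bessel_J \<nu> (\<epsilon> * sqrt \<mu>) = 0)
              \<longleftrightarrow> \<mu> = lam \<epsilon>) \<and>
           (lam \<longlongrightarrow> lam0) (at_right 0) \<and>
           (\<exists>a>0. (\<lambda>\<epsilon>. lam \<epsilon> - lam0 - a * V \<epsilon> powr ((N + 2 * l - 2) / N))
                    \<in> o[at_right 0](\<lambda>\<epsilon>. V \<epsilon> powr ((N + 2 * l - 2) / N)))))
     \<and> (\<exists>b>0. (\<lambda>\<epsilon>. dirichlet_lambda1 (trunc_cone k \<beta> \<epsilon>) - dirichlet_lambda1 (sph_cone k \<beta>)
                       - b * V \<epsilon> powr ((N + 2 * least_exponent k \<beta> - 2) / N))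
                \<in> o[at_right 0](\<lambda>\<epsilon>. V \<epsilon> powr ((N + 2 * least_exponent k \<beta> - 2) / N)))"
proof -
  interpret spherical_cone k \<beta> by unfold_locales (use assms in auto)
  \<comment> \<open>The factor relating the volume power to
    \<open>\<epsilon> powr (2 * \<nu>)\<close>; both constants of the theorem are obtained by
    dividing a coefficient \<open>A\<close> by it.\<close>
  let ?D = "\<lambda>l. unit_sector_measure powr ((real CARD('n) + 2 * l - 2) / real CARD('n))"
  have D: "?D l > 0" for l
    using unit_sector_measure_pos by simp
  show ?thesis
    unfolding N_def V_def
  proof (intro conjI ballI allI impI)
    fix l \<nu> lam0 :: real
    assume l: "l \<in> cone_exponents k \<beta>" and \<nu>: "\<nu> = (real CARD('n) + 2 * l - 2) / 2"
      and lam0: "0 \<le> lam0" "lam0 \<noteq> 0" "bessel_J \<nu> (sqrt lam0) = 0"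
    have o: "\<nu> = bessel_index l" using \<nu> by (simp add: bessel_index_def)
    have lp: "l > 0" using l by (simp add: cone_exponents_def)
    interpret bessel_order \<nu> by unfold_locales (simp add: o bessel_index_pos[OF lp])
    have l0: "lam0 > 0" using lam0 by simp
    obtain \<epsilon>0 r lam A where P: "\<epsilon>0 > 0" "r > 0" "A > 0"
      "\<forall>\<epsilon>\<in>{0<..<\<epsilon>0}. \<forall>\<mu>. (0 < \<mu> \<and> \<bar>\<mu> - lam0\<bar> < r \<and> cross \<epsilon> \<mu> = 0) \<longleftrightarrow> \<mu> = lam \<epsilon>"
      "(lam \<longlongrightarrow> lam0) (at_right 0)"
      "((\<lambda>\<epsilon>. (lam \<epsilon> - lam0) / \<epsilon> powr (2 * \<nu>)) \<longlongrightarrow> A) (at_right 0)"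
      using root_perturbation[OF l0 lam0(3)] by blast
    show "\<exists>\<epsilon>0>0. \<exists>r>0. \<exists>lam :: real \<Rightarrow> real.
           (\<forall>\<epsilon> \<in> {0<..<\<epsilon>0}. \<forall>\<mu>.
              (0 < \<mu> \<and> \<bar>\<mu> - lam0\<bar> < r \<and>
               bessel_J \<nu> (sqrt \<mu>) * bessel_Y \<nu> (\<epsilon> * sqrt \<mu>)
               - bessel_Y \<nu> (sqrt \<mu>) * bessel_J \<nu> (\<epsilon> * sqrt \<mu>) = 0)
              \<longleftrightarrow> \<mu> = lam \<epsilon>) \<and>
           (lam \<longlongrightarrow> lam0) (at_right 0) \<and>
           (\<exists>a>0. (\<lambda>\<epsilon>. lam \<epsilon> - lam0 - a * measure lebesgue (sph_cone k \<beta> - trunc_cone k \<beta> \<epsilon>) powr ((real CARD('n) + 2 * l - 2) / real CARD('n)))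
                    \<in> o[at_right 0](\<lambda>\<epsilon>. measure lebesgue (sph_cone k \<beta> - trunc_cone k \<beta> \<epsilon>) powr ((real CARD('n) + 2 * l - 2) / real CARD('n))))"
    proof (intro exI conjI)
      show "\<epsilon>0 > 0" "r > 0" "(lam \<longlongrightarrow> lam0) (at_right 0)" using P by auto
      show "\<forall>\<epsilon> \<in> {0<..<\<epsilon>0}. \<forall>\<mu>.
              (0 < \<mu> \<and> \<bar>\<mu> - lam0\<bar> < r \<and>
               bessel_J \<nu> (sqrt \<mu>) * bessel_Y \<nu> (\<epsilon> * sqrt \<mu>)
               - bessel_Y \<nu> (sqrt \<mu>) * bessel_J \<nu> (\<epsilon> * sqrt \<mu>) = 0)
              \<longleftrightarrow> \<mu> = lam \<epsilon>"
        using P(4) unfolding cross_def .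
      show "A / ?D l > 0" using P(3) D[of l] by simp
      show "(\<lambda>\<epsilon>. lam \<epsilon> - lam0 - A / ?D l * measure lebesgue (sph_cone k \<beta> - trunc_cone k \<beta> \<epsilon>) powr ((real CARD('n) + 2 * l - 2) / real CARD('n)))
                    \<in> o[at_right 0](\<lambda>\<epsilon>. measure lebesgue (sph_cone k \<beta> - trunc_cone k \<beta> \<epsilon>) powr ((real CARD('n) + 2 * l - 2) / real CARD('n)))"
        by (rule smallo_of_tendsto_quotient[OF P(6)[unfolded o] removed_volume_powr D])
    qed
  next
    obtain l where l: "l > 0" "least_exponent k \<beta> = l"
      "zonal (real CARD('n)) (sphere_eigval l) (cos \<beta>) = 0"
      "\<And>t. cos \<beta> < t \<Longrightarrow> t \<le> 1 \<Longrightarrow> zonal (real CARD('n)) (sphere_eigval l) t > 0"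
      using least_exponent by blast
    obtain A where A: "A > 0"
      "((\<lambda>\<epsilon>. (dirichlet_lambda1 (trunc_cone k \<beta> \<epsilon>) - dirichlet_lambda1 (sph_cone k \<beta>)) / \<epsilon> powr (2 * bessel_index l)) \<longlongrightarrow> A) (at_right 0)"
      using lambda1_cone_asymptotics[OF l(1,3,4)] by blast
    show "\<exists>b>0. (\<lambda>\<epsilon>. dirichlet_lambda1 (trunc_cone k \<beta> \<epsilon>) - dirichlet_lambda1 (sph_cone k \<beta>)
                       - b * measure lebesgue (sph_cone k \<beta> - trunc_cone k \<beta> \<epsilon>) powr ((real CARD('n) + 2 * least_exponent k \<beta> - 2) / real CARD('n)))
                \<in> o[at_right 0](\<lambda>\<epsilon>. measure lebesgue (sph_cone k \<beta> - trunc_cone k \<beta> \<epsilon>) powr ((real CARD('n) + 2 * least_exponent k \<beta> - 2) / real CARD('n)))"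
      unfolding l(2)
    proof (intro exI conjI)
      show "A / ?D l > 0" using A(1) D[of l] by simp
      show "(\<lambda>\<epsilon>. dirichlet_lambda1 (trunc_cone k \<beta> \<epsilon>) - dirichlet_lambda1 (sph_cone k \<beta>)
                       - A / ?D l * measure lebesgue (sph_cone k \<beta> - trunc_cone k \<beta> \<epsilon>) powr ((real CARD('n) + 2 * l - 2) / real CARD('n)))
                \<in> o[at_right 0](\<lambda>\<epsilon>. measure lebesgue (sph_cone k \<beta> - trunc_cone k \<beta> \<epsilon>) powr ((real CARD('n) + 2 * l - 2) / real CARD('n)))"
        by (rule smallo_of_tendsto_quotient[OF A(2) removed_volume_powr D])
    qed
  qed
qed

end
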